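(* Let $d$ be a positive integer. Suppose that for every $\eta,\epsilon>0$ there exist $c>0$, $\delta>0$ and a positive integer $l$ such that for all positive integers $n_1,\dots,n_d$ the following holds with $\mathcal G=\mathbb F_2^{n_1}\otimes\dots\otimes\mathbb F_2^{n_d}$ and $B\subset\mathcal G$ the set of rank-1 tensors: for every $\mathcal A\subset\mathcal G$ that is $(B,\eta)$-closed, there are a subset $B'\subset B$ and a non-empty subset $\mathcal C\subset\mathcal G$ such that (1) $|B'|\ge\delta|B|$; (2) $\mathcal C$ is $(B',1-\epsilon)$-closed; (3) for every $x\in\mathcal C$, the probability that $x-b_1-\dots-b_l\in\mathcal A$, when $b_1,\dots,b_l$ are chosen uniformly and independently at random from $B$, is at least $c$. Then for any $\eta>0$ there exist $k=k(d,\eta)$ and $\rho=\rho(d,\eta)>0$ with the following property: for all positive integers $n_1,\dots,n_d$ and every $\eta$-closed $\mathcal A\subset\mathbb F_2^{n_1}\otimes\dots\otimes\mathbb F_2^{n_d}$, there is a $k$-simple set $\mathcal D$ such that $|\mathcal A\cap\mathcal D|\ge\rho|\mathcal D|$.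
   Context: Rank-1 tensors are the tensors $u_1\otimes\dots\otimes u_d$ with $u_i\in\mathbb F_2^{n_i}\setminus\{0\}$ for all $i$. For finite non-empty subsets $A,B$ of an Abelian group, $A$ is $(B,\eta)$-closed if $|\{(a,b)\in A\times B:a+b\in A\}|\ge\eta|A||B|$. A set $\mathcal A\subset\mathbb F_2^{n_1}\otimes\dots\otimes\mathbb F_2^{n_d}$ is $\eta$-closed if it is $(B,\eta)$-closed for $B$ the set of rank-1 tensors. For a non-empty $I\subset[d]=\{1,\dots,d\}$ write $\mathbb F_2^I=\bigotimes_{i\in I}\mathbb F_2^{n_i}$ and $I^c=[d]\setminus I$, so that $\mathcal G=\mathbb F_2^I\otimes\mathbb F_2^{I^c}$ naturally. A set is $k$-simple if there exist subspaces $H_I\subset\mathbb F_2^I$ of codimension at most $k$, one for each non-empty $I\subset[d]$, such that the set is a translate of $\bigcap_{I\subset[d],I\ne\emptyset}(H_I\otimes\mathbb F_2^{I^c})$, where $H_{[d]}\otimes\mathbb F_2^{\emptyset}$ means $H_{[d]}$. *)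

theory Defs
  imports
    "HOL-Probability.Product_PMF"
    "HOL-Library.Z2"
    "HOL-Library.Function_Algebras"
begin

text \<open>
  A tensor is given by its coordinates in the standard basis. A basis vector of \<open>F\<^sub>2\<^sup>I\<close>, the tensor
  product over \<open>i \<in> I\<close> of the spaces of dimension \<open>n i\<close>, is a multi-index
  \<open>x \<in> (\<Pi>\<^sub>E i\<in>I. {..<n i})\<close>, and tensors are functions from multi-indices to the field \<^typ>\<open>bit\<close>
  of two elements that vanish outside this set. Addition is the pointwise one of
  \<open>HOL-Library.Function_Algebras\<close>.
\<close>

type_synonym tensor = "(nat \<Rightarrow> nat) \<Rightarrow> bit"

definition scale_fun :: "bit \<Rightarrow> ('a \<Rightarrow> bit) \<Rightarrow> 'a \<Rightarrow> bit" where
  "scale_fun c f = (\<lambda>x. c * f x)"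

global_interpretation F2: vector_space "scale_fun :: bit \<Rightarrow> ('a \<Rightarrow> bit) \<Rightarrow> 'a \<Rightarrow> bit"
  by unfold_locales
    (simp_all only: scale_fun_def fun_eq_iff plus_fun_apply distrib_left distrib_right
      mult.assoc mult_1_left simp_thms)

definition vec_space :: "nat \<Rightarrow> (nat \<Rightarrow> bit) set" where
  "vec_space m = {v. \<forall>j. j \<notin> {..<m} \<longrightarrow> v j = 0}"

definition tensor_space :: "(nat \<Rightarrow> nat) \<Rightarrow> nat set \<Rightarrow> tensor set" where
  "tensor_space n I = {f. \<forall>x. x \<notin> (\<Pi>\<^sub>E i\<in>I. {..<n i}) \<longrightarrow> f x = 0}"

definition pure_tensor :: "nat set \<Rightarrow> (nat \<Rightarrow> nat \<Rightarrow> bit) \<Rightarrow> tensor" where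
  "pure_tensor I u = (\<lambda>x. if x \<in> extensional I then \<Prod>i\<in>I. u i (x i) else 0)"

definition rank1_tensors :: "nat \<Rightarrow> (nat \<Rightarrow> nat) \<Rightarrow> tensor set" where
  "rank1_tensors d n =
     {pure_tensor {1..d} u | u. \<forall>i\<in>{1..d}. u i \<in> vec_space (n i) - {0}}"

definition closed_wrt :: "'a::ab_group_add set \<Rightarrow> real \<Rightarrow> 'a set \<Rightarrow> bool" where
  "closed_wrt B \<eta> A \<longleftrightarrow>
     finite A \<and> A \<noteq> {} \<and> finite B \<and> B \<noteq> {} \<and>
     real (card {(a, b). a \<in> A \<and> b \<in> B \<and> a + b \<in> A}) \<ge> \<eta> * real (card A) * real (card B)"

text \<open>For disjoint \<open>I\<close> and \<open>J\<close>: the product of tensors over \<open>I\<close> and \<open>J\<close>, and the tensor product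
  of two subspaces, both as a tensor (respectively a set of tensors) over \<open>I \<union> J\<close>.\<close>

definition tensor_prod :: "nat set \<Rightarrow> nat set \<Rightarrow> tensor \<Rightarrow> tensor \<Rightarrow> tensor" where
  "tensor_prod I J u v =
     (\<lambda>x. if x \<in> extensional (I \<union> J) then u (restrict x I) * v (restrict x J) else 0)"

definition subspace_prod :: "nat set \<Rightarrow> nat set \<Rightarrow> tensor set \<Rightarrow> tensor set \<Rightarrow> tensor set" where
  "subspace_prod I J U V = F2.span {tensor_prod I J u v | u v. u \<in> U \<and> v \<in> V}"

definition subspace_of_codim_le :: "tensor set \<Rightarrow> tensor set \<Rightarrow> nat \<Rightarrow> bool" where
  "subspace_of_codim_le H V k \<longleftrightarrow> F2.subspace H \<and> H \<subseteq> V \<and> F2.dim V \<le> F2.dim H + k"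

definition k_simple :: "nat \<Rightarrow> (nat \<Rightarrow> nat) \<Rightarrow> nat \<Rightarrow> tensor set \<Rightarrow> bool" where
  "k_simple d n k D \<longleftrightarrow>
     (\<exists>H. \<exists>t \<in> tensor_space n {1..d}.
        (\<forall>I. I \<subseteq> {1..d} \<and> I \<noteq> {} \<longrightarrow> subspace_of_codim_le (H I) (tensor_space n I) k) \<and>
        D = (\<lambda>x. t + x) `
              (\<Inter>I \<in> {I. I \<subseteq> {1..d} \<and> I \<noteq> {}}.
                 if I = {1..d} then H I
                 else subspace_prod I ({1..d} - I) (H I) (tensor_space n ({1..d} - I))))"

end

theory Submission imports Defs begin

text \<open>
  Let \<open>C\<close> be almost closed under a dense set \<open>B\<close> of rank-1 tensors. Then most of the \<open>L\<^sup>2\<close> mass of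
  the Fourier transform of \<open>C\<close> lies on tensors \<open>r\<close> that, viewed as multilinear forms, vanish on all
  but a small proportion \<open>\<epsilon>\<close> of \<open>B\<close>. If all such \<open>r\<close> lie in one space \<open>\<Sum>\<^sub>I V\<^sub>I \<otimes> F\<^sub>2\<^sup>I\<^sup>c\<close> with
  bounded \<open>dim V\<^sub>I\<close>, then \<open>C\<close> is dense in a coset of its annihilator, which is simple, and averaging
  over \<open>b\<^sub>1, \<dots>, b\<^sub>l\<close> transfers the density to the given set.

  The structure of the forms that nearly vanish on a dense set is found by induction on the index
  set \<open>I\<close>. A form is first written as itself, a one-term sum of products over the trivial partition
  of \<open>I\<close>. Maximal parts \<open>J\<close> are then removed one at a time: the factors over \<open>J\<close> which occur are, up
  to lower order terms, among boundedly many, by a second moment argument and the fact that biased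
  forms have bounded partition rank; and their cofactors nearly vanish on a dense set over
  \<open>I - J\<close>. Passing to differences within the fibres of the dense set kills the structured part
  found so far, so that the next \<open>J\<close> can be treated in the same way.
\<close>

section \<open>Multilinear forms over the field of two elements\<close>

text \<open>One asymmetry shapes every reduction: the admissible \<open>mass\<close> may shrink only
  by factors depending on the index set, while density bounds, numbers of terms and sizes of
  families may grow in any way. Restricting \<open>\<mu>\<close> to the common zeros of a family
  found earlier would violate this, since masses would be divided by the weight of the zero set,
  which depends on the family. Passing to differences avoids it: the mass of a multilinear form
  grows by at most 4 per coordinate, whatever the size of the family. The part removed has to be
  maximal because then, with the arguments off \<open>J\<close> fixed, every product without the
  part \<open>J\<close> is a product of two forms in disjoint non-empty groups of the arguments in
  \<open>J\<close>. Such terms are what partition rank counts, so they can be discarded when forms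
  over \<open>J\<close> are compared. They return only as products with parts strictly inside
  \<open>J\<close>, so the collection of parts shrinks.\<close>

declare add_bit_eq_xor [simp del] mult_bit_eq_and [simp del]

lemma bit_add_self [simp]: "b + b = (0 :: bit)"
  by (cases b) (simp_all add: add_bit_eq_xor)

type_synonym form = "(nat \<Rightarrow> nat \<Rightarrow> bit) \<Rightarrow> bit"

text \<open>The first clause makes \<open>f\<close> a function of the arguments indexed by
  \<open>I\<close>; additivity suffices because the only scalars are 0 and 1. Forms take arbitrary
  bit vectors, and dimensions enter only with \<open>vec_space\<close> and
  \<open>vecs\<close>.\<close>

definition multilinear :: "nat set \<Rightarrow> form \<Rightarrow> bool" where
  "multilinear I f \<longleftrightarrow>
     (\<forall>x y. (\<forall>i\<in>I. x i = y i) \<longrightarrow> f x = f y) \<and>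
     (\<forall>i\<in>I. \<forall>x a b. f (x(i := a + b)) = f (x(i := a)) + f (x(i := b)))"

definition vecs :: "(nat \<Rightarrow> nat) \<Rightarrow> nat set \<Rightarrow> (nat \<Rightarrow> nat \<Rightarrow> bit) set" where
  "vecs n I = (\<Pi>\<^sub>E i\<in>I. vec_space (n i))"

lemma bit_add_eq_1_iff: "a + b = 1 \<longleftrightarrow> (a = 1) \<noteq> (b = 1)" for a b :: bit
  by (cases a; cases b) auto

lemma multilinear_cong: "multilinear I f \<Longrightarrow> (\<And>i. i \<in> I \<Longrightarrow> x i = y i) \<Longrightarrow> f x = f y"
  by (auto simp: multilinear_def)

lemma multilinear_additive:
  "multilinear I f \<Longrightarrow> i \<in> I \<Longrightarrow> f (x(i := a + b)) = f (x(i := a)) + f (x(i := b))"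
  by (auto simp: multilinear_def)

lemma multilinear_zero: "multilinear I (\<lambda>_. 0)"
  by (simp add: multilinear_def)

lemma multilinear_const: "multilinear {} (\<lambda>_. c)"
  by (simp add: multilinear_def)

lemma multilinear_add:
  assumes "multilinear I f" "multilinear I g"
  shows "multilinear I (\<lambda>x. f x + g x)"
  unfolding multilinear_def
proof (intro conjI allI ballI impI)
  fix x y :: "nat \<Rightarrow> nat \<Rightarrow> bit" assume "\<forall>i\<in>I. x i = y i"
  then show "f x + g x = f y + g y"
    using multilinear_cong[OF assms(1), of x y] multilinear_cong[OF assms(2), of x y] by simp
next
  fix i x and a b :: "nat \<Rightarrow> bit" assume "i \<in> I"
  then show "f (x(i := a + b)) + g (x(i := a + b)) =
      f (x(i := a)) + g (x(i := a)) + (f (x(i := b)) + g (x(i := b)))"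
    by (simp only: multilinear_additive[OF assms(1)] multilinear_additive[OF assms(2)] ac_simps)
qed

lemma multilinear_sum:
  "(\<And>s. s \<in> S \<Longrightarrow> multilinear I (f s)) \<Longrightarrow> multilinear I (\<lambda>x. \<Sum>s\<in>S. f s x)"
  by (induction S rule: infinite_finite_induct) (auto intro: multilinear_zero multilinear_add)

lemma multilinear_sum_list:
  "(\<And>g. g \<in> set fs \<Longrightarrow> multilinear I g) \<Longrightarrow> multilinear I (\<lambda>x. \<Sum>g\<leftarrow>fs. g x)"
  by (induction fs) (auto intro: multilinear_zero multilinear_add)

lemma multilinear_scale: "multilinear I f \<Longrightarrow> multilinear I (\<lambda>x. c * f x)"
  unfolding multilinear_def by (metis distrib_left)

lemma multilinear_mult:
  assumes "multilinear I f" "multilinear J g" "I \<inter> J = {}"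
  shows "multilinear (I \<union> J) (\<lambda>x. f x * g x)"
  unfolding multilinear_def
proof (intro conjI allI ballI impI)
  fix x y :: "nat \<Rightarrow> nat \<Rightarrow> bit" assume "\<forall>i\<in>I \<union> J. x i = y i"
  then show "f x * g x = f y * g y"
    using multilinear_cong[OF assms(1), of x y] multilinear_cong[OF assms(2), of x y] by simp
next
  fix i x and a b :: "nat \<Rightarrow> bit" assume i: "i \<in> I \<union> J"
  show "f (x(i := a + b)) * g (x(i := a + b)) =
    f (x(i := a)) * g (x(i := a)) + f (x(i := b)) * g (x(i := b))"
  proof (cases "i \<in> I")
    case True
    then have "i \<notin> J" using assms(3) by auto
    then have "g (x(i := c)) = g x" for c
      by (intro multilinear_cong[OF assms(2)]) auto
    then show ?thesis using multilinear_additive[OF assms(1) True] by (simp add: distrib_right)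
  next
    case False
    then have "f (x(i := c)) = f x" for c
      by (intro multilinear_cong[OF assms(1)]) auto
    then show ?thesis using multilinear_additive[OF assms(2)] i False by (simp add: distrib_left)
  qed
qed

lemma multilinear_mult_Diff:
  "multilinear J f \<Longrightarrow> multilinear (I - J) g \<Longrightarrow> J \<subseteq> I \<Longrightarrow> multilinear I (\<lambda>x. f x * g x)"
  using multilinear_mult[of J f "I - J" g] by (simp add: Un_absorb1)

lemma multilinear_override:
  assumes "multilinear I f"
  shows "multilinear (I \<inter> J) (\<lambda>x. f (override_on y x J))"
  unfolding multilinear_def
proof (intro conjI allI ballI impI)
  fix x x' :: "nat \<Rightarrow> nat \<Rightarrow> bit" assume "\<forall>i\<in>I \<inter> J. x i = x' i"
  then show "f (override_on y x J) = f (override_on y x' J)"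
    by (intro multilinear_cong[OF assms]) (auto simp: override_on_def)
next
  fix i x and a b :: "nat \<Rightarrow> bit" assume i: "i \<in> I \<inter> J"
  have "override_on y (x(i := c)) J = (override_on y x J)(i := c)" for c
    using i by (auto simp: override_on_def)
  then show "f (override_on y (x(i := a + b)) J) =
     f (override_on y (x(i := a)) J) + f (override_on y (x(i := b)) J)"
    using i multilinear_additive[OF assms] by simp
qed

lemma multilinear_fun_upd:
  assumes "multilinear I f"
  shows "multilinear (I - {j}) (\<lambda>x. f (x(j := u)))"
  unfolding multilinear_def
proof (intro conjI allI ballI impI)
  fix x x' :: "nat \<Rightarrow> nat \<Rightarrow> bit" assume "\<forall>i\<in>I - {j}. x i = x' i"
  then show "f (x(j := u)) = f (x'(j := u))"
    by (intro multilinear_cong[OF assms]) auto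
next
  fix i x and a b :: "nat \<Rightarrow> bit" assume i: "i \<in> I - {j}"
  have "(x(i := c))(j := u) = (x(j := u))(i := c)" for c
    using i by auto
  then show "f ((x(i := a + b))(j := u)) = f ((x(i := a))(j := u)) + f ((x(i := b))(j := u))"
    using i multilinear_additive[OF assms] by simp
qed

section \<open>Counting tuples of vectors and splitting sums over coordinates\<close>

lemma vec_space_add: "a \<in> vec_space m \<Longrightarrow> b \<in> vec_space m \<Longrightarrow> a + b \<in> vec_space m"
  by (auto simp: vec_space_def)

lemma zero_in_vec_space [simp]: "0 \<in> vec_space m"
  by (auto simp: vec_space_def)

lemma bij_betw_vec_space: "bij_betw (\<lambda>S j. of_bool (j \<in> S)) (Pow {..<m}) (vec_space m)"
proof (rule bij_betw_byWitness[where f' = "\<lambda>v. {j. v j = 1}"])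
  show "\<forall>v\<in>vec_space m. (\<lambda>j. of_bool (j \<in> {j. v j = 1})) = v"
    by (auto simp: of_bool_def fun_eq_iff)
  show "(\<lambda>v. {j. v j = 1}) ` vec_space m \<subseteq> Pow {..<m}"
    by (force simp: vec_space_def)
qed (auto simp: vec_space_def)

lemma finite_vec_space [simp]: "finite (vec_space m)"
  using bij_betw_finite[OF bij_betw_vec_space] by simp

lemma card_vec_space: "card (vec_space m) = 2 ^ m"
  using bij_betw_same_card[OF bij_betw_vec_space, of m] by (simp add: card_Pow)

lemma finite_vecs: "finite I \<Longrightarrow> finite (vecs n I)"
  by (simp add: vecs_def finite_PiE)

lemma card_vecs_pos: "finite I \<Longrightarrow> card (vecs n I) > 0"
  by (simp add: vecs_def card_PiE card_vec_space prod_pos)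

lemma card_vecs_split:
  "finite I \<Longrightarrow> J \<subseteq> I \<Longrightarrow> card (vecs n I) = card (vecs n (I - J)) * card (vecs n J)"
  by (simp add: vecs_def card_PiE finite_subset prod.subset_diff)

lemma override_on_in_vecs:
  "J \<subseteq> I \<Longrightarrow> y \<in> vecs n (I - J) \<Longrightarrow> x \<in> vecs n J \<Longrightarrow> override_on y x J \<in> vecs n I"
  by (auto simp: vecs_def PiE_iff extensional_def override_on_def)

lemma sum_PiE_split:
  assumes "J \<subseteq> I"
  shows "(\<Sum>x\<in>PiE I X. F x) = (\<Sum>y\<in>PiE (I - J) X. \<Sum>x\<in>PiE J X. F (override_on y x J))"
  unfolding sum.cartesian_product
  by (rule sum.reindex_bij_witness[of _ "\<lambda>(y, x). override_on y x J"
        "\<lambda>x. (restrict x (I - J), restrict x J)"])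
    (use assms in \<open>auto simp: PiE_iff extensional_def override_on_def restrict_def fun_eq_iff
       intro!: arg_cong[where f = F]\<close>)

lemma sum_vecs_split:
  "J \<subseteq> I \<Longrightarrow>
    (\<Sum>x\<in>vecs n I. F x) = (\<Sum>y\<in>vecs n (I - J). \<Sum>x\<in>vecs n J. F (override_on y x J))"
  unfolding vecs_def by (rule sum_PiE_split)

lemma sum_vecs_fun_upd:
  fixes F :: "_ \<Rightarrow> 'c::comm_monoid_add"
  assumes "i \<in> I"
  shows "(\<Sum>x\<in>vecs n I. F x) = (\<Sum>y\<in>vecs n (I - {i}). \<Sum>a\<in>vec_space (n i). F (y(i := a)))"
proof -
  have "bij_betw (\<lambda>a. (\<lambda>j. undefined)(i := a)) (vec_space (n i)) (vecs n {i})"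
    by (rule bij_betw_byWitness[where f' = "\<lambda>x. x i"])
      (auto simp: vecs_def PiE_iff extensional_def fun_eq_iff)
  from sum.reindex_bij_betw[OF this]
  have "(\<Sum>x\<in>vecs n {i}. G x) = (\<Sum>a\<in>vec_space (n i). G ((\<lambda>j. undefined)(i := a)))"
    for G :: "_ \<Rightarrow> 'c"
    by metis
  moreover have "override_on y ((\<lambda>j. undefined)(i := a)) {i} = y(i := a)"
    for y :: "nat \<Rightarrow> nat \<Rightarrow> bit" and a
    by (auto simp: override_on_def)
  ultimately show ?thesis
    using sum_vecs_split[of "{i}" I F n] assms by simp
qed

section \<open>Sums of products of forms\<close>

text \<open>A list, since equal terms cancel over F2 while a set would merge them; an upper bound on
  the length, so that bounds can be relaxed.\<close>

definition sum_of :: "(form \<Rightarrow> bool) \<Rightarrow> nat \<Rightarrow> form \<Rightarrow> bool" where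
  "sum_of P t f \<longleftrightarrow>
     (\<exists>fs. length fs \<le> t \<and> (\<forall>g\<in>set fs. P g) \<and> f = (\<lambda>x. \<Sum>g\<leftarrow>fs. g x))"

lemma sum_of_zero: "sum_of P t (\<lambda>_. 0)"
  unfolding sum_of_def by (rule exI[of _ "[]"]) auto

lemma sum_of_single: "P f \<Longrightarrow> sum_of P 1 f"
  unfolding sum_of_def by (rule exI[of _ "[f]"]) auto

lemma sum_of_mono: "sum_of P t f \<Longrightarrow> t \<le> t' \<Longrightarrow> sum_of P t' f"
  unfolding sum_of_def by (blast intro: le_trans)

lemma sum_of_add:
  assumes "sum_of P t f" "sum_of P t' g"
  shows "sum_of P (t + t') (\<lambda>x. f x + g x)"
proof -
  from assms obtain fs gs where
    "length fs \<le> t" "\<forall>g\<in>set fs. P g" "f = (\<lambda>x. \<Sum>g\<leftarrow>fs. g x)"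
    "length gs \<le> t'" "\<forall>g\<in>set gs. P g" "g = (\<lambda>x. \<Sum>g\<leftarrow>gs. g x)"
    unfolding sum_of_def by blast
  then show ?thesis unfolding sum_of_def by (intro exI[of _ "fs @ gs"]) auto
qed

lemma sum_of_sum:
  assumes "finite S" "\<And>s. s \<in> S \<Longrightarrow> sum_of P t (f s)"
  shows "sum_of P (card S * t) (\<lambda>x. \<Sum>s\<in>S. f s x)"
  using assms
proof (induction S rule: finite_induct)
  case empty
  then show ?case by (simp add: sum_of_zero)
next
  case (insert a S)
  then show ?case using sum_of_add[of P t "f a" "card S * t"] by simp
qed

lemma sum_of_induct [consumes 1, case_names zero add]:
  assumes "sum_of P t f" "\<And>t. Q t (\<lambda>_. 0)"
    "\<And>g f t. P g \<Longrightarrow> sum_of P t f \<Longrightarrow> Q t f \<Longrightarrow> Q (Suc t) (\<lambda>x. g x + f x)"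
  shows "Q t f"
proof -
  have "length fs \<le> t \<Longrightarrow> \<forall>g\<in>set fs. P g \<Longrightarrow> Q t (\<lambda>x. \<Sum>g\<leftarrow>fs. g x)" for fs t
  proof (induction fs arbitrary: t)
    case Nil
    then show ?case using assms(2) by simp
  next
    case (Cons a fs)
    then obtain t' where t: "t = Suc t'" "length fs \<le> t'" by (cases t) auto
    then have "sum_of P t' (\<lambda>x. \<Sum>g\<leftarrow>fs. g x)"
      using Cons.prems by (auto simp: sum_of_def)
    with Cons t assms(3)[of a t' "\<lambda>x. \<Sum>g\<leftarrow>fs. g x"] show ?case by auto
  qed
  with assms(1) show ?thesis unfolding sum_of_def by blast
qed

lemma sum_of_mult:
  assumes "sum_of P t f" "sum_of Q t' g" "\<And>f g. P f \<Longrightarrow> Q g \<Longrightarrow> R (\<lambda>x. f x * g x)"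
  shows "sum_of R (t * t') (\<lambda>x. f x * g x)"
  using assms(1)
proof (induction rule: sum_of_induct)
  case (zero t)
  then show ?case by (simp add: sum_of_zero)
next
  case (add h f t)
  have "sum_of R t' (\<lambda>x. h x * g x)"
    using assms(2)
  proof (induction rule: sum_of_induct)
    case (zero t)
    then show ?case by (simp add: sum_of_zero)
  next
    case (add g' g t)
    then show ?case
      using sum_of_add[OF sum_of_single[of R, OF assms(3)], of h g' t] \<open>P h\<close>
      by (simp add: distrib_left)
  qed
  with add show ?case using sum_of_add[of R t'] by (simp add: distrib_right)
qed

lemma multilinear_sum_of:
  "sum_of P t f \<Longrightarrow> (\<And>g. P g \<Longrightarrow> multilinear I g) \<Longrightarrow> multilinear I f"
  by (auto simp: sum_of_def intro!: multilinear_sum_list)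

text \<open>The parts are non-empty and disjoint, hence form a partition of the index set in which
  none repeats. The constant 1 is available only over the empty index set.\<close>

inductive product_form :: "nat set set \<Rightarrow> nat set \<Rightarrow> form \<Rightarrow> bool" for \<J> where
  empty: "product_form \<J> {} (\<lambda>_. 1)"
| mult: "J \<in> \<J> \<Longrightarrow> J \<noteq> {} \<Longrightarrow> J \<inter> I = {} \<Longrightarrow> multilinear J a \<Longrightarrow> product_form \<J> I g \<Longrightarrow>
    product_form \<J> (I \<union> J) (\<lambda>x. a x * g x)"

lemma product_form_multilinear: "product_form \<J> I f \<Longrightarrow> multilinear I f"
proof (induction rule: product_form.induct)
  case empty
  then show ?case by (rule multilinear_const)
next
  case (mult J I a g)
  then show ?case using multilinear_mult[of J a I g] by (simp add: Un_commute)
qed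

lemma product_form_single: "J \<in> \<J> \<Longrightarrow> J \<noteq> {} \<Longrightarrow> multilinear J a \<Longrightarrow> product_form \<J> J a"
  using product_form.mult[OF _ _ _ _ product_form.empty, of J \<J> a] by simp

lemma product_form_mult:
  assumes "product_form \<J> I f" "product_form \<J> I' g" "I \<inter> I' = {}"
  shows "product_form \<J> (I \<union> I') (\<lambda>x. f x * g x)"
  using assms(1,3)
proof (induction rule: product_form.induct)
  case empty
  then show ?case using assms(2) by simp
next
  case (mult J I a h)
  have "product_form \<J> (I \<union> I') (\<lambda>x. h x * g x)"
    by (rule mult.IH) (use mult.prems in auto)
  then have "product_form \<J> ((I \<union> I') \<union> J) (\<lambda>x. a x * (h x * g x))"
    by (rule product_form.mult[rotated -1]) (use mult.hyps mult.prems in auto)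
  then show ?case by (simp add: mult.assoc Un_ac)
qed

text \<open>Disjoint non-empty parts cannot repeat, so once the factor over \<open>J\<close> is
  pulled out, the rest uses \<open>\<J> - {J}\<close> only.\<close>

lemma product_form_extract:
  assumes "product_form \<J> I f" "J \<noteq> {}"
  shows "product_form (\<J> - {J}) I f \<or>
    (\<exists>a b. J \<subseteq> I \<and> multilinear J a \<and> product_form (\<J> - {J}) (I - J) b \<and> f = (\<lambda>x. a x * b x))"
  using assms(1)
proof (induction rule: product_form.induct)
  case empty
  then show ?case using product_form.empty by blast
next
  case (mult J0 I a g)
  show ?case
  proof (cases "J0 = J")
    case True
    have "product_form (\<J> - {J}) I g"
      using mult.IH mult.hyps True by auto
    moreover have "(I \<union> J0) - J = I" using mult.hyps True by auto
    ultimately have "J \<subseteq> I \<union> J0 \<and> multilinear J a \<and> product_form (\<J> - {J}) ((I \<union> J0) - J) g \<and>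
       (\<lambda>x. a x * g x) = (\<lambda>x. a x * g x)" using True mult.hyps by simp
    then show ?thesis by blast
  next
    case False
    from mult.IH show ?thesis
    proof
      assume "product_form (\<J> - {J}) I g"
      then have "product_form (\<J> - {J}) (I \<union> J0) (\<lambda>x. a x * g x)"
        using mult.hyps False by (intro product_form.mult) auto
      then show ?thesis by blast
    next
      assume "\<exists>a b. J \<subseteq> I \<and> multilinear J a \<and> product_form (\<J> - {J}) (I - J) b \<and>
        g = (\<lambda>x. a x * b x)"
      then obtain a' b where *: "J \<subseteq> I" "multilinear J a'" "product_form (\<J> - {J}) (I - J) b"
        "g = (\<lambda>x. a' x * b x)" by blast
      have "product_form (\<J> - {J}) ((I - J) \<union> J0) (\<lambda>x. a x * b x)"
        using mult.hyps False * by (intro product_form.mult) auto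
      moreover have "(I - J) \<union> J0 = (I \<union> J0) - J" using * mult.hyps by auto
      ultimately have "J \<subseteq> I \<union> J0 \<and> multilinear J a' \<and>
         product_form (\<J> - {J}) ((I \<union> J0) - J) (\<lambda>x. a x * b x) \<and>
         (\<lambda>x. a x * g x) = (\<lambda>x. a' x * (a x * b x))"
        using * by (auto simp: fun_eq_iff)
      then show ?thesis by blast
    qed
  qed
qed

text \<open>The forms of partition rank one: \<open>sum_of (split_form J) t\<close> says that the
  partition rank is at most \<open>t\<close>. Over a singleton there are none, so only the zero form
  is such a sum.\<close>

definition split_form :: "nat set \<Rightarrow> form \<Rightarrow> bool" where
  "split_form J f \<longleftrightarrow> (\<exists>K g h. K \<subset> J \<and> K \<noteq> {} \<and> multilinear K g \<and> multilinear (J - K) h \<and>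
     f = (\<lambda>x. g x * h x))"

lemma split_form_multilinear: "split_form J f \<Longrightarrow> multilinear J f"
  unfolding split_form_def by (auto intro!: multilinear_mult_Diff)

lemma split_form_product_form:
  assumes "split_form J f" "\<And>K. K \<subset> J \<Longrightarrow> K \<noteq> {} \<Longrightarrow> K \<in> \<J>"
  shows "product_form \<J> J f"
proof -
  obtain K g h where *: "K \<subset> J" "K \<noteq> {}" "multilinear K g" "multilinear (J - K) h"
     "f = (\<lambda>x. g x * h x)" using assms(1) unfolding split_form_def by blast
  have "product_form \<J> (K \<union> (J - K)) (\<lambda>x. g x * h x)"
    by (intro product_form_mult product_form_single assms) (use * in auto)
  moreover have "K \<union> (J - K) = J" using * by auto
  ultimately show ?thesis using * by simp
qed

text \<open>The parts cover \<open>I\<close>, so one of them meets \<open>J\<close>. It cannot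
  contain \<open>J\<close>, and it serves as \<open>K\<close>, with all other factors collected in
  \<open>h\<close>.\<close>

lemma product_form_split:
  assumes "product_form \<J> I f" "\<And>K. K \<in> \<J> \<Longrightarrow> \<not> J \<subseteq> K" "J \<subseteq> I" "J \<noteq> {}"
  shows "\<exists>K g h. K \<subseteq> I \<and> K \<inter> J \<noteq> {} \<and> \<not> J \<subseteq> K \<and> multilinear K g \<and> multilinear (I - K) h \<and>
     f = (\<lambda>x. g x * h x)"
  using assms(1,3)
proof (induction rule: product_form.induct)
  case empty
  then show ?case using assms(4) by simp
next
  case (mult J0 I a g)
  show ?case
  proof (cases "J0 \<inter> J = {}")
    case False
    moreover have "(I \<union> J0) - J0 = I" using mult.hyps by auto
    ultimately show ?thesis using mult.hyps assms(2) product_form_multilinear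
      by (intro exI[of _ J0] exI[of _ a] exI[of _ g]) auto
  next
    case True
    then have "J \<subseteq> I" using mult.prems by auto
    from mult.IH[OF this] obtain K g' h where *: "K \<subseteq> I" "K \<inter> J \<noteq> {}" "\<not> J \<subseteq> K"
      "multilinear K g'" "multilinear (I - K) h" "g = (\<lambda>x. g' x * h x)" by blast
    have "multilinear (J0 \<union> (I - K)) (\<lambda>x. a x * h x)"
      using mult.hyps * by (intro multilinear_mult) auto
    moreover have "J0 \<union> (I - K) = (I \<union> J0) - K" using mult.hyps * by auto
    ultimately show ?thesis using *
      by (intro exI[of _ K] exI[of _ g'] exI[of _ "\<lambda>x. a x * h x"]) (auto simp: fun_eq_iff)
  qed
qed

text \<open>The part \<open>K\<close> meets \<open>J\<close> without containing it, so when the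
  arguments off \<open>J\<close> are frozen at \<open>y\<close>, both \<open>K \<inter> J\<close>
  and its complement in \<open>J\<close> are non-empty.\<close>

lemma product_form_override_split:
  assumes "product_form \<J> I f" "\<And>K. K \<in> \<J> \<Longrightarrow> \<not> J \<subseteq> K" "J \<subseteq> I" "J \<noteq> {}"
  shows "split_form J (\<lambda>x. f (override_on y x J))"
proof -
  obtain K g h where *: "K \<subseteq> I" "K \<inter> J \<noteq> {}" "\<not> J \<subseteq> K" "multilinear K g" "multilinear (I - K) h"
     "f = (\<lambda>x. g x * h x)" using product_form_split[OF assms] by blast
  have "J - K \<inter> J = (I - K) \<inter> J" using assms(3) by auto
  then show ?thesis unfolding split_form_def
    using * multilinear_override[OF *(4), of J y] multilinear_override[OF *(5), of J y]
    by (intro exI[of _ "K \<inter> J"] exI[of _ "\<lambda>x. g (override_on y x J)"]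
      exI[of _ "\<lambda>x. h (override_on y x J)"]) auto
qed

section \<open>Structured spaces of forms\<close>

definition unit_vec :: "nat \<Rightarrow> nat \<Rightarrow> bit" where
  "unit_vec i = (\<lambda>k. of_bool (k = i))"

lemma unit_vec_in_vec_space: "i < m \<Longrightarrow> unit_vec i \<in> vec_space m"
  by (auto simp: unit_vec_def vec_space_def)

lemma sum_fun_apply: "(\<Sum>s\<in>S. f s) x = (\<Sum>s\<in>S. f s x)"
  for f :: "'a \<Rightarrow> 'b \<Rightarrow> 'c::comm_monoid_add"
  by (induction S rule: infinite_finite_induct) auto

lemma multilinear_upd_zero: "multilinear I f \<Longrightarrow> i \<in> I \<Longrightarrow> f (x(i := 0)) = 0"
  using multilinear_additive[of I f i x 0 0] by simp

lemma multilinear_upd_sum: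
  assumes "multilinear I f" "i \<in> I"
  shows "f (x(i := \<Sum>s\<in>S. a s)) = (\<Sum>s\<in>S. f (x(i := a s)))"
  by (induction S rule: infinite_finite_induct)
    (simp_all only: sum.infinite sum.empty sum.insert multilinear_upd_zero[OF assms]
      multilinear_additive[OF assms] simp_thms)

lemma vec_space_expand:
  assumes "v \<in> vec_space m"
  shows "v = (\<Sum>k<m. scale_fun (v k) (unit_vec k))"
proof
  fix j
  have "(\<Sum>k<m. v k * (of_bool (j = k))) = (\<Sum>k<m. if k = j then v k else 0)"
    by (intro sum.cong) auto
  also have "\<dots> = v j" using assms by (auto simp: vec_space_def)
  finally show "v j = (\<Sum>k<m. scale_fun (v k) (unit_vec k)) j"
    by (simp add: sum_fun_apply scale_fun_def unit_vec_def)
qed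

lemma scale_fun_0 [simp]: "scale_fun 0 f = 0" and scale_fun_1 [simp]: "scale_fun 1 f = f"
  by (auto simp: scale_fun_def fun_eq_iff)

lemma multilinear_upd_scale:
  assumes "multilinear I f" "i \<in> I"
  shows "f (x(i := scale_fun c a)) = c * f (x(i := a))"
  by (cases c) (simp_all only: scale_fun_0 scale_fun_1 mult_zero_left mult_1_left
      multilinear_upd_zero[OF assms])

lemma multilinear_expand_coord:
  assumes "multilinear I f" "i \<in> I" "x i \<in> vec_space m"
  shows "f x = (\<Sum>k<m. x i k * f (x(i := unit_vec k)))"
proof -
  have "f x = f (x(i := \<Sum>k<m. scale_fun (x i k) (unit_vec k)))"
    using vec_space_expand[OF assms(3)] by simp
  then show ?thesis
    by (simp add: multilinear_upd_sum[OF assms(1,2)] multilinear_upd_scale[OF assms(1,2)])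
qed

section \<open>Bounded densities and structured families\<close>

definition chi :: "bit \<Rightarrow> real" where
  "chi b = (if b = 0 then 1 else -1)"

lemma chi_0 [simp]: "chi 0 = 1" and chi_1 [simp]: "chi 1 = -1"
  by (simp_all add: chi_def)

lemma chi_add: "chi (a + b) = chi a * chi b"
  by (cases a; cases b) simp_all

lemma chi_eq: "chi b = 1 - 2 * of_bool (b = 1)"
  by (cases b) simp_all

text \<open>The normalised indicator of a set of relative density at least \<open>1 / M\<close> is
  the model case. General weights are used because marginals and laws of differences are no longer
  indicators.\<close>

definition bounded_density ::
  "(nat \<Rightarrow> nat) \<Rightarrow> nat set \<Rightarrow> real \<Rightarrow> ((nat \<Rightarrow> nat \<Rightarrow> bit) \<Rightarrow> real) \<Rightarrow> bool" where
  "bounded_density n I M \<mu> \<longleftrightarrow>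
     (\<forall>x\<in>vecs n I. 0 \<le> \<mu> x \<and> \<mu> x * card (vecs n I) \<le> M) \<and> (\<Sum>x\<in>vecs n I. \<mu> x) = 1"

definition mass ::
  "(nat \<Rightarrow> nat) \<Rightarrow> nat set \<Rightarrow> ((nat \<Rightarrow> nat \<Rightarrow> bit) \<Rightarrow> real) \<Rightarrow> form \<Rightarrow> real" where
  "mass n I \<mu> f = (\<Sum>x\<in>vecs n I. \<mu> x * of_bool (f x = 1))"

definition family :: "nat set \<Rightarrow> nat \<Rightarrow> (nat set \<times> form) set \<Rightarrow> bool" where
  "family I k \<V> \<longleftrightarrow> finite \<V> \<and> card \<V> \<le> k \<and>
     (\<forall>p\<in>\<V>. fst p \<subseteq> I \<and> fst p \<noteq> {} \<and> multilinear (fst p) (snd p))"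

text \<open>The forms agreeing, on vectors of the right dimensions, with an element of
  \<open>\<Sum>\<^sub>J V\<^sub>J \<otimes> F\<^sub>2\<^sup>I\<^sup>-\<^sup>J\<close>, where \<open>V\<^sub>J\<close> is spanned by the \<open>v\<close> with \<open>(J, v) \<in> \<V>\<close>.\<close>

definition in_span ::
  "(nat \<Rightarrow> nat) \<Rightarrow> nat set \<Rightarrow> (nat set \<times> form) set \<Rightarrow> form \<Rightarrow> bool" where
  "in_span n I \<V> r \<longleftrightarrow> (\<exists>c. (\<forall>p\<in>\<V>. multilinear (I - fst p) (c p)) \<and>
     (\<forall>x\<in>Pi I (\<lambda>i. vec_space (n i)). r x = (\<Sum>p\<in>\<V>. snd p x * c p x)))"

lemma in_span_cong:
  "in_span n I \<V> r \<Longrightarrow> (\<And>x. x \<in> Pi I (\<lambda>i. vec_space (n i)) \<Longrightarrow> r' x = r x) \<Longrightarrow> in_span n I \<V> r'"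
  unfolding in_span_def by simp

lemma in_span_zero: "in_span n I \<V> (\<lambda>_. 0)"
  unfolding in_span_def by (rule exI[of _ "\<lambda>_ _. 0"]) (simp add: multilinear_zero)

lemma in_span_add:
  assumes "in_span n I \<V> r" "in_span n I \<V> r'"
  shows "in_span n I \<V> (\<lambda>x. r x + r' x)"
proof -
  from assms obtain c c' where
    "\<forall>p\<in>\<V>. multilinear (I - fst p) (c p)" "\<forall>p\<in>\<V>. multilinear (I - fst p) (c' p)"
    "\<forall>x\<in>Pi I (\<lambda>i. vec_space (n i)). r x = (\<Sum>p\<in>\<V>. snd p x * c p x)"
    "\<forall>x\<in>Pi I (\<lambda>i. vec_space (n i)). r' x = (\<Sum>p\<in>\<V>. snd p x * c' p x)"
    unfolding in_span_def by blast
  then show ?thesis unfolding in_span_def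
    by (intro exI[of _ "\<lambda>p x. c p x + c' p x"])
      (simp add: multilinear_add distrib_left sum.distrib)
qed

lemma in_span_sum:
  "(\<And>s. s \<in> S \<Longrightarrow> in_span n I \<V> (r s)) \<Longrightarrow> in_span n I \<V> (\<lambda>x. \<Sum>s\<in>S. r s x)"
  by (induction S rule: infinite_finite_induct) (auto intro: in_span_zero in_span_add)

lemma in_span_mono:
  assumes "in_span n I \<V> r" "\<V> \<subseteq> \<W>" "finite \<W>"
  shows "in_span n I \<W> r"
proof -
  from assms obtain c where *: "\<forall>p\<in>\<V>. multilinear (I - fst p) (c p)"
    "\<forall>x\<in>Pi I (\<lambda>i. vec_space (n i)). r x = (\<Sum>p\<in>\<V>. snd p x * c p x)"
    unfolding in_span_def by blast
  have "(\<Sum>p\<in>\<W>. snd p x * (if p \<in> \<V> then c p x else 0)) = (\<Sum>p\<in>\<V>. snd p x * c p x)" for x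
    using assms by (intro sum.mono_neutral_cong_right) auto
  moreover have "multilinear (I - fst p) (\<lambda>x. if p \<in> \<V> then c p x else 0)" for p
    using * by (cases "p \<in> \<V>") (auto intro: multilinear_zero)
  ultimately show ?thesis using * unfolding in_span_def
    by (intro exI[of _ "\<lambda>p x. if p \<in> \<V> then c p x else 0"]) simp
qed

lemma in_span_member:
  assumes "finite \<V>" "(J, v) \<in> \<V>" "multilinear (I - J) b"
  shows "in_span n I \<V> (\<lambda>x. v x * b x)"
  unfolding in_span_def
proof (intro exI conjI ballI)
  show "multilinear (I - fst p) (\<lambda>x. if p = (J, v) then b x else 0)" for p
    using assms(3) by (cases "p = (J, v)") (auto intro: multilinear_zero)
  have "(\<Sum>p\<in>\<V>. snd p x * (if p = (J, v) then b x else 0)) =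
      (\<Sum>p\<in>\<V>. if p = (J, v) then v x * b x else 0)" for x
    by (intro sum.cong) auto
  then show "v x * b x = (\<Sum>p\<in>\<V>. snd p x * (if p = (J, v) then b x else 0))" for x
    using assms(1,2) by simp
qed

lemma in_span_mult:
  assumes "in_span n K \<V> r" "multilinear J a" "K \<inter> J = {}" "\<And>p. p \<in> \<V> \<Longrightarrow> fst p \<subseteq> K"
  shows "in_span n (K \<union> J) \<V> (\<lambda>x. a x * r x)"
proof -
  from assms obtain c where *: "\<forall>p\<in>\<V>. multilinear (K - fst p) (c p)"
    "\<forall>x\<in>Pi K (\<lambda>i. vec_space (n i)). r x = (\<Sum>p\<in>\<V>. snd p x * c p x)"
    unfolding in_span_def by blast
  have "multilinear ((K \<union> J) - fst p) (\<lambda>x. a x * c p x)" if "p \<in> \<V>" for p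
  proof -
    have "multilinear (J \<union> (K - fst p)) (\<lambda>x. a x * c p x)"
      using * that assms by (intro multilinear_mult) auto
    moreover have "J \<union> (K - fst p) = (K \<union> J) - fst p" using assms(3) assms(4)[OF that] by blast
    ultimately show ?thesis by simp
  qed
  with * show ?thesis unfolding in_span_def
    by (intro exI[of _ "\<lambda>p x. a x * c p x"]) (auto simp: sum_distrib_left ac_simps)
qed

text \<open>Let \<open>g\<close> be the sum of the signs of all members. Its
  \<open>\<nu>\<close>-average is at least 3/4 of \<open>card T\<close>, as each member vanishes on
  7/8 of the weight. Its uniform second moment is nearly that of orthogonal signs, and
  \<open>\<nu>\<close> exceeds the uniform weight by at most the factor \<open>L\<close>. Comparing
  the two bounds \<open>card T\<close>.\<close>

lemma separated_card_le:
  fixes f :: "'b \<Rightarrow> 'a \<Rightarrow> bit" and \<nu> :: "'a \<Rightarrow> real" and W B L :: real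
  assumes fin: "finite X" "finite T" and L: "L > 0" and W: "W = (\<Sum>x\<in>X. \<nu> x)" "W > 0"
    and \<nu>: "\<And>x. x \<in> X \<Longrightarrow> 0 \<le> \<nu> x" "\<And>x. x \<in> X \<Longrightarrow> \<nu> x \<le> B" and BL: "B * card X \<le> L * W"
    and small: "\<And>p. p \<in> T \<Longrightarrow> (\<Sum>x\<in>X. \<nu> x * of_bool (f p x = 1)) \<le> W / 8"
    and sep: "\<And>p q. p \<in> T \<Longrightarrow> q \<in> T \<Longrightarrow> p \<noteq> q \<Longrightarrow>
      (\<Sum>x\<in>X. chi (f p x + f q x)) \<le> 1 / (4 * L) * card X"
  shows "card T \<le> 4 * L"
proof (cases "T = {}")
  case False
  define m where "m = real (card T)"
  have m: "m > 0" using False fin by (simp add: m_def card_gt_0_iff)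
  define g where "g x = (\<Sum>p\<in>T. chi (f p x))" for x
  have "3/4 * W \<le> (\<Sum>x\<in>X. \<nu> x * chi (f p x))" if "p \<in> T" for p
  proof -
    have "(\<Sum>x\<in>X. \<nu> x * chi (f p x)) = W - 2 * (\<Sum>x\<in>X. \<nu> x * of_bool (f p x = 1))"
      unfolding W sum_distrib_left sum_subtractf[symmetric]
      by (intro sum.cong) (auto simp: chi_eq algebra_simps)
    with small[OF that] show ?thesis by simp
  qed
  then have "(\<Sum>p\<in>T. 3/4 * W) \<le> (\<Sum>p\<in>T. \<Sum>x\<in>X. \<nu> x * chi (f p x))"
    by (rule sum_mono)
  also have "\<dots> = (\<Sum>x\<in>X. \<nu> x * g x)"
    unfolding g_def sum_distrib_left by (rule sum.swap)
  finally have lower: "3/4 * m * W \<le> (\<Sum>x\<in>X. \<nu> x * g x)" by (simp add: m_def)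
  \<comment> \<open>Expanding a square around the lower bound of the mean takes the place of
    Cauchy-Schwarz.\<close>
  define l where "l = 3/4 * m"
  have l: "l > 0" using m by (simp add: l_def)
  have "0 \<le> (\<Sum>x\<in>X. \<nu> x * (g x - l)\<^sup>2)"
    by (intro sum_nonneg mult_nonneg_nonneg \<nu>) auto
  also have "\<dots> = (\<Sum>x\<in>X. \<nu> x * (g x)\<^sup>2) - 2 * l * (\<Sum>x\<in>X. \<nu> x * g x) + l\<^sup>2 * W"
    unfolding W sum_distrib_left sum_subtractf[symmetric] sum.distrib[symmetric]
    by (intro sum.cong) (auto simp: power2_eq_square algebra_simps)
  finally have "2 * l * (\<Sum>x\<in>X. \<nu> x * g x) \<le> (\<Sum>x\<in>X. \<nu> x * (g x)\<^sup>2) + l\<^sup>2 * W" by simp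
  moreover have "2 * l * (l * W) \<le> 2 * l * (\<Sum>x\<in>X. \<nu> x * g x)"
    using lower l unfolding l_def by (intro mult_left_mono) auto
  ultimately have 1: "l\<^sup>2 * W \<le> (\<Sum>x\<in>X. \<nu> x * (g x)\<^sup>2)" by (simp add: power2_eq_square)
  also have "\<dots> \<le> (\<Sum>x\<in>X. B * (g x)\<^sup>2)"
    by (intro sum_mono mult_right_mono \<nu>) auto
  also have "\<dots> = B * (\<Sum>x\<in>X. \<Sum>p\<in>T. \<Sum>q\<in>T. chi (f p x + f q x))"
  proof -
    have "(g x)\<^sup>2 = (\<Sum>p\<in>T. \<Sum>q\<in>T. chi (f p x + f q x))" for x
      by (simp only: g_def power2_eq_square sum_product chi_add)
    then show ?thesis by (simp only: sum_distrib_left)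
  qed
  also have "(\<Sum>x\<in>X. \<Sum>p\<in>T. \<Sum>q\<in>T. chi (f p x + f q x)) =
      (\<Sum>p\<in>T. \<Sum>q\<in>T. \<Sum>x\<in>X. chi (f p x + f q x))"
    by (subst sum.swap, intro sum.cong refl, subst sum.swap, simp)
  also have "B * \<dots> \<le> B * (\<Sum>p\<in>T. \<Sum>q\<in>T. card X * of_bool (p = q) + 1 / (4 * L) * card X)"
  proof (intro mult_left_mono sum_mono)
    fix p q assume pq: "p \<in> T" "q \<in> T"
    show "(\<Sum>x\<in>X. chi (f p x + f q x)) \<le> card X * of_bool (p = q) + 1 / (4 * L) * card X"
      using sep[OF pq] L by (cases "p = q") auto
  next
    have "X \<noteq> {}" using W by auto
    then obtain x where "x \<in> X" by auto
    then show "0 \<le> B" using \<nu>[of x] by linarith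
  qed
  also have "\<dots> = (B * card X) * (m + m\<^sup>2 / (4 * L))"
  proof -
    have "(\<Sum>q\<in>T. real (card X) * of_bool (p = q)) = card X" if "p \<in> T" for p
      using fin that by (simp add: of_bool_def if_distrib sum.delta cong: if_cong)
    then have "(\<Sum>p\<in>T. \<Sum>q\<in>T. card X * of_bool (p = q) + 1 / (4 * L) * card X)
       = (\<Sum>p\<in>T. card X + m * (1 / (4 * L) * card X))"
      by (simp add: sum.distrib m_def)
    also have "\<dots> = m * card X + m * m * (1 / (4 * L) * card X)"
      by (simp add: m_def algebra_simps)
    finally show ?thesis by (simp add: algebra_simps power2_eq_square)
  qed
  also have "\<dots> \<le> (L * W) * (m + m\<^sup>2 / (4 * L))"
    using BL L m by (intro mult_right_mono) auto
  also have "\<dots> = W * (L * m + m\<^sup>2 / 4)" using L by (simp add: field_simps)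
  finally have "l\<^sup>2 \<le> L * m + m\<^sup>2 / 4" using W by (simp add: mult.commute)
  \<comment> \<open>9/16 - 1/4 = 5/16, so \<open>card T\<close> is at most 16/5 of
    \<open>L\<close>.\<close>
  then have "m * (5/16 * m) \<le> m * L" by (simp add: l_def power2_eq_square algebra_simps)
  then have "5/16 * m \<le> L" using m by (simp only: mult_le_cancel_left_pos)
  then show ?thesis using L m by (simp add: m_def)
qed (use L in simp)

section \<open>Biased forms and regularization\<close>

text \<open>It matters that \<open>\<epsilon>\<close> does not depend on \<open>M\<close>: in the theorem the density of \<open>B'\<close> is only known
  after \<open>\<epsilon>\<close> has been chosen.\<close>

definition structured_vanishing :: "real \<Rightarrow> nat set \<Rightarrow> bool" where
  "structured_vanishing \<epsilon> I \<longleftrightarrow> (\<forall>M. \<exists>k. \<forall>n \<mu>. bounded_density n I M \<mu> \<longrightarrow>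
     (\<exists>\<V>. family I k \<V> \<and>
       (\<forall>r. multilinear I r \<and> mass n I \<mu> r \<le> \<epsilon> \<longrightarrow> in_span n I \<V> r)))"

text \<open>In one argument the form is linear: either it vanishes there, or translation by a vector
  at which it is 1 reverses the sign of the sum.\<close>

lemma sum_chi_coord:
  assumes "multilinear I f" "i \<in> I"
  shows "(\<Sum>a\<in>vec_space m. chi (f (z(i := a)))) =
    2 ^ m * of_bool (\<forall>a\<in>vec_space m. f (z(i := a)) = 0)"
proof (cases "\<forall>a\<in>vec_space m. f (z(i := a)) = 0")
  case True
  then show ?thesis by (simp add: card_vec_space)
next
  case False
  then obtain a0 where a0: "a0 \<in> vec_space m" "f (z(i := a0)) = 1" by auto
  have cancel: "a + a0 + a0 = a" for a :: "nat \<Rightarrow> bit"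
    by (simp add: fun_eq_iff add.assoc)
  have "(\<Sum>a\<in>vec_space m. chi (f (z(i := a)))) = (\<Sum>a\<in>vec_space m. chi (f (z(i := a + a0))))"
    by (rule sum.reindex_bij_witness[of _ "\<lambda>a. a + a0" "\<lambda>a. a + a0"])
      (use a0 cancel in \<open>auto simp only: intro: vec_space_add\<close>)
  also have "\<dots> = - (\<Sum>a\<in>vec_space m. chi (f (z(i := a))))"
    unfolding multilinear_additive[OF assms] chi_add sum_negf[symmetric] using a0 by simp
  finally show ?thesis using False by simp
qed

text \<open>If \<open>p\<close> is biased then the set \<open>Z\<close> of partial arguments \<open>z\<close> with \<open>p (z, \<cdot>) = 0\<close> is dense. All
  slices of \<open>p\<close> in the last coordinate vanish on \<open>Z\<close>, hence lie in one and the same structured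
  space.\<close>

lemma biased_imp_sum_of_split:
  fixes \<gamma> \<epsilon> :: real
  assumes "finite J" "j \<in> J" "structured_vanishing \<epsilon> (J - {j})" "0 \<le> \<epsilon>" "0 < \<gamma>"
  shows "\<exists>s. \<forall>n p. multilinear J p \<and> \<gamma> * card (vecs n J) < (\<Sum>x\<in>vecs n J. chi (p x)) \<longrightarrow>
    (\<exists>q. sum_of (split_form J) s q \<and> (\<forall>x\<in>Pi J (\<lambda>i. vec_space (n i)). p x = q x))"
proof -
  from assms(3) obtain k where k: "\<And>n \<mu>. bounded_density n (J - {j}) (1 / \<gamma>) \<mu> \<Longrightarrow>
     (\<exists>\<V>. family (J - {j}) k \<V> \<and>
       (\<forall>r. multilinear (J - {j}) r \<and> mass n (J - {j}) \<mu> r \<le> \<epsilon> \<longrightarrow> in_span n (J - {j}) \<V> r))"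
    unfolding structured_vanishing_def by meson
  show ?thesis
  proof (intro exI[of _ k] allI impI, elim conjE)
    fix n p assume p: "multilinear J p"
      and biased: "\<gamma> * card (vecs n J) < (\<Sum>x\<in>vecs n J. chi (p x))"
    define Z where "Z = {z \<in> vecs n (J - {j}). \<forall>a\<in>vec_space (n j). p (z(j := a)) = 0}"
    define N where "N = real (card (vecs n (J - {j})))"
    have N: "N > 0" using card_vecs_pos[of "J - {j}" n] assms(1) by (simp add: N_def)
    have "finite Z" using finite_vecs[of "J - {j}" n] assms(1) by (simp add: Z_def)
    have "(\<Sum>x\<in>vecs n J. chi (p x)) =
       (\<Sum>z\<in>vecs n (J - {j}). 2 ^ n j * of_bool (\<forall>a\<in>vec_space (n j). p (z(j := a)) = 0))"
      by (simp only: sum_vecs_fun_upd[OF assms(2)] sum_chi_coord[OF p assms(2)])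
    also have "\<dots> = 2 ^ n j * (\<Sum>z\<in>Z. 1)"
      unfolding Z_def sum_distrib_left
      by (intro sum.mono_neutral_cong_right) (use finite_vecs assms(1) in auto)
    finally have "(\<Sum>x\<in>vecs n J. chi (p x)) = 2 ^ n j * real (card Z)" by simp
    moreover have "real (card (vecs n J)) = N * 2 ^ n j"
      using card_vecs_split[of J "{j}" n] assms
      by (simp add: N_def vecs_def card_PiE card_vec_space)
    ultimately have "2 ^ n j * (\<gamma> * N) < 2 ^ n j * real (card Z)"
      using biased by (simp add: ac_simps)
    then have cardZ: "\<gamma> * N < card Z" by simp
    then have posZ: "0 < real (card Z)" using mult_pos_pos[OF assms(5) N] by linarith
    \<comment> \<open>The uniform distribution on \<open>Z\<close>; the bias bounds its density by
      \<open>1 / \<gamma>\<close>.\<close>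
    define \<mu> where "\<mu> z = of_bool (z \<in> Z) / real (card Z)" for z
    have inZ: "(\<Sum>z\<in>vecs n (J - {j}). of_bool (z \<in> Z) * g z) = (\<Sum>z\<in>Z. g z)"
      for g :: "_ \<Rightarrow> real"
      by (intro sum.mono_neutral_cong_right) (use finite_vecs assms(1) in \<open>auto simp: Z_def\<close>)
    have "bounded_density n (J - {j}) (1 / \<gamma>) \<mu>"
      unfolding bounded_density_def
    proof (intro conjI ballI)
      show "0 \<le> \<mu> x" for x by (simp add: \<mu>_def)
      show "\<mu> x * card (vecs n (J - {j})) \<le> 1 / \<gamma>" for x
        using cardZ assms(5) posZ N by (simp add: \<mu>_def N_def[symmetric] field_simps)
      show "(\<Sum>x\<in>vecs n (J - {j}). \<mu> x) = 1"
        using inZ[of "\<lambda>_. 1 / real (card Z)"] posZ by (simp add: \<mu>_def)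
    qed
    from k[OF this] obtain \<V> where \<V>: "family (J - {j}) k \<V>"
      "\<And>r. multilinear (J - {j}) r \<Longrightarrow> mass n (J - {j}) \<mu> r \<le> \<epsilon> \<Longrightarrow> in_span n (J - {j}) \<V> r"
      by blast
    have "in_span n (J - {j}) \<V> (\<lambda>x. p (x(j := unit_vec m)))" if "m < n j" for m
    proof (rule \<V>(2))
      show "multilinear (J - {j}) (\<lambda>x. p (x(j := unit_vec m)))"
        by (rule multilinear_fun_upd[OF p])
      have "mass n (J - {j}) \<mu> (\<lambda>x. p (x(j := unit_vec m))) = 0"
        unfolding mass_def
        by (intro sum.neutral) (use that unit_vec_in_vec_space in \<open>auto simp: \<mu>_def Z_def\<close>)
      then show "mass n (J - {j}) \<mu> (\<lambda>x. p (x(j := unit_vec m))) \<le> \<epsilon>" using assms(4) by simp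
    qed
    then have "\<forall>m. \<exists>c. m < n j \<longrightarrow> (\<forall>v\<in>\<V>. multilinear (J - {j} - fst v) (c v)) \<and>
        (\<forall>x\<in>Pi (J - {j}) (\<lambda>i. vec_space (n i)).
          p (x(j := unit_vec m)) = (\<Sum>v\<in>\<V>. snd v x * c v x))"
      unfolding in_span_def by blast
    from choice[OF this] obtain c where c: "\<And>m v. m < n j \<Longrightarrow> v \<in> \<V> \<Longrightarrow> multilinear (J - {j} - fst v) (c m v)"
      "\<And>m x. m < n j \<Longrightarrow> x \<in> Pi (J - {j}) (\<lambda>i. vec_space (n i)) \<Longrightarrow>
        p (x(j := unit_vec m)) = (\<Sum>v\<in>\<V>. snd v x * c m v x)"
      by blast
    \<comment> \<open>The number \<open>n j\<close> of slices is unbounded, but they share the forms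
      of \<open>\<V>\<close>. With the sum over \<open>\<V>\<close> outside and the slices collected
      in the cofactors, at most \<open>k\<close> terms remain.\<close>
    define q where "q x = (\<Sum>v\<in>\<V>. snd v x * (\<Sum>m<n j. x j m * c m v x))" for x
    have "split_form J (\<lambda>x. snd v x * (\<Sum>m<n j. x j m * c m v x))" if v: "v \<in> \<V>" for v
    proof -
      have fv: "fst v \<subseteq> J - {j}" "fst v \<noteq> {}" "multilinear (fst v) (snd v)"
        using \<V>(1) v by (auto simp: family_def)
      have coord: "multilinear {j} (\<lambda>x. x j m)" for m
        by (simp add: multilinear_def)
      have "multilinear ({j} \<union> (J - {j} - fst v)) (\<lambda>x. x j m * c m v x)" if "m < n j" for m
        by (intro multilinear_mult coord c that v) auto
      moreover have "{j} \<union> (J - {j} - fst v) = J - fst v" using assms(2) fv by auto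
      ultimately have "multilinear (J - fst v) (\<lambda>x. \<Sum>m<n j. x j m * c m v x)"
        by (intro multilinear_sum) auto
      then show ?thesis unfolding split_form_def
        using fv assms(2)
        by (intro exI[of _ "fst v"] exI[of _ "snd v"]
          exI[of _ "\<lambda>x. \<Sum>m<n j. x j m * c m v x"]) auto
    qed
    then have "sum_of (split_form J) (card \<V> * 1) q"
      unfolding q_def using \<V>(1) by (intro sum_of_sum sum_of_single) (auto simp: family_def)
    then have "sum_of (split_form J) k q"
      using \<V>(1) by (auto simp: family_def elim: sum_of_mono)
    moreover have "p x = q x" if x: "x \<in> Pi J (\<lambda>i. vec_space (n i))" for x
    proof -
      have "p x = (\<Sum>m<n j. x j m * p (x(j := unit_vec m)))"
        using x assms(2) by (intro multilinear_expand_coord[OF p]) auto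
      also have "\<dots> = (\<Sum>m<n j. x j m * (\<Sum>v\<in>\<V>. snd v x * c m v x))"
        using c(2) x by (intro sum.cong) auto
      also have "\<dots> = (\<Sum>m<n j. \<Sum>v\<in>\<V>. snd v x * (x j m * c m v x))"
        by (simp only: sum_distrib_left mult.left_commute)
      also have "\<dots> = q x"
        unfolding q_def sum_distrib_left by (rule sum.swap)
      finally show ?thesis .
    qed
    ultimately show "\<exists>q. sum_of (split_form J) k q \<and> (\<forall>x\<in>Pi J (\<lambda>i. vec_space (n i)). p x = q x)"
      by blast
  qed
qed

text \<open>Draw \<open>x\<close> from \<open>\<mu>\<close>, then redraw its \<open>i\<close>-th coordinate among the points at which the forms of
  \<open>\<V>\<close> take the same values as at \<open>x\<close>, and put the difference into coordinate \<open>i\<close>. The forms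
  involving coordinate \<open>i\<close> then vanish. Discarding the light cells keeps the density bounded.\<close>

lemma regularize_coord:
  fixes M :: real
  assumes I: "finite I" "i \<in> I" and \<mu>: "bounded_density n I M \<mu>" and \<V>: "family I k \<V>"
  shows "\<exists>\<mu>'. bounded_density n I (M * M * 2 ^ (k + 2)) \<mu>' \<and>
    (\<forall>x\<in>vecs n I. \<mu>' x \<noteq> 0 \<longrightarrow> (\<forall>p\<in>\<V>. i \<in> fst p \<longrightarrow> snd p x = 0) \<and>
       (\<exists>x'\<in>vecs n I. \<mu> x' \<noteq> 0 \<and> (\<forall>l\<in>I - {i}. x l = x' l))) \<and>
    (\<forall>r. multilinear I r \<longrightarrow> mass n I \<mu>' r \<le> 4 * mass n I \<mu> r)"
proof -
  define V where "V = vec_space (n i)"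
  define Y where "Y = vecs n (I - {i})"
  define NY NV N where "NY = real (card Y)" and "NV = real (card V)"
    and "N = real (card (vecs n I))"
  \<comment> \<open>A fibre has at most \<open>2 ^ k\<close> cells, so over all \<open>NY\<close>
    fibres the cells lighter than \<open>\<theta> / NY\<close> carry at most
    \<open>2 ^ k * \<theta> = 1/2\<close> of the weight.\<close>
  define \<theta> where "\<theta> = (1 / 2 ^ (k + 1) :: real)"
  define sig where "sig x = {p \<in> \<V>. snd p x = 1}" for x
  define m where "m y S = (\<Sum>b\<in>V. \<mu> (y(i := b)) * of_bool (sig (y(i := b)) = S))" for y S
  define good where "good y S \<longleftrightarrow> \<theta> \<le> m y S * NY" for y S
  \<comment> \<open>The joint weight of the drawn value \<open>a\<close> and the redrawn value
    \<open>b\<close> in the fibre over \<open>y\<close>, restricted to heavy cells. It is symmetric,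
    so both values have the same marginal, which is at most \<open>\<mu>\<close>.\<close>
  define G where "G y a b = of_bool (sig (y(i := a)) = sig (y(i := b)) \<and> good y (sig (y(i := a))))
     * (\<mu> (y(i := a)) * \<mu> (y(i := b)) / m y (sig (y(i := a))))" for y a b
  have fin: "finite V" "finite Y" "finite \<V>"
    using I \<V> finite_vecs[of "I - {i}" n] by (auto simp: V_def Y_def family_def)
  have pos: "NY > 0" "NV > 0" "\<theta> > 0"
    using card_vecs_pos[of "I - {i}" n] I
    by (simp_all add: NY_def NV_def Y_def V_def card_vec_space \<theta>_def)
  have N: "N = NY * NV"
    using card_vecs_split[of I "{i}" n] I
    by (simp add: N_def NY_def NV_def Y_def V_def vecs_def card_PiE)
  have in_vecs: "y(i := a) \<in> vecs n I" if "y \<in> Y" "a \<in> V" for y a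
    using that I by (auto simp: Y_def V_def vecs_def PiE_iff extensional_def)
  have \<mu>_nonneg: "0 \<le> \<mu> (y(i := a))" and \<mu>_le: "\<mu> (y(i := a)) \<le> M / N"
    if "y \<in> Y" "a \<in> V" for y a
    using \<mu> in_vecs[OF that] pos N
    by (auto simp: bounded_density_def N_def[symmetric] field_simps)
  have sum_vecs: "(\<Sum>x\<in>vecs n I. F x) = (\<Sum>y\<in>Y. \<Sum>a\<in>V. F (y(i := a)))" for F :: "_ \<Rightarrow> real"
    unfolding Y_def V_def by (rule sum_vecs_fun_upd[OF I(2)])
  have G_sym: "G y a b = G y b a" for y a b
    by (auto simp: G_def)
  have m_nonneg: "0 \<le> m y S" if "y \<in> Y" for y S
    unfolding m_def by (intro sum_nonneg mult_nonneg_nonneg \<mu>_nonneg that) auto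
  have G_nonneg: "0 \<le> G y a b" if "y \<in> Y" "a \<in> V" "b \<in> V" for y a b
    unfolding G_def using \<mu>_nonneg m_nonneg that by simp
  have good_pos: "m y S > 0" if "good y S" for y S
    using that pos unfolding good_def by (smt (verit) mult_nonpos_nonneg)
  have G_row: "(\<Sum>b\<in>V. G y a b) = of_bool (good y (sig (y(i := a)))) * \<mu> (y(i := a))"
    if "y \<in> Y" "a \<in> V" for y a
  proof (cases "good y (sig (y(i := a)))")
    case True
    let ?S = "sig (y(i := a))"
    have "(\<Sum>b\<in>V. G y a b) = (\<Sum>b\<in>V. \<mu> (y(i := a)) / m y ?S *
        (\<mu> (y(i := b)) * of_bool (sig (y(i := b)) = ?S)))"
      using True by (intro sum.cong) (auto simp: G_def)
    also have "\<dots> = \<mu> (y(i := a)) / m y ?S * m y ?S"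
      unfolding m_def by (simp only: sum_distrib_left)
    finally show ?thesis using good_pos[OF True] True by simp
  qed (simp add: G_def)
  have G_row_le: "(\<Sum>b\<in>V. G y a b) \<le> \<mu> (y(i := a))" if "y \<in> Y" "a \<in> V" for y a
    using G_row[OF that] \<mu>_nonneg[OF that] by simp
  define tot where "tot = (\<Sum>y\<in>Y. \<Sum>a\<in>V. \<Sum>b\<in>V. G y a b)"
  have "(\<Sum>y\<in>Y. \<Sum>a\<in>V. of_bool (\<not> good y (sig (y(i := a)))) * \<mu> (y(i := a))) \<le> 1 / 2"
  proof -
    have "(\<Sum>a\<in>V. of_bool (\<not> good y (sig (y(i := a)))) * \<mu> (y(i := a))) \<le> 2 ^ k * (\<theta> / NY)"
      if y: "y \<in> Y" for y
    proof -
      have "(\<Sum>a\<in>V. of_bool (\<not> good y (sig (y(i := a)))) * \<mu> (y(i := a))) =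
         (\<Sum>a\<in>V. \<Sum>S\<in>Pow \<V>. of_bool (\<not> good y S) *
            (\<mu> (y(i := a)) * of_bool (sig (y(i := a)) = S)))"
      proof (intro sum.cong refl)
        fix a
        have "(\<Sum>S\<in>Pow \<V>. of_bool (\<not> good y S) * (\<mu> (y(i := a)) * of_bool (sig (y(i := a)) = S)))
           = (\<Sum>S\<in>Pow \<V>. if S = sig (y(i := a)) then of_bool (\<not> good y S) * \<mu> (y(i := a)) else 0)"
          by (intro sum.cong) auto
        also have "\<dots> = of_bool (\<not> good y (sig (y(i := a)))) * \<mu> (y(i := a))"
          using fin by (simp add: sig_def)
        finally show "of_bool (\<not> good y (sig (y(i := a)))) * \<mu> (y(i := a)) =
          (\<Sum>S\<in>Pow \<V>. of_bool (\<not> good y S) * (\<mu> (y(i := a)) * of_bool (sig (y(i := a)) = S)))"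
          by simp
      qed
      also have "\<dots> = (\<Sum>S\<in>Pow \<V>. of_bool (\<not> good y S) * m y S)"
        unfolding m_def sum_distrib_left by (rule sum.swap)
      also have "\<dots> \<le> (\<Sum>S\<in>Pow \<V>. \<theta> / NY)"
        using pos by (intro sum_mono) (auto simp: good_def field_simps)
      also have "\<dots> \<le> 2 ^ k * (\<theta> / NY)"
        using fin pos \<V> by (simp add: card_Pow family_def divide_right_mono)
      finally show ?thesis .
    qed
    then have "(\<Sum>y\<in>Y. \<Sum>a\<in>V. of_bool (\<not> good y (sig (y(i := a)))) * \<mu> (y(i := a)))
       \<le> (\<Sum>y\<in>Y. 2 ^ k * (\<theta> / NY))" by (rule sum_mono)
    also have "\<dots> = 1 / 2" using pos by (simp add: NY_def[symmetric] \<theta>_def)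
    finally show ?thesis .
  qed
  moreover have "(\<Sum>y\<in>Y. \<Sum>a\<in>V. of_bool (\<not> good y (sig (y(i := a)))) * \<mu> (y(i := a))) + tot = 1"
  proof -
    have "tot = (\<Sum>y\<in>Y. \<Sum>a\<in>V. of_bool (good y (sig (y(i := a)))) * \<mu> (y(i := a)))"
      unfolding tot_def by (intro sum.cong refl G_row)
    then have "(\<Sum>y\<in>Y. \<Sum>a\<in>V. of_bool (\<not> good y (sig (y(i := a)))) * \<mu> (y(i := a))) + tot =
        (\<Sum>y\<in>Y. \<Sum>a\<in>V. \<mu> (y(i := a)))"
      by (simp only: sum.distrib[symmetric]) (intro sum.cong, auto)
    also have "\<dots> = 1" using \<mu> sum_vecs[of \<mu>] by (simp add: bounded_density_def)
    finally show ?thesis .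
  qed
  ultimately have tot: "tot \<ge> 1 / 2" by simp
  \<comment> \<open>The law of \<open>a + b\<close>, renormalised: \<open>a + x i\<close> is the
    \<open>b\<close> for which the sum is \<open>x i\<close>. As \<open>G\<close> ignores coordinate
    \<open>i\<close> of its first argument, \<open>x\<close> itself can be passed.\<close>
  define \<mu>' where "\<mu>' x = (\<Sum>a\<in>V. G x a (a + x i)) / tot" for x
  have G_upd: "G (y(i := c)) a b = G y a b" for y a b c
    by (simp add: G_def m_def good_def)
  have V_add: "a \<in> V \<Longrightarrow> b \<in> V \<Longrightarrow> a + b \<in> V" for a b
    unfolding V_def by (rule vec_space_add)
  have cancel: "a + (a + b) = b" for a b :: "nat \<Rightarrow> bit"
    by (simp add: fun_eq_iff flip: add.assoc)
  have sum_\<mu>': "(\<Sum>x\<in>vecs n I. \<mu>' x * h x) =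
      (\<Sum>y\<in>Y. \<Sum>a\<in>V. \<Sum>b\<in>V. G y a b * h (y(i := a + b))) / tot" for h
  proof -
    have "(\<Sum>x\<in>vecs n I. \<mu>' x * h x) =
        (\<Sum>y\<in>Y. \<Sum>c\<in>V. \<Sum>a\<in>V. G y a (a + c) * h (y(i := c)) / tot)"
      unfolding sum_vecs \<mu>'_def
      by (simp only: G_upd fun_upd_same sum_divide_distrib sum_distrib_right times_divide_eq_left)
    also have "\<dots> = (\<Sum>y\<in>Y. \<Sum>a\<in>V. \<Sum>c\<in>V. G y a (a + c) * h (y(i := c)) / tot)"
      by (intro sum.cong refl sum.swap)
    also have "\<dots> = (\<Sum>y\<in>Y. \<Sum>a\<in>V. \<Sum>b\<in>V. G y a b * h (y(i := a + b)) / tot)"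
    proof (rule sum.cong[OF refl], rule sum.cong[OF refl])
      fix y a assume "a \<in> V"
      then show "(\<Sum>c\<in>V. G y a (a + c) * h (y(i := c)) / tot) =
         (\<Sum>b\<in>V. G y a b * h (y(i := a + b)) / tot)"
        by (intro sum.reindex_bij_witness[of _ "\<lambda>b. a + b" "\<lambda>b. a + b"])
          (simp_all del: plus_fun_apply add: cancel V_add)
    qed
    finally show ?thesis by (simp only: sum_divide_distrib)
  qed
  have "bounded_density n I (M * M * 2 ^ (k + 2)) \<mu>'"
    unfolding bounded_density_def
  proof (intro conjI ballI)
    fix x assume x: "x \<in> vecs n I"
    define y where "y = restrict x (I - {i})"
    have y: "y \<in> Y" "x = y(i := x i)" "x i \<in> V"
      using x I by (auto simp: y_def Y_def V_def vecs_def PiE_iff extensional_def fun_eq_iff)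
    have \<mu>'_x: "\<mu>' x = (\<Sum>a\<in>V. G y a (a + x i)) / tot"
      unfolding \<mu>'_def by (subst y(2)) (simp only: G_upd fun_upd_same)
    show "0 \<le> \<mu>' x"
      unfolding \<mu>'_x using tot y V_add by (intro divide_nonneg_nonneg sum_nonneg G_nonneg) auto
    \<comment> \<open>\<open>M / N\<close> bounds both weights and \<open>NY / \<theta>\<close> the
      reciprocal weight of a heavy cell. Summing over the \<open>NV = N / NY\<close> values of
      \<open>a\<close> leaves a single \<open>1 / N\<close>, so the density stays bounded;
      \<open>tot\<close> costs another factor 2.\<close>
    have "G y a b \<le> (M / N) * ((M / N) * (NY / \<theta>))" if "a \<in> V" "b \<in> V" for a b
    proof (cases "good y (sig (y(i := a)))")
      case True
      have M: "0 \<le> M / N" using \<mu>_nonneg \<mu>_le y(1) that(1) by (meson order_trans)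
      have "1 / m y (sig (y(i := a))) \<le> NY / \<theta>"
        using True good_pos[OF True] pos by (simp add: good_def field_simps)
      then have "\<mu> (y(i := a)) * (\<mu> (y(i := b)) * (1 / m y (sig (y(i := a)))))
          \<le> (M / N) * ((M / N) * (NY / \<theta>))"
        using M \<mu>_le \<mu>_nonneg y(1) that pos good_pos[OF True] by (intro mult_mono) auto
      moreover have "G y a b \<le> \<mu> (y(i := a)) * (\<mu> (y(i := b)) * (1 / m y (sig (y(i := a)))))"
        using \<mu>_nonneg[OF y(1)] that good_pos[OF True] by (simp add: G_def)
      ultimately show ?thesis by linarith
    next
      case False
      have "0 \<le> M / N" using \<mu>_nonneg \<mu>_le y(1) that(1) by (meson order_trans)
      then have "0 \<le> (M / N) * ((M / N) * (NY / \<theta>))"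
        using pos by (intro mult_nonneg_nonneg) auto
      with False show ?thesis by (simp only: G_def simp_thms of_bool_eq mult_zero_left)
    qed
    then have "(\<Sum>a\<in>V. G y a (a + x i)) \<le> (\<Sum>a\<in>V. (M / N) * ((M / N) * (NY / \<theta>)))"
      using y V_add by (intro sum_mono) auto
    also have "\<dots> = M * M * 2 ^ (k + 1) / N"
      using pos N by (simp add: NV_def[symmetric] \<theta>_def field_simps)
    finally have "(\<Sum>a\<in>V. G y a (a + x i)) * N \<le> M * M * 2 ^ (k + 1)"
      using pos N by (simp add: field_simps)
    also have "\<dots> \<le> M * M * 2 ^ (k + 2) * tot"
      using mult_left_mono[OF tot, of "M * M * 2 ^ (k + 2)"] by simp
    finally show "\<mu>' x * card (vecs n I) \<le> M * M * 2 ^ (k + 2)"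
      using tot by (simp add: \<mu>'_x N_def[symmetric] field_simps)
  next
    show "(\<Sum>x\<in>vecs n I. \<mu>' x) = 1"
      using sum_\<mu>'[of "\<lambda>_. 1"] tot by (simp add: tot_def[symmetric])
  qed
  moreover have "(\<forall>p\<in>\<V>. i \<in> fst p \<longrightarrow> snd p x = 0) \<and>
       (\<exists>x'\<in>vecs n I. \<mu> x' \<noteq> 0 \<and> (\<forall>l\<in>I - {i}. x l = x' l))"
    if x: "x \<in> vecs n I" "\<mu>' x \<noteq> 0" for x
  proof -
    from x(2) have "(\<Sum>a\<in>V. G x a (a + x i)) \<noteq> 0" by (auto simp: \<mu>'_def)
    then obtain a where a: "a \<in> V" "G x a (a + x i) \<noteq> 0"
      by (meson sum.neutral)
    then have sig: "sig (x(i := a)) = sig (x(i := a + x i))" and nz: "\<mu> (x(i := a)) \<noteq> 0"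
      by (auto simp: G_def simp del: plus_fun_apply)
    have "snd p x = 0" if "p \<in> \<V>" "i \<in> fst p" for p
    proof -
      have ml: "multilinear (fst p) (snd p)" using \<V> that by (auto simp: family_def)
      have "snd p x = snd p (x(i := a + (a + x i)))" by (simp only: cancel fun_upd_triv)
      also have "\<dots> = snd p (x(i := a)) + snd p (x(i := a + x i))"
        by (rule multilinear_additive[OF ml that(2)])
      also have "snd p (x(i := a + x i)) = snd p (x(i := a))"
        using sig that(1) unfolding sig_def
        by (smt (verit, best) bit_not_one_iff mem_Collect_eq)
      finally show ?thesis by (simp only: bit_add_self)
    qed
    moreover have "x(i := a) \<in> vecs n I"
      using x a I by (auto simp: V_def vecs_def PiE_iff extensional_def)
    \<comment> \<open>The witness shares all other arguments with \<open>x\<close>, so vanishing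
      obtained at other coordinates survives.\<close>
    ultimately show ?thesis using nz by (intro conjI ballI impI bexI[of _ "x(i := a)"]) auto
  qed
  moreover have "mass n I \<mu>' r \<le> 4 * mass n I \<mu> r" if r: "multilinear I r" for r
  proof -
    let ?o = "\<lambda>x. of_bool (r x = 1) :: real"
    \<comment> \<open>If \<open>r\<close> is 1 at the difference, it is 1 at one of the two points.
      Each point has law at most \<open>\<mu>\<close>, and dividing by \<open>tot\<close>, which is
      at least 1/2, turns the resulting factor 2 into 4.\<close>
    have "G y a b * ?o (y(i := a + b)) \<le> G y a b * ?o (y(i := a)) + G y a b * ?o (y(i := b))"
      if "y \<in> Y" "a \<in> V" "b \<in> V" for y a b
    proof -
      have "?o (y(i := a + b)) \<le> ?o (y(i := a)) + ?o (y(i := b))"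
        unfolding multilinear_additive[OF r I(2)] bit_add_eq_1_iff by simp
      from mult_left_mono[OF this G_nonneg[OF that]] show ?thesis by (simp only: distrib_left)
    qed
    then have "(\<Sum>y\<in>Y. \<Sum>a\<in>V. \<Sum>b\<in>V. G y a b * ?o (y(i := a + b))) \<le>
      (\<Sum>y\<in>Y. \<Sum>a\<in>V. \<Sum>b\<in>V. G y a b * ?o (y(i := a)) + G y a b * ?o (y(i := b)))"
      by (intro sum_mono)
    also have "\<dots> = (\<Sum>y\<in>Y. \<Sum>a\<in>V. \<Sum>b\<in>V. G y a b * ?o (y(i := a))) +
       (\<Sum>y\<in>Y. \<Sum>a\<in>V. \<Sum>b\<in>V. G y a b * ?o (y(i := b)))"
      by (simp only: sum.distrib)
    also have "(\<Sum>y\<in>Y. \<Sum>a\<in>V. \<Sum>b\<in>V. G y a b * ?o (y(i := b))) =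
       (\<Sum>y\<in>Y. \<Sum>a\<in>V. \<Sum>b\<in>V. G y a b * ?o (y(i := a)))"
      by (rule sum.cong[OF refl], subst sum.swap, subst G_sym) (rule refl)
    also have "(\<Sum>y\<in>Y. \<Sum>a\<in>V. \<Sum>b\<in>V. G y a b * ?o (y(i := a))) \<le>
       (\<Sum>y\<in>Y. \<Sum>a\<in>V. \<mu> (y(i := a)) * ?o (y(i := a)))"
      unfolding sum_distrib_right[symmetric] by (intro sum_mono mult_right_mono G_row_le) auto
    also have "\<dots> = mass n I \<mu> r" unfolding mass_def by (rule sum_vecs[symmetric])
    finally have "(\<Sum>y\<in>Y. \<Sum>a\<in>V. \<Sum>b\<in>V. G y a b * ?o (y(i := a + b))) \<le> 2 * mass n I \<mu> r"
      by (simp only: mult_2)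
    moreover have "0 \<le> mass n I \<mu> r"
      unfolding mass_def using \<mu> by (intro sum_nonneg) (auto simp: bounded_density_def)
    then have "2 * mass n I \<mu> r \<le> 4 * mass n I \<mu> r * tot"
      using mult_left_mono[OF tot, of "4 * mass n I \<mu> r"] by simp
    ultimately have "(\<Sum>y\<in>Y. \<Sum>a\<in>V. \<Sum>b\<in>V. G y a b * ?o (y(i := a + b))) \<le>
       4 * mass n I \<mu> r * tot" by linarith
    then show ?thesis
      unfolding mass_def[of n I \<mu>'] sum_\<mu>' using tot by (simp only: pos_divide_le_eq)
  qed
  ultimately show ?thesis by (intro exI[of _ \<mu>']) simp
qed

text \<open>One coordinate at a time. A form already killed either involves the new coordinate and
  is killed again, or depends only on arguments kept from a point where it vanished. Each form of
  the family involves some coordinate, so in the end all are killed. The new density bound depends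
  on \<open>k\<close>, the mass factor does not.\<close>

lemma regularize:
  fixes M :: real
  assumes "finite I"
  shows "\<exists>M'. \<forall>n \<mu> \<V>. bounded_density n I M \<mu> \<and> family I k \<V> \<longrightarrow>
    (\<exists>\<mu>'. bounded_density n I M' \<mu>' \<and>
      (\<forall>x\<in>vecs n I. \<mu>' x \<noteq> 0 \<longrightarrow> (\<forall>p\<in>\<V>. snd p x = 0)) \<and>
      (\<forall>r. multilinear I r \<longrightarrow> mass n I \<mu>' r \<le> 4 ^ card I * mass n I \<mu> r))"
proof -
  have "\<exists>M'. \<forall>n \<mu> \<V>. bounded_density n I M \<mu> \<and> family I k \<V> \<longrightarrow>
    (\<exists>\<mu>'. bounded_density n I M' \<mu>' \<and>
      (\<forall>x\<in>vecs n I. \<mu>' x \<noteq> 0 \<longrightarrow> (\<forall>p\<in>\<V>. fst p \<inter> I' \<noteq> {} \<longrightarrow> snd p x = 0)) \<and>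
      (\<forall>r. multilinear I r \<longrightarrow> mass n I \<mu>' r \<le> 4 ^ card I' * mass n I \<mu> r))"
    if "I' \<subseteq> I" for I'
    using finite_subset[OF that assms] that
  proof (induction I' rule: finite_induct)
    case empty
    then show ?case by auto
  next
    case (insert i I')
    have "I' \<subseteq> I" using insert.prems by simp
    from insert.IH[OF this] obtain M' where M': "\<And>n \<mu> \<V>. bounded_density n I M \<mu> \<Longrightarrow> family I k \<V> \<Longrightarrow>
      (\<exists>\<mu>'. bounded_density n I M' \<mu>' \<and>
        (\<forall>x\<in>vecs n I. \<mu>' x \<noteq> 0 \<longrightarrow> (\<forall>p\<in>\<V>. fst p \<inter> I' \<noteq> {} \<longrightarrow> snd p x = 0)) \<and>
        (\<forall>r. multilinear I r \<longrightarrow> mass n I \<mu>' r \<le> 4 ^ card I' * mass n I \<mu> r))"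
      by meson
    show ?case
    proof (rule exI[of _ "M' * M' * 2 ^ (k + 2)"], intro allI impI, elim conjE)
      fix n \<mu> \<V> assume \<mu>: "bounded_density n I M \<mu>" and \<V>: "family I k \<V>"
      from M'[OF this] obtain \<mu>' where \<mu>': "bounded_density n I M' \<mu>'"
        "\<And>x p. x \<in> vecs n I \<Longrightarrow> \<mu>' x \<noteq> 0 \<Longrightarrow> p \<in> \<V> \<Longrightarrow> fst p \<inter> I' \<noteq> {} \<Longrightarrow> snd p x = 0"
        "\<And>r. multilinear I r \<Longrightarrow> mass n I \<mu>' r \<le> 4 ^ card I' * mass n I \<mu> r" by blast
      have "i \<in> I" using insert.prems by simp
      from regularize_coord[OF assms this \<mu>'(1) \<V>] obtain \<mu>'' where
        \<mu>'': "bounded_density n I (M' * M' * 2 ^ (k + 2)) \<mu>''"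
        "\<And>x p. x \<in> vecs n I \<Longrightarrow> \<mu>'' x \<noteq> 0 \<Longrightarrow> p \<in> \<V> \<Longrightarrow> i \<in> fst p \<Longrightarrow> snd p x = 0"
        "\<And>x. x \<in> vecs n I \<Longrightarrow> \<mu>'' x \<noteq> 0 \<Longrightarrow>
          \<exists>x'\<in>vecs n I. \<mu>' x' \<noteq> 0 \<and> (\<forall>l\<in>I - {i}. x l = x' l)"
        "\<And>r. multilinear I r \<Longrightarrow> mass n I \<mu>'' r \<le> 4 * mass n I \<mu>' r" by blast
      have "snd p x = 0" if x: "x \<in> vecs n I" "\<mu>'' x \<noteq> 0" and p: "p \<in> \<V>"
        "fst p \<inter> insert i I' \<noteq> {}" for x p
      proof (cases "i \<in> fst p")
        case True
        then show ?thesis using \<mu>''(2) x p by blast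
      next
        case False
        from \<mu>''(3)[OF x] obtain x' where x': "x' \<in> vecs n I" "\<mu>' x' \<noteq> 0"
          "\<forall>l\<in>I - {i}. x l = x' l" by blast
        have "snd p x = snd p x'"
          by (rule multilinear_cong[of "fst p"]) (use \<V> p False x' in \<open>auto simp: family_def\<close>)
        also have "\<dots> = 0" using \<mu>'(2) x' p False by blast
        finally show ?thesis .
      qed
      moreover have "mass n I \<mu>'' r \<le> 4 ^ card (insert i I') * mass n I \<mu> r"
        if "multilinear I r" for r
        using \<mu>''(4)[OF that] \<mu>'(3)[OF that] insert.hyps by simp
      ultimately show "\<exists>\<mu>'. bounded_density n I (M' * M' * 2 ^ (k + 2)) \<mu>' \<and>
        (\<forall>x\<in>vecs n I. \<mu>' x \<noteq> 0 \<longrightarrow> (\<forall>p\<in>\<V>. fst p \<inter> insert i I' \<noteq> {} \<longrightarrow> snd p x = 0)) \<and>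
        (\<forall>r. multilinear I r \<longrightarrow> mass n I \<mu>' r \<le> 4 ^ card (insert i I') * mass n I \<mu> r)"
        using \<mu>''(1) by blast
    qed
  qed
  from this[OF subset_refl] obtain M' where M': "\<And>n \<mu> \<V>. bounded_density n I M \<mu> \<Longrightarrow> family I k \<V> \<Longrightarrow>
      (\<exists>\<mu>'. bounded_density n I M' \<mu>' \<and>
        (\<forall>x\<in>vecs n I. \<mu>' x \<noteq> 0 \<longrightarrow> (\<forall>p\<in>\<V>. fst p \<inter> I \<noteq> {} \<longrightarrow> snd p x = 0)) \<and>
        (\<forall>r. multilinear I r \<longrightarrow> mass n I \<mu>' r \<le> 4 ^ card I * mass n I \<mu> r))" by meson
  have "fst p \<inter> I \<noteq> {}" if "family I k \<V>" "p \<in> \<V>" for p \<V>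
    using that by (auto simp: family_def)
  with M' show ?thesis by (intro exI[of _ M']) meson
qed

section \<open>Removing a maximal part\<close>

text \<open>\<open>\<B>0\<close> is a basis of the span of \<open>A\<close>, \<open>\<B>\<close>
  extends it to the whole space, and \<open>\<phi> e\<close> lists the coefficients of the
  coordinate functional of \<open>e\<close>. Explicit coefficients are convenient because the
  functionals will be applied to vectors whose entries are forms.\<close>

lemma basis_split:
  assumes "A \<subseteq> vec_space t"
  obtains \<B> \<B>0 :: "(nat \<Rightarrow> bit) set" and \<phi> where
    "\<B>0 \<subseteq> \<B>" "\<B> \<subseteq> vec_space t" "\<B>0 \<subseteq> A"
    "\<And>\<beta> i. \<beta> \<in> vec_space t \<Longrightarrow> \<beta> i = (\<Sum>e\<in>\<B>. (\<Sum>j<t. \<beta> j * \<phi> e j) * e i)"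
    "\<And>\<beta> e. \<beta> \<in> A \<Longrightarrow> e \<in> \<B> - \<B>0 \<Longrightarrow> (\<Sum>j<t. \<beta> j * \<phi> e j) = 0"
proof -
  obtain \<B>0 where \<B>0: "\<B>0 \<subseteq> A" "F2.independent \<B>0" "A \<subseteq> F2.span \<B>0"
    by (rule F2.maximal_independent_subset)
  then have "\<B>0 \<subseteq> vec_space t" using assms by auto
  from F2.maximal_independent_subset_extend[OF this \<B>0(2)] obtain \<B> where
    \<B>: "\<B>0 \<subseteq> \<B>" "\<B> \<subseteq> vec_space t" "F2.independent \<B>" "vec_space t \<subseteq> F2.span \<B>" .
  have fin: "finite \<B>" using \<B>(2) finite_vec_space by (rule finite_subset)
  define \<phi> where "\<phi> e j = F2.representation \<B> (unit_vec j) e" for e j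
  have in_span: "\<beta> \<in> F2.span \<B>" if "\<beta> \<in> vec_space t" for \<beta>
    using \<B>(4) that by auto
  have rep: "F2.representation \<B> \<beta> e = (\<Sum>j<t. \<beta> j * \<phi> e j)" if "\<beta> \<in> vec_space t" for \<beta> e
  proof -
    have unit: "unit_vec j \<in> F2.span \<B>" if "j \<in> {..<t}" for j
      using that by (intro in_span unit_vec_in_vec_space) auto
    have "F2.representation \<B> \<beta> =
        F2.representation \<B> (\<Sum>j<t. scale_fun (\<beta> j) (unit_vec j))"
      by (subst vec_space_expand[OF that]) (rule refl)
    also have "\<dots> = (\<lambda>e. \<Sum>j<t. F2.representation \<B> (scale_fun (\<beta> j) (unit_vec j)) e)"
      by (intro F2.representation_sum \<B>(3) F2.span_scale unit)
    also have "\<dots> = (\<lambda>e. \<Sum>j<t. \<beta> j * \<phi> e j)"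
      by (intro ext sum.cong refl)
        (simp add: \<phi>_def F2.representation_scale[OF \<B>(3) unit])
    finally show ?thesis by (rule fun_cong)
  qed
  show thesis
  proof (rule that[OF \<B>(1,2) \<B>0(1)])
    fix \<beta> i assume \<beta>: "\<beta> \<in> vec_space t"
    have "\<beta> = (\<Sum>e\<in>\<B>. scale_fun (F2.representation \<B> \<beta> e) e)"
      using F2.sum_representation_eq[OF \<B>(3) in_span[OF \<beta>] fin subset_refl] by (rule sym)
    then have "\<beta> i = (\<Sum>e\<in>\<B>. scale_fun (F2.representation \<B> \<beta> e) e) i" by (rule fun_cong)
    then show "\<beta> i = (\<Sum>e\<in>\<B>. (\<Sum>j<t. \<beta> j * \<phi> e j) * e i)"
      by (simp add: sum_fun_apply scale_fun_def rep[OF \<beta>])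
  next
    fix \<beta> e assume \<beta>: "\<beta> \<in> A" and e: "e \<in> \<B> - \<B>0"
    have "F2.representation \<B> \<beta> = F2.representation \<B>0 \<beta>"
      using \<beta> \<B>0 \<B> by (intro F2.representation_extend) auto
    moreover have "F2.representation \<B>0 \<beta> e = 0"
    proof (rule ccontr)
      assume "F2.representation \<B>0 \<beta> e \<noteq> 0"
      then have "e \<in> \<B>0" by (rule F2.representation_ne_zero)
      with e show False by simp
    qed
    ultimately show "(\<Sum>j<t. \<beta> j * \<phi> e j) = 0"
      using rep \<beta> assms by (metis subsetD)
  qed
qed

lemma sum_of_comp:
  assumes "sum_of P t f" "\<And>g. P g \<Longrightarrow> Q (\<lambda>x. g (h x))"
  shows "sum_of Q t (\<lambda>x. f (h x))"
  using assms(1)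
proof (induction rule: sum_of_induct)
  case (zero t)
  then show ?case by (rule sum_of_zero)
next
  case (add g f t)
  then show ?case using sum_of_add[OF sum_of_single[of Q, OF assms(2)[of g]]] by fastforce
qed

lemma sum_of_product_form_extract:
  assumes "sum_of (product_form \<J> I) t r" "J \<noteq> {}"
  shows "\<exists>t'\<le>t. \<exists>a b g. (\<forall>i<t'. multilinear J (a i) \<and> product_form (\<J> - {J}) (I - J) (b i)) \<and>
    (t' = 0 \<or> J \<subseteq> I) \<and>
    sum_of (product_form (\<J> - {J}) I) t g \<and> r = (\<lambda>x. (\<Sum>i<t'. a i x * b i x) + g x)"
  using assms(1)
proof (induction rule: sum_of_induct)
  case (zero t)
  show ?case
    by (intro exI[of _ 0] conjI exI[of _ "\<lambda>_. 0"]) (auto simp: sum_of_zero)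
next
  case (add h f t)
  then obtain t' a b g where IH: "t' \<le> t"
    "\<And>i. i < t' \<Longrightarrow> multilinear J (a i) \<and> product_form (\<J> - {J}) (I - J) (b i)"
    "t' = 0 \<or> J \<subseteq> I"
    "sum_of (product_form (\<J> - {J}) I) t g" "f = (\<lambda>x. (\<Sum>i<t'. a i x * b i x) + g x)"
    by blast
  from product_form_extract[OF add(1) assms(2)] show ?case
  proof (elim disjE exE conjE)
    assume h: "product_form (\<J> - {J}) I h"
    have "sum_of (product_form (\<J> - {J}) I) (Suc t) (\<lambda>x. h x + g x)"
      using sum_of_add[OF sum_of_single[of "product_form (\<J> - {J}) I", OF h] IH(4)] by simp
    with IH show ?thesis
      by (intro exI[of _ t'] conjI exI[of _ a] exI[of _ b] exI[of _ "\<lambda>x. h x + g x"])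
        (auto simp: ac_simps)
  next
    fix a' b' assume *: "J \<subseteq> I" "multilinear J a'" "product_form (\<J> - {J}) (I - J) b'"
      "h = (\<lambda>x. a' x * b' x)"
    have "sum_of (product_form (\<J> - {J}) I) (Suc t) g"
      using IH(4) by (rule sum_of_mono) simp
    with IH * show ?thesis
      by (intro exI[of _ "Suc t'"] conjI exI[of _ "a(t' := a')"] exI[of _ "b(t' := b')"]
          exI[of _ g]) (auto simp: ac_simps less_Suc_eq)
  qed
qed

section \<open>Fibres of a density and popular forms\<close>

lemma bounded_density_mono: "bounded_density n I M \<mu> \<Longrightarrow> M \<le> M' \<Longrightarrow> bounded_density n I M' \<mu>"
  unfolding bounded_density_def by (meson order_trans)

definition marginal ::
  "(nat \<Rightarrow> nat) \<Rightarrow> nat set \<Rightarrow> ((nat \<Rightarrow> nat \<Rightarrow> bit) \<Rightarrow> real) \<Rightarrow> (nat \<Rightarrow> nat \<Rightarrow> bit) \<Rightarrow> real" where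
  "marginal n J \<mu> y = (\<Sum>x\<in>vecs n J. \<mu> (override_on y x J))"

text \<open>Summing over the arguments in \<open>J\<close> averages the relative density, and an
  average of values up to \<open>M\<close> is at most \<open>M\<close>.\<close>

lemma bounded_density_marginal:
  assumes "finite I" "J \<subseteq> I" "bounded_density n I M \<mu>"
  shows "bounded_density n (I - J) M (marginal n J \<mu>)"
  unfolding bounded_density_def
proof (intro conjI ballI)
  fix y assume y: "y \<in> vecs n (I - J)"
  then have in_I: "override_on y x J \<in> vecs n I" if "x \<in> vecs n J" for x
    using assms(2) that by (intro override_on_in_vecs)
  have finJ: "finite J" using assms(1,2) by (rule finite_subset[rotated])
  have posJ: "real (card (vecs n J)) > 0" using card_vecs_pos[OF finJ] by simp
  have cards: "real (card (vecs n I)) = card (vecs n (I - J)) * card (vecs n J)"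
    using card_vecs_split[OF assms(1,2), of n] by simp
  show "0 \<le> marginal n J \<mu> y"
    unfolding marginal_def using assms(3) in_I by (auto simp: bounded_density_def intro!: sum_nonneg)
  have "marginal n J \<mu> y * card (vecs n (I - J)) =
      (\<Sum>x\<in>vecs n J. \<mu> (override_on y x J) * card (vecs n (I - J)))"
    unfolding marginal_def by (rule sum_distrib_right)
  also have "\<dots> \<le> (\<Sum>x\<in>vecs n J. M / card (vecs n J))"
  proof (rule sum_mono)
    fix x assume "x \<in> vecs n J"
    then show "\<mu> (override_on y x J) * card (vecs n (I - J)) \<le> M / card (vecs n J)"
      using assms(3) in_I[of x] posJ
      by (simp add: bounded_density_def cards pos_le_divide_eq mult.assoc)
  qed
  also have "\<dots> = M" using posJ by simp
  finally show "marginal n J \<mu> y * card (vecs n (I - J)) \<le> M" .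
next
  show "(\<Sum>y\<in>vecs n (I - J). marginal n J \<mu> y) = 1"
    using assms(2,3) by (simp add: marginal_def bounded_density_def sum_vecs_split)
qed

text \<open>Up to \<open>t\<close> split forms, \<open>p\<close> vanishes on most of the fibre over \<open>y\<close>.\<close>

definition fits_fibre where
  "fits_fibre n I J \<mu> \<kappa> t p y \<longleftrightarrow> \<kappa> \<le> marginal n J \<mu> y * card (vecs n (I - J)) \<and>
     (\<exists>q. sum_of (split_form J) t q \<and>
       (\<Sum>x\<in>vecs n J. \<mu> (override_on y x J) * of_bool (p x + q x = 1)) \<le> marginal n J \<mu> y / 8)"

definition popular where
  "popular n I J \<mu> \<kappa> \<kappa>' t p \<longleftrightarrow> multilinear J p \<and>
     \<kappa>' \<le> (\<Sum>y\<in>vecs n (I - J). marginal n J \<mu> y * of_bool (fits_fibre n I J \<mu> \<kappa> t p y))"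

text \<open>In characteristic 2 the sum is the difference: \<open>p\<close> and \<open>p'\<close>
  agree up to partition rank \<open>s\<close>, as functions on vectors of the given
  dimensions.\<close>

definition close_forms where
  "close_forms n J s p p' \<longleftrightarrow> (\<exists>q. sum_of (split_form J) s q \<and>
     (\<forall>x\<in>Pi J (\<lambda>i. vec_space (n i)). p x + p' x = q x))"

text \<open>Corrected by split forms, all members nearly vanish on one and the same fibre. Were
  there too many, the sum of two corrected forms would be biased, hence of partition rank at most
  \<open>s\<close>; undoing the two corrections of rank \<open>t\<close> makes the original forms
  close. This is the origin of \<open>s + 2 * t\<close>.\<close>

lemma card_fits_fibre_le:
  fixes M \<kappa> :: real
  assumes I: "finite I" "J \<subseteq> I" and \<mu>: "bounded_density n I M \<mu>" and pos: "0 < M" "0 < \<kappa>"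
    and T: "finite T" "\<And>p. p \<in> T \<Longrightarrow> multilinear J p"
    and sep: "\<And>p p'. p \<in> T \<Longrightarrow> p' \<in> T \<Longrightarrow> p \<noteq> p' \<Longrightarrow> \<not> close_forms n J (s + 2 * t) p p'"
    and bias: "\<And>p. multilinear J p \<Longrightarrow>
      1 / (4 * (M / \<kappa>)) * card (vecs n J) < (\<Sum>x\<in>vecs n J. chi (p x)) \<Longrightarrow>
      \<exists>q. sum_of (split_form J) s q \<and> (\<forall>x\<in>Pi J (\<lambda>i. vec_space (n i)). p x = q x)"
    and y: "y \<in> vecs n (I - J)"
  shows "card {p \<in> T. fits_fibre n I J \<mu> \<kappa> t p y} \<le> 4 * (M / \<kappa>)"
proof (cases "{p \<in> T. fits_fibre n I J \<mu> \<kappa> t p y} = {}")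
  case True
  then show ?thesis using pos by (simp only: card.empty) simp
next
  case False
  define T' where "T' = {p \<in> T. fits_fibre n I J \<mu> \<kappa> t p y}"
  define W where "W = marginal n J \<mu> y"
  define NK where "NK = real (card (vecs n (I - J)))"
  define NJ where "NJ = real (card (vecs n J))"
  have finJ: "finite J" using I by (rule finite_subset[rotated])
  have N: "NK > 0" "NJ > 0" "real (card (vecs n I)) = NK * NJ"
    using card_vecs_pos[OF finJ, of n] card_vecs_pos[of "I - J" n] card_vecs_split[OF I, of n] I
    by (simp_all add: NK_def NJ_def)
  from False have W: "\<kappa> \<le> W * NK" by (auto simp: fits_fibre_def W_def NK_def)
  then have "0 < W * NK" using pos by linarith
  then have Wpos: "0 < W" using N by (simp add: zero_less_mult_iff)
  have "\<forall>p. \<exists>q. p \<in> T' \<longrightarrow> sum_of (split_form J) t q \<and>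
     (\<Sum>x\<in>vecs n J. \<mu> (override_on y x J) * of_bool (p x + q x = 1)) \<le> W / 8"
    by (auto simp: T'_def fits_fibre_def W_def)
  from choice[OF this] obtain q where q: "\<And>p. p \<in> T' \<Longrightarrow> sum_of (split_form J) t (q p)"
    "\<And>p. p \<in> T' \<Longrightarrow> (\<Sum>x\<in>vecs n J. \<mu> (override_on y x J) * of_bool (p x + q p x = 1)) \<le> W / 8"
    by blast
  have in_I: "override_on y x J \<in> vecs n I" if "x \<in> vecs n J" for x
    using I(2) y that by (intro override_on_in_vecs)
  have "card T' \<le> 4 * (M / \<kappa>)"
  proof (rule separated_card_le[where X = "vecs n J" and \<nu> = "\<lambda>x. \<mu> (override_on y x J)" and W = W
        and f = "\<lambda>p x. p x + q p x" and B = "M / (NK * NJ)"])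
    show "finite (vecs n J)" "finite T'" using finite_vecs[OF finJ] T by (auto simp: T'_def)
    show "0 < M / \<kappa>" using pos by simp
    show "W = (\<Sum>x\<in>vecs n J. \<mu> (override_on y x J))" by (simp add: W_def marginal_def)
    show "0 < W" by (rule Wpos)
    show "0 \<le> \<mu> (override_on y x J)" "\<mu> (override_on y x J) \<le> M / (NK * NJ)"
      if "x \<in> vecs n J" for x
      using \<mu> in_I[OF that] N by (auto simp: bounded_density_def field_simps)
    have "M / NK \<le> M / \<kappa> * W" using W N pos by (simp add: field_simps)
    then show "M / (NK * NJ) * real (card (vecs n J)) \<le> M / \<kappa> * W"
      using N by (simp add: NJ_def[symmetric])
    show "(\<Sum>x\<in>vecs n J. \<mu> (override_on y x J) * of_bool (p x + q p x = 1)) \<le> W / 8"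
      if "p \<in> T'" for p using q(2)[OF that] .
    show "(\<Sum>x\<in>vecs n J. chi (p x + q p x + (p' x + q p' x))) \<le> 1 / (4 * (M / \<kappa>)) * card (vecs n J)"
      if pp: "p \<in> T'" "p' \<in> T'" "p \<noteq> p'" for p p'
    proof (rule ccontr)
      assume "\<not> ?thesis"
      then have big: "1 / (4 * (M / \<kappa>)) * card (vecs n J) <
         (\<Sum>x\<in>vecs n J. chi (p x + q p x + (p' x + q p' x)))" by simp
      have ml: "multilinear J (\<lambda>x. p x + q p x)" if "p \<in> T'" for p
        using that T(2) multilinear_sum_of[OF q(1)[OF that] split_form_multilinear]
        by (intro multilinear_add) (simp_all add: T'_def)
      have "multilinear J (\<lambda>x. p x + q p x + (p' x + q p' x))"
        using pp by (intro multilinear_add[OF ml ml])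
      from bias[OF this big] obtain q0 where q0: "sum_of (split_form J) s q0"
        "\<And>x. x \<in> Pi J (\<lambda>i. vec_space (n i)) \<Longrightarrow> p x + q p x + (p' x + q p' x) = q0 x" by blast
      have "sum_of (split_form J) (s + (t + t)) (\<lambda>x. q0 x + (q p x + q p' x))"
        using pp by (intro sum_of_add q0 q)
      moreover have "p x + p' x = q0 x + (q p x + q p' x)"
        if "x \<in> Pi J (\<lambda>i. vec_space (n i))" for x
      proof -
        have "a + c = (a + b + (c + d)) + (b + d)" for a b c d :: bit
          by (cases a; cases b; cases c; cases d) simp_all
        then show ?thesis unfolding q0(2)[OF that, symmetric] .
      qed
      ultimately have "close_forms n J (s + 2 * t) p p'"
        unfolding close_forms_def by (intro exI[of _ "\<lambda>x. q0 x + (q p x + q p' x)"]) (simp add: mult_2)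
      then show False using sep pp by (auto simp: T'_def)
    qed
  qed
  then show ?thesis by (simp add: T'_def)
qed

text \<open>Double counting: each popular form claims weight \<open>\<kappa>'\<close> of base points
  \<open>y\<close>, and each \<open>y\<close> is claimed at most \<open>4 * (M / \<kappa>)\<close>
  times.\<close>

lemma popular_separated_card_le:
  fixes M \<kappa> \<kappa>' :: real
  assumes I: "finite I" "J \<subseteq> I" and \<mu>: "bounded_density n I M \<mu>" and pos: "0 < M" "0 < \<kappa>" "0 < \<kappa>'"
    and T: "finite T" "\<And>p. p \<in> T \<Longrightarrow> popular n I J \<mu> \<kappa> \<kappa>' t p"
    and sep: "\<And>p p'. p \<in> T \<Longrightarrow> p' \<in> T \<Longrightarrow> p \<noteq> p' \<Longrightarrow> \<not> close_forms n J (s + 2 * t) p p'"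
    and bias: "\<And>p. multilinear J p \<Longrightarrow>
      1 / (4 * (M / \<kappa>)) * card (vecs n J) < (\<Sum>x\<in>vecs n J. chi (p x)) \<Longrightarrow>
      \<exists>q. sum_of (split_form J) s q \<and> (\<forall>x\<in>Pi J (\<lambda>i. vec_space (n i)). p x = q x)"
  shows "card T \<le> 4 * (M / \<kappa>) / \<kappa>'"
proof -
  let ?w = "marginal n J \<mu>" and ?E = "fits_fibre n I J \<mu> \<kappa> t"
  have w: "bounded_density n (I - J) M ?w" by (rule bounded_density_marginal[OF I \<mu>])
  have "card T * \<kappa>' = (\<Sum>p\<in>T. \<kappa>')" by simp
  also have "\<dots> \<le> (\<Sum>p\<in>T. \<Sum>y\<in>vecs n (I - J). ?w y * of_bool (?E p y))"
    using T(2) by (intro sum_mono) (simp add: popular_def)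
  also have "\<dots> = (\<Sum>y\<in>vecs n (I - J). ?w y * (\<Sum>p\<in>T. of_bool (?E p y)))"
    unfolding sum_distrib_left by (rule sum.swap)
  also have "\<dots> \<le> (\<Sum>y\<in>vecs n (I - J). ?w y * (4 * (M / \<kappa>)))"
  proof (intro sum_mono mult_left_mono)
    fix y assume y: "y \<in> vecs n (I - J)"
    have "(\<Sum>p\<in>T. of_bool (?E p y)) = real (card {p \<in> T. ?E p y})"
      using T(1) by (simp add: sum.If_cases of_bool_def Int_def)
    also have "\<dots> \<le> 4 * (M / \<kappa>)"
      using T(2) by (intro card_fits_fibre_le[OF I \<mu> pos(1,2) T(1) _ sep bias y])
        (auto simp: popular_def)
    finally show "(\<Sum>p\<in>T. of_bool (?E p y)) \<le> 4 * (M / \<kappa>)" .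
    show "0 \<le> ?w y" using w y by (simp add: bounded_density_def)
  qed
  also have "\<dots> = 4 * (M / \<kappa>)"
    using w by (simp only: bounded_density_def sum_distrib_right[symmetric] mult_1_left)
  finally show ?thesis using pos by (simp add: field_simps)
qed

text \<open>A separated set of popular forms of largest size is a net, and the bound on separated
  sets provides one.\<close>

lemma popular_net:
  fixes M \<kappa> \<kappa>' :: real
  assumes "finite I" "J \<subseteq> I" "bounded_density n I M \<mu>" "0 < M" "0 < \<kappa>" "0 < \<kappa>'"
    "\<And>p. multilinear J p \<Longrightarrow>
      1 / (4 * (M / \<kappa>)) * card (vecs n J) < (\<Sum>x\<in>vecs n J. chi (p x)) \<Longrightarrow>
      \<exists>q. sum_of (split_form J) s q \<and> (\<forall>x\<in>Pi J (\<lambda>i. vec_space (n i)). p x = q x)"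
  shows "\<exists>T. finite T \<and> card T \<le> 4 * (M / \<kappa>) / \<kappa>' \<and> (\<forall>p\<in>T. multilinear J p) \<and>
    (\<forall>p. popular n I J \<mu> \<kappa> \<kappa>' t p \<longrightarrow> (\<exists>p'\<in>T. close_forms n J (s + 2 * t) p p'))"
proof -
  define sep where "sep T \<longleftrightarrow> finite T \<and> (\<forall>p\<in>T. popular n I J \<mu> \<kappa> \<kappa>' t p) \<and>
     (\<forall>p\<in>T. \<forall>p'\<in>T. p \<noteq> p' \<longrightarrow> \<not> close_forms n J (s + 2 * t) p p')" for T
  have bound: "card T \<le> 4 * (M / \<kappa>) / \<kappa>'" if "sep T" for T
    using that unfolding sep_def by (intro popular_separated_card_le[OF assms(1-6) _ _ _ assms(7)]) auto
  then have "card T \<le> nat \<lfloor>4 * (M / \<kappa>) / \<kappa>'\<rfloor>" if "sep T" for T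
    using that by (simp add: le_nat_floor)
  moreover have "sep {}" by (simp add: sep_def)
  ultimately have "\<exists>T. sep T \<and> (\<forall>T'. sep T' \<longrightarrow> card T' \<le> card T)"
    by (intro ex_has_greatest_nat[of sep "{}" card "Suc (nat \<lfloor>4 * (M / \<kappa>) / \<kappa>'\<rfloor>)"])
      (auto simp: le_Suc_eq less_Suc_eq_le)
  then obtain T where T: "sep T" "\<And>T'. sep T' \<Longrightarrow> card T' \<le> card T" by blast
  have sym: "close_forms n J (s + 2 * t) p p' \<Longrightarrow> close_forms n J (s + 2 * t) p' p" for p p'
    unfolding close_forms_def by (simp add: add.commute)
  have "\<exists>p'\<in>T. close_forms n J (s + 2 * t) p p'" if p: "popular n I J \<mu> \<kappa> \<kappa>' t p" for p
  proof (rule ccontr)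
    assume neg: "\<not> ?thesis"
    have "close_forms n J (s + 2 * t) p p"
      unfolding close_forms_def by (intro exI[of _ "\<lambda>_. 0"]) (simp add: sum_of_zero)
    with neg have "p \<notin> T" by auto
    moreover have "sep (insert p T)" using T(1) p neg sym by (auto simp: sep_def)
    then have "card (insert p T) \<le> card T" by (rule T(2))
    ultimately show False using T(1) by (simp add: sep_def)
  qed
  with T(1) bound show ?thesis by (intro exI[of _ T]) (auto simp: sep_def popular_def)
qed

lemma sum_of_sum_le:
  assumes "finite S" "card S \<le> m" "\<And>s. s \<in> S \<Longrightarrow> sum_of P t (f s)"
  shows "sum_of P (m * t) (\<lambda>x. \<Sum>s\<in>S. f s x)"
  by (rule sum_of_mono[OF sum_of_sum[OF assms(1,3)]]) (use assms(2) in auto)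

text \<open>Fibres of relative weight below \<open>\<kappa>\<close> contribute at most
  \<open>\<bar>\<kappa>\<bar>\<close> in total; on the others Markov's inequality with threshold 1/8
  gives the factor 8.\<close>

lemma mass_unfits_le:
  fixes M \<kappa> :: real
  assumes I: "finite I" "J \<subseteq> I" and \<mu>: "bounded_density n I M \<mu>"
  shows "(\<Sum>y\<in>vecs n (I - J). marginal n J \<mu> y *
      of_bool (\<not> (\<kappa> \<le> marginal n J \<mu> y * card (vecs n (I - J)) \<and>
        (\<Sum>x\<in>vecs n J. \<mu> (override_on y x J) * of_bool (r (override_on y x J) = 1))
          \<le> marginal n J \<mu> y / 8))) \<le> \<bar>\<kappa>\<bar> + 8 * mass n I \<mu> r"
proof -
  define NK where "NK = real (card (vecs n (I - J)))"
  define R where "R y = (\<Sum>x\<in>vecs n J. \<mu> (override_on y x J) * of_bool (r (override_on y x J) = 1))" for y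
  have NK: "NK > 0" using card_vecs_pos[of "I - J" n] I by (simp add: NK_def)
  have "marginal n J \<mu> y * of_bool (\<not> (\<kappa> \<le> marginal n J \<mu> y * NK \<and> R y \<le> marginal n J \<mu> y / 8))
    \<le> \<bar>\<kappa>\<bar> / NK + 8 * R y" if y: "y \<in> vecs n (I - J)" for y
  proof -
    have "override_on y x J \<in> vecs n I" if "x \<in> vecs n J" for x
      using I(2) y that by (intro override_on_in_vecs)
    then have "0 \<le> R y" unfolding R_def
      using \<mu> by (intro sum_nonneg mult_nonneg_nonneg) (auto simp: bounded_density_def)
    moreover have "0 \<le> \<bar>\<kappa>\<bar> / NK" using NK by simp
    moreover have "marginal n J \<mu> y \<le> \<bar>\<kappa>\<bar> / NK" if "\<not> \<kappa> \<le> marginal n J \<mu> y * NK"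
      using that NK by (simp add: pos_le_divide_eq)
    ultimately show ?thesis by (cases "\<kappa> \<le> marginal n J \<mu> y * NK") (auto simp: of_bool_def)
  qed
  then have "(\<Sum>y\<in>vecs n (I - J). marginal n J \<mu> y *
       of_bool (\<not> (\<kappa> \<le> marginal n J \<mu> y * NK \<and> R y \<le> marginal n J \<mu> y / 8)))
    \<le> (\<Sum>y\<in>vecs n (I - J). \<bar>\<kappa>\<bar> / NK + 8 * R y)"
    by (rule sum_mono)
  also have "\<dots> = \<bar>\<kappa>\<bar> + 8 * (\<Sum>y\<in>vecs n (I - J). R y)"
    using NK by (simp add: sum.distrib NK_def[symmetric] sum_distrib_left)
  also have "(\<Sum>y\<in>vecs n (I - J). R y) = mass n I \<mu> r"
    unfolding R_def mass_def by (rule sum_vecs_split[OF I(2), symmetric])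
  finally show ?thesis by (simp only: NK_def R_def)
qed

text \<open>The main reduction: forms of bounded complexity that nearly vanish on \<open>\<mu>\<close> agree, up to a
  structured form, with forms of bounded complexity that do not involve the maximal index set \<open>J\<close>.
  Write \<open>r = \<Sum>\<^sub>i a\<^sub>i b\<^sub>i + g\<close> with \<open>a\<^sub>i\<close> over \<open>J\<close> and \<open>b\<^sub>i\<close> over \<open>I - J\<close>, and view \<open>b (y)\<close> as a vector.
  For most \<open>y\<close> the form \<open>\<Sum>\<^sub>i b\<^sub>i (y) a\<^sub>i\<close> is popular, and hence near one of boundedly many
  forms. In a basis adapted to the values of \<open>b (y)\<close> that give popular forms, the coordinates of
  \<open>b\<close> outside of their span nearly vanish on the marginal, so they are structured.\<close>

lemma remove_maximal_part:
  fixes \<epsilon> :: real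
  assumes I: "finite I" "J \<subseteq> I" "J \<noteq> {}"
    and maximal: "\<And>A. A \<in> \<J> \<Longrightarrow> J \<subseteq> A \<Longrightarrow> A = J"
    and down: "\<And>B. B \<subset> J \<Longrightarrow> B \<noteq> {} \<Longrightarrow> B \<in> \<J>"
    and \<epsilon>: "0 < \<epsilon>" "structured_vanishing \<epsilon> (I - J)"
    and bias: "\<And>\<gamma>::real. 0 < \<gamma> \<Longrightarrow>
      \<exists>s. \<forall>n p. multilinear J p \<and> \<gamma> * card (vecs n J) < (\<Sum>x\<in>vecs n J. chi (p x)) \<longrightarrow>
      (\<exists>q. sum_of (split_form J) s q \<and> (\<forall>x\<in>Pi J (\<lambda>i. vec_space (n i)). p x = q x))"
  shows "\<exists>k t'. \<forall>n \<mu>. bounded_density n I M \<mu> \<longrightarrow> (\<exists>\<V>. family I k \<V> \<and>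
    (\<forall>r. sum_of (product_form \<J> I) t r \<and> mass n I \<mu> r \<le> \<epsilon> / 32 \<longrightarrow>
      (\<exists>r'. sum_of (product_form (\<J> - {J}) I) t' r' \<and> in_span n I \<V> (\<lambda>x. r x + r' x))))"
proof -
  define M' where "M' = max M 1"
  \<comment> \<open>The weight lost below is \<open>\<epsilon> / 4\<close> for light fibres,
    \<open>8 * \<epsilon> / 32\<close> in Markov's inequality, and \<open>\<kappa>'\<close> for each
    of at most \<open>2 ^ t\<close> unpopular combinations. The total
    \<open>3 * \<epsilon> / 4\<close> is within the \<open>\<epsilon>\<close> allowed over
    \<open>I - J\<close>.\<close>
  define \<kappa> \<kappa>' where "\<kappa> = \<epsilon> / 4" and "\<kappa>' = \<epsilon> / (4 * 2 ^ t)"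
  define K where "K = I - J"
  have pos: "0 < M'" "0 < \<kappa>" "0 < \<kappa>'" using \<epsilon> by (auto simp: M'_def \<kappa>_def \<kappa>'_def)
  have "0 < 1 / (4 * (M' / \<kappa>))" using pos by simp
  from bias[OF this] obtain s where s: "\<And>n p. multilinear J p \<Longrightarrow>
      1 / (4 * (M' / \<kappa>)) * card (vecs n J) < (\<Sum>x\<in>vecs n J. chi (p x)) \<Longrightarrow>
      \<exists>q. sum_of (split_form J) s q \<and> (\<forall>x\<in>Pi J (\<lambda>i. vec_space (n i)). p x = q x)"
    by blast
  from \<epsilon>(2)[unfolded structured_vanishing_def, THEN spec, of M', folded K_def]
  obtain kK where kK: "\<forall>n \<mu>. bounded_density n K M' \<mu> \<longrightarrow>
      (\<exists>\<V>. family K kK \<V> \<and>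
        (\<forall>r. multilinear K r \<and> mass n K \<mu> r \<le> \<epsilon> \<longrightarrow> in_span n K \<V> r))"
    by blast
  define kT where "kT = nat \<lfloor>4 * (M' / \<kappa>) / \<kappa>'\<rfloor>"
  define s' where "s' = s + 2 * t"
  \<comment> \<open>Up to \<open>2 ^ t\<close> basis vectors, for each a form of \<open>s'\<close>
    split terms times a cofactor of \<open>t\<close> terms, and then the \<open>t\<close> terms of
    \<open>g\<close>.\<close>
  define t' where "t' = 2 ^ t * (s' * t) + t"
  show ?thesis
  proof (rule exI[of _ "kT + kK"], rule exI[of _ t'], intro allI impI)
    fix n \<mu> assume "bounded_density n I M \<mu>"
    then have \<mu>: "bounded_density n I M' \<mu>"
      by (rule bounded_density_mono) (simp add: M'_def)
    define w where "w = marginal n J \<mu>"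
    have w: "bounded_density n K M' w"
      unfolding w_def K_def by (rule bounded_density_marginal[OF I(1,2) \<mu>])
    from kK[rule_format, OF w] obtain \<V>K where \<V>K: "family K kK \<V>K"
      "\<And>r. multilinear K r \<Longrightarrow> mass n K w r \<le> \<epsilon> \<Longrightarrow> in_span n K \<V>K r" by blast
    let ?Pop = "popular n I J \<mu> \<kappa> \<kappa>' t"
    from popular_net[OF I(1,2) \<mu> pos s, where t = t] obtain T where T: "finite T"
      "card T \<le> 4 * (M' / \<kappa>) / \<kappa>'" "\<And>p. p \<in> T \<Longrightarrow> multilinear J p"
      "\<And>p. ?Pop p \<Longrightarrow> \<exists>p'\<in>T. close_forms n J s' p p'" unfolding s'_def by blast
    define \<V> where "\<V> = Pair J ` T \<union> \<V>K"
    have fin\<V>: "finite \<V>" using T(1) \<V>K(1) by (simp add: \<V>_def family_def)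
    have "family I (kT + kK) \<V>"
    proof -
      have "card T \<le> kT" using T(2) unfolding kT_def by (simp add: le_nat_floor)
      then have "card \<V> \<le> kT + kK"
        unfolding \<V>_def using \<V>K(1) card_image_le[OF T(1), of "Pair J"]
        by (intro order_trans[OF card_Un_le] add_mono) (auto simp: family_def)
      then show ?thesis
        using fin\<V> \<V>K(1) I T(3) by (auto simp: \<V>_def family_def K_def)
    qed
    moreover have "\<exists>r'. sum_of (product_form (\<J> - {J}) I) t' r' \<and> in_span n I \<V> (\<lambda>x. r x + r' x)"
      if r: "sum_of (product_form \<J> I) t r" "mass n I \<mu> r \<le> \<epsilon> / 32" for r
    proof -
      from sum_of_product_form_extract[OF r(1) I(3)] obtain t1 a b g where t1: "t1 \<le> t"
        and a: "\<And>i. i < t1 \<Longrightarrow> multilinear J (a i)"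
        and b: "\<And>i. i < t1 \<Longrightarrow> product_form (\<J> - {J}) K (b i)"
        and g: "sum_of (product_form (\<J> - {J}) I) t g"
        and r_eq: "r = (\<lambda>x. (\<Sum>i<t1. a i x * b i x) + g x)"
        unfolding K_def by blast
      have b_ml: "multilinear K (b i)" if "i < t1" for i
        using b[OF that] by (rule product_form_multilinear)
      define P where "P \<beta> x = (\<Sum>i<t1. \<beta> i * a i x)" for \<beta> :: "nat \<Rightarrow> bit" and x
      have P_ml: "multilinear J (P \<beta>)" for \<beta>
        unfolding P_def by (intro multilinear_sum multilinear_scale a) auto
      define \<beta> where "\<beta> x i = (if i < t1 then b i x else 0)" for x i
      have \<beta>_in: "\<beta> x \<in> vec_space t1" for x by (simp add: \<beta>_def vec_space_def)
      define A where "A = {\<beta>' \<in> vec_space t1. ?Pop (P \<beta>')}"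
      obtain \<B> \<B>0 \<phi> where \<B>: "\<B>0 \<subseteq> \<B>" "\<B> \<subseteq> vec_space t1" "\<B>0 \<subseteq> A"
        "\<And>\<beta> i. \<beta> \<in> vec_space t1 \<Longrightarrow> \<beta> i = (\<Sum>e\<in>\<B>. (\<Sum>j<t1. \<beta> j * \<phi> e j) * e i)"
        "\<And>\<beta> e. \<beta> \<in> A \<Longrightarrow> e \<in> \<B> - \<B>0 \<Longrightarrow> (\<Sum>j<t1. \<beta> j * \<phi> e j) = 0"
        by (rule basis_split[of A t1]) (auto simp: A_def)
      have fin\<B>: "finite \<B>" using \<B>(2) finite_vec_space by (rule finite_subset)
      define c where "c e x = (\<Sum>j<t1. \<beta> x j * \<phi> e j)" for e x
      have c_eq: "c e = (\<lambda>x. \<Sum>j<t1. \<phi> e j * b j x)" for e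
        by (auto simp: c_def \<beta>_def fun_eq_iff mult.commute intro!: sum.cong)
      have c_ml: "multilinear K (c e)" for e
        unfolding c_eq by (intro multilinear_sum multilinear_scale b_ml) auto
      have main: "(\<Sum>i<t1. a i x * b i x) = (\<Sum>e\<in>\<B>. P e x * c e x)" for x
      proof -
        have "b i x = (\<Sum>e\<in>\<B>. c e x * e i)" if "i < t1" for i
          using \<B>(4)[OF \<beta>_in, of x i] that by (simp add: c_def \<beta>_def)
        then have "(\<Sum>i<t1. a i x * b i x) = (\<Sum>i<t1. a i x * (\<Sum>e\<in>\<B>. c e x * e i))"
          by (intro sum.cong) auto
        also have "\<dots> = (\<Sum>i<t1. \<Sum>e\<in>\<B>. e i * a i x * c e x)"
          by (simp only: sum_distrib_left ac_simps)
        also have "\<dots> = (\<Sum>e\<in>\<B>. P e x * c e x)"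
          unfolding P_def sum_distrib_right by (rule sum.swap)
        finally show ?thesis .
      qed
      define good where "good y \<longleftrightarrow> \<kappa> \<le> w y * card (vecs n K) \<and>
        (\<Sum>x\<in>vecs n J. \<mu> (override_on y x J) * of_bool (r (override_on y x J) = 1)) \<le> w y / 8"
        for y
      have bad: "(\<Sum>y\<in>vecs n K. w y * of_bool (\<not> good y)) \<le> \<epsilon> / 2"
        using mass_unfits_le[OF I(1,2) \<mu>, of \<kappa> r] r(2) \<epsilon>
        by (simp add: good_def w_def K_def \<kappa>_def)
      have fits: "fits_fibre n I J \<mu> \<kappa> t (P (\<beta> y)) y" if "good y" for y
        unfolding fits_fibre_def
      proof (intro conjI exI)
        \<comment> \<open>By maximality no part in \<open>\<J> - {J}\<close> contains
          \<open>J\<close>, so every term of \<open>g\<close> splits on the fibre.\<close>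
        show "sum_of (split_form J) t (\<lambda>x. g (override_on y x J))"
          by (rule sum_of_comp[OF g product_form_override_split[of "\<J> - {J}" I]])
            (use I maximal in auto)
        have "r (override_on y x J) = P (\<beta> y) x + g (override_on y x J)" for x
        proof -
          have "a i (override_on y x J) = a i x" "b i (override_on y x J) = b i y" if "i < t1" for i
            using multilinear_cong[OF a[OF that], of "override_on y x J" x]
              multilinear_cong[OF b_ml[OF that], of "override_on y x J" y]
            by (auto simp: override_on_def K_def)
          then show ?thesis by (simp add: r_eq P_def \<beta>_def mult.commute)
        qed
        then show "(\<Sum>x\<in>vecs n J. \<mu> (override_on y x J) *
            of_bool (P (\<beta> y) x + g (override_on y x J) = 1)) \<le> marginal n J \<mu> y / 8"
          using that by (simp add: good_def w_def)
      qed (use that in \<open>simp add: good_def w_def K_def\<close>)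
      have w_nonneg: "0 \<le> w y" if "y \<in> vecs n K" for y
        using w that by (simp add: bounded_density_def)
      have unpop: "(\<Sum>y\<in>vecs n K. w y * of_bool (\<beta> y \<notin> A)) \<le> \<epsilon>"
      proof -
        let ?U = "vec_space t1 - A" and ?E = "\<lambda>\<beta>' y. fits_fibre n I J \<mu> \<kappa> t (P \<beta>') y"
        \<comment> \<open>Union bound: on a good fibre with \<open>\<beta> y\<close> outside
          \<open>A\<close>, the combination \<open>P (\<beta> y)\<close> is itself an unpopular form
          that fits.\<close>
        have "of_bool (\<beta> y \<notin> A) \<le> of_bool (\<not> good y) + (\<Sum>\<beta>'\<in>?U. of_bool (?E \<beta>' y) :: real)" for y
        proof (cases "good y \<and> \<beta> y \<notin> A")
          case True
          then have "\<beta> y \<in> ?U" "?E (\<beta> y) y" using \<beta>_in fits by auto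
          then have "of_bool (?E (\<beta> y) y) \<le> (\<Sum>\<beta>'\<in>?U. of_bool (?E \<beta>' y) :: real)"
            by (intro member_le_sum) auto
          with True fits show ?thesis by simp
        next
          case False
          have "0 \<le> (\<Sum>\<beta>'\<in>?U. of_bool (?E \<beta>' y) :: real)" by (intro sum_nonneg) auto
          with False show ?thesis by (auto simp: of_bool_def)
        qed
        then have "(\<Sum>y\<in>vecs n K. w y * of_bool (\<beta> y \<notin> A)) \<le>
           (\<Sum>y\<in>vecs n K. w y * (of_bool (\<not> good y) + (\<Sum>\<beta>'\<in>?U. of_bool (?E \<beta>' y))))"
          by (intro sum_mono mult_left_mono w_nonneg)
        also have "\<dots> = (\<Sum>y\<in>vecs n K. w y * of_bool (\<not> good y)) +
           (\<Sum>y\<in>vecs n K. \<Sum>\<beta>'\<in>?U. w y * of_bool (?E \<beta>' y))"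
          by (simp only: distrib_left sum.distrib sum_distrib_left)
        also have "(\<Sum>y\<in>vecs n K. \<Sum>\<beta>'\<in>?U. w y * of_bool (?E \<beta>' y)) =
           (\<Sum>\<beta>'\<in>?U. \<Sum>y\<in>vecs n K. w y * of_bool (?E \<beta>' y))" by (rule sum.swap)
        also have "\<dots> \<le> (\<Sum>\<beta>'\<in>?U. \<kappa>')"
        proof (rule sum_mono)
          fix \<beta>' assume "\<beta>' \<in> ?U"
          then have "\<not> ?Pop (P \<beta>')" by (auto simp: A_def)
          then show "(\<Sum>y\<in>vecs n K. w y * of_bool (?E \<beta>' y)) \<le> \<kappa>'"
            using P_ml by (simp add: popular_def w_def K_def)
        qed
        also have "\<dots> \<le> 2 ^ t * \<kappa>'"
        proof -
          have "card ?U \<le> card (vec_space t1)" by (intro card_mono) auto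
          also have "\<dots> \<le> 2 ^ t" using t1 by (simp add: card_vec_space)
          finally have "real (card ?U) \<le> 2 ^ t" using of_nat_mono by fastforce
          then show ?thesis using pos by (simp add: mult_right_mono)
        qed
        also have "2 ^ t * \<kappa>' = \<epsilon> / 4" by (simp add: \<kappa>'_def)
        finally show ?thesis using bad \<epsilon> by linarith
      qed
      have "in_span n I \<V> (\<lambda>x. P e x * c e x)" if e: "e \<in> \<B> - \<B>0" for e
      proof -
        \<comment> \<open>The coordinate \<open>c e\<close> vanishes wherever the vector of cofactor
          values lies in \<open>A\<close>.\<close>
        have "mass n K w (c e) \<le> (\<Sum>y\<in>vecs n K. w y * of_bool (\<beta> y \<notin> A))"
          unfolding mass_def
        proof (intro sum_mono mult_left_mono w_nonneg)
          fix y
          show "of_bool (c e y = 1) \<le> (of_bool (\<beta> y \<notin> A) :: real)"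
            using \<B>(5)[OF _ e, of "\<beta> y"] by (auto simp: c_def)
        qed
        then have "in_span n K \<V>K (c e)"
          using unpop by (intro \<V>K(2) c_ml) simp
        then have "in_span n (K \<union> J) \<V>K (\<lambda>x. P e x * c e x)"
          by (rule in_span_mult[OF _ P_ml]) (use \<V>K(1) in \<open>auto simp: K_def family_def\<close>)
        moreover have "K \<union> J = I" using I by (auto simp: K_def)
        ultimately show ?thesis using fin\<V> by (auto simp: \<V>_def intro: in_span_mono)
      qed
      then have span1: "in_span n I \<V> (\<lambda>x. \<Sum>e\<in>\<B> - \<B>0. P e x * c e x)"
        by (rule in_span_sum)
      \<comment> \<open>The vectors of \<open>\<B>0\<close> lie in \<open>A\<close> themselves, so
        each \<open>P e\<close> is near a form of the net, with remainder
        \<open>q e\<close>.\<close>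
      have "\<forall>e. \<exists>p' q. e \<in> \<B>0 \<longrightarrow> p' \<in> T \<and> sum_of (split_form J) s' q \<and>
         (\<forall>x\<in>Pi J (\<lambda>i. vec_space (n i)). P e x + p' x = q x)"
        using T(4) \<B>(3) unfolding A_def close_forms_def by blast
      then obtain p' q where pq: "\<And>e. e \<in> \<B>0 \<Longrightarrow> p' e \<in> T"
        "\<And>e. e \<in> \<B>0 \<Longrightarrow> sum_of (split_form J) s' (q e)"
        "\<And>e x. e \<in> \<B>0 \<Longrightarrow> x \<in> Pi J (\<lambda>i. vec_space (n i)) \<Longrightarrow> P e x + p' e x = q e x"
        by metis
      have span0: "in_span n I \<V> (\<lambda>x. \<Sum>e\<in>\<B>0. p' e x * c e x)"
      proof (rule in_span_sum)
        fix e assume "e \<in> \<B>0"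
        then show "in_span n I \<V> (\<lambda>x. p' e x * c e x)"
          using pq(1) c_ml by (intro in_span_member[OF fin\<V>, of J]) (auto simp: \<V>_def K_def)
      qed
      define r' where "r' x = (\<Sum>e\<in>\<B>0. q e x * c e x) + g x" for x
      have "sum_of (product_form (\<J> - {J}) I) t' r'"
        unfolding r'_def t'_def
      proof (intro sum_of_add g sum_of_sum_le)
        show fin\<B>0: "finite \<B>0" using fin\<B> \<B>(1) by (rule finite_subset[rotated])
        have "card \<B>0 \<le> card (vec_space t1)" using \<B>(1,2) by (intro card_mono) auto
        also have "\<dots> \<le> 2 ^ t" using t1 by (simp add: card_vec_space)
        finally show "card \<B>0 \<le> 2 ^ t" .
        fix e assume e: "e \<in> \<B>0"
        have "sum_of (product_form (\<J> - {J}) K) (t * 1) (c e)"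
          unfolding c_eq
        proof (rule sum_of_sum_le)
          fix j assume "j \<in> {..<t1}"
          then show "sum_of (product_form (\<J> - {J}) K) 1 (\<lambda>x. \<phi> e j * b j x)"
            using sum_of_single[of "product_form (\<J> - {J}) K", OF b[of j]]
            by (cases "\<phi> e j") (auto simp: sum_of_zero)
        qed (use t1 in auto)
        then have ce: "sum_of (product_form (\<J> - {J}) K) t (c e)" by simp
        show "sum_of (product_form (\<J> - {J}) I) (s' * t) (\<lambda>x. q e x * c e x)"
        proof (rule sum_of_mult[OF pq(2)[OF e] ce])
          fix f h assume fh: "split_form J f" "product_form (\<J> - {J}) K h"
          \<comment> \<open>The split form has parts strictly inside \<open>J\<close>, which belong
            to \<open>\<J>\<close> by downward closure, and \<open>J\<close> itself no longer
            occurs.\<close>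
          have "product_form (\<J> - {J}) (J \<union> K) (\<lambda>x. f x * h x)"
            by (intro product_form_mult split_form_product_form fh) (use down K_def in auto)
          moreover have "J \<union> K = I" using I by (auto simp: K_def)
          ultimately show "product_form (\<J> - {J}) I (\<lambda>x. f x * h x)" by simp
        qed
      qed
      moreover have "in_span n I \<V> (\<lambda>x. r x + r' x)"
      proof (rule in_span_cong[OF in_span_add[OF span0 span1]])
        fix x assume "x \<in> Pi I (\<lambda>i. vec_space (n i))"
        then have x: "x \<in> Pi J (\<lambda>i. vec_space (n i))" using I(2) by auto
        have "(\<Sum>e\<in>\<B>. P e x * c e x) = (\<Sum>e\<in>\<B> - \<B>0. P e x * c e x) + (\<Sum>e\<in>\<B>0. P e x * c e x)"
          using fin\<B> \<B>(1) by (rule sum.subset_diff[rotated])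
        moreover have "(\<Sum>e\<in>\<B>0. P e x * c e x) + (\<Sum>e\<in>\<B>0. q e x * c e x) =
            (\<Sum>e\<in>\<B>0. p' e x * c e x)"
          unfolding sum.distrib[symmetric]
        proof (rule sum.cong[OF refl])
          fix e assume "e \<in> \<B>0"
          from pq(3)[OF this x] have "q e x = P e x + p' e x" by simp
          then show "P e x * c e x + q e x * c e x = p' e x * c e x"
            by (cases "P e x"; cases "p' e x"; cases "c e x") simp_all
        qed
        moreover have "l + r0 + g' + (s0 + g') = (r0 + s0) + l" for l r0 s0 g' :: bit
          by (cases l; cases r0; cases s0; cases g') simp_all
        ultimately show "r x + r' x =
            (\<Sum>e\<in>\<B>0. p' e x * c e x) + (\<Sum>e\<in>\<B> - \<B>0. P e x * c e x)"
          by (simp only: r_eq r'_def main)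
      qed
      ultimately show ?thesis by blast
    qed
    ultimately show "\<exists>\<V>. family I (kT + kK) \<V> \<and>
      (\<forall>r. sum_of (product_form \<J> I) t r \<and> mass n I \<mu> r \<le> \<epsilon> / 32 \<longrightarrow>
       (\<exists>r'. sum_of (product_form (\<J> - {J}) I) t' r' \<and> in_span n I \<V> (\<lambda>x. r x + r' x)))"
      by blast
  qed
qed

text \<open>Here \<open>\<epsilon>\<close> precedes not only \<open>M\<close> but also the number
  \<open>t\<close> of terms: removing a part enlarges both by amounts not known in advance.\<close>

definition structured_sums :: "real \<Rightarrow> nat set set \<Rightarrow> nat set \<Rightarrow> bool" where
  "structured_sums \<epsilon> \<J> I \<longleftrightarrow> (\<forall>M t. \<exists>k. \<forall>n \<mu>. bounded_density n I M \<mu> \<longrightarrow>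
     (\<exists>\<V>. family I k \<V> \<and>
       (\<forall>r. sum_of (product_form \<J> I) t r \<and> mass n I \<mu> r \<le> \<epsilon> \<longrightarrow> in_span n I \<V> r)))"

lemma mass_cong:
  assumes "\<And>x. x \<in> vecs n I \<Longrightarrow> \<mu> x \<noteq> 0 \<Longrightarrow> f x = g x"
  shows "mass n I \<mu> f = mass n I \<mu> g"
  unfolding mass_def
proof (rule sum.cong[OF refl])
  fix x assume "x \<in> vecs n I"
  then show "\<mu> x * of_bool (f x = 1) = \<mu> x * of_bool (g x = 1)"
    using assms[of x] by (cases "\<mu> x = 0") auto
qed

text \<open>On the support of the regularised density the structured part vanishes. There the
  remainder \<open>r'\<close> agrees with \<open>r\<close> and inherits its small mass, up to
  \<open>4 ^ card I\<close>. It has no factor over \<open>J\<close>, so the smaller collection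
  applies to it.\<close>

lemma structured_sums_insert:
  fixes \<epsilon> \<epsilon>' :: real
  assumes I: "finite I" "J \<subseteq> I" "J \<noteq> {}"
    and maximal: "\<And>A. A \<in> \<J> \<Longrightarrow> J \<subseteq> A \<Longrightarrow> A = J"
    and down: "\<And>B. B \<subset> J \<Longrightarrow> B \<noteq> {} \<Longrightarrow> B \<in> \<J>"
    and \<epsilon>: "0 < \<epsilon>" "structured_vanishing \<epsilon> (I - J)"
    and bias: "\<And>\<gamma>::real. 0 < \<gamma> \<Longrightarrow>
      \<exists>s. \<forall>n p. multilinear J p \<and> \<gamma> * card (vecs n J) < (\<Sum>x\<in>vecs n J. chi (p x)) \<longrightarrow>
      (\<exists>q. sum_of (split_form J) s q \<and> (\<forall>x\<in>Pi J (\<lambda>i. vec_space (n i)). p x = q x))"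
    and IH: "0 < \<epsilon>'" "structured_sums \<epsilon>' (\<J> - {J}) I"
  shows "structured_sums (min (\<epsilon> / 32) (\<epsilon>' / 4 ^ card I)) \<J> I"
  unfolding structured_sums_def
proof (intro allI)
  fix M :: real and t
  let ?\<epsilon> = "min (\<epsilon> / 32) (\<epsilon>' / 4 ^ card I)"
  from remove_maximal_part[OF assms(1-8), where M = M and t = t] obtain k1 t' where
    1: "\<And>n \<mu>. bounded_density n I M \<mu> \<Longrightarrow> (\<exists>\<V>. family I k1 \<V> \<and>
    (\<forall>r. sum_of (product_form \<J> I) t r \<and> mass n I \<mu> r \<le> \<epsilon> / 32 \<longrightarrow>
      (\<exists>r'. sum_of (product_form (\<J> - {J}) I) t' r' \<and> in_span n I \<V> (\<lambda>x. r x + r' x))))"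
    by blast
  from regularize[OF I(1), of M k1] obtain M' where
    2: "\<And>n \<mu> \<V>. bounded_density n I M \<mu> \<Longrightarrow> family I k1 \<V> \<Longrightarrow>
      (\<exists>\<mu>'. bounded_density n I M' \<mu>' \<and>
        (\<forall>x\<in>vecs n I. \<mu>' x \<noteq> 0 \<longrightarrow> (\<forall>p\<in>\<V>. snd p x = 0)) \<and>
        (\<forall>r. multilinear I r \<longrightarrow> mass n I \<mu>' r \<le> 4 ^ card I * mass n I \<mu> r))"
    by blast
  from IH(2)[unfolded structured_sums_def, THEN spec, of M', THEN spec, of t'] obtain k2 where
    3: "\<forall>n \<mu>. bounded_density n I M' \<mu> \<longrightarrow> (\<exists>\<V>. family I k2 \<V> \<and>
       (\<forall>r. sum_of (product_form (\<J> - {J}) I) t' r \<and> mass n I \<mu> r \<le> \<epsilon>' \<longrightarrow> in_span n I \<V> r))"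
    by blast
  show "\<exists>k. \<forall>n \<mu>. bounded_density n I M \<mu> \<longrightarrow> (\<exists>\<V>. family I k \<V> \<and>
       (\<forall>r. sum_of (product_form \<J> I) t r \<and> mass n I \<mu> r \<le> ?\<epsilon> \<longrightarrow> in_span n I \<V> r))"
  proof (rule exI[of _ "k1 + k2"], intro allI impI)
    fix n \<mu> assume \<mu>: "bounded_density n I M \<mu>"
    from 1[OF this] obtain \<V>1 where \<V>1: "family I k1 \<V>1"
      "\<And>r. sum_of (product_form \<J> I) t r \<Longrightarrow> mass n I \<mu> r \<le> \<epsilon> / 32 \<Longrightarrow>
      (\<exists>r'. sum_of (product_form (\<J> - {J}) I) t' r' \<and> in_span n I \<V>1 (\<lambda>x. r x + r' x))" by blast
    from 2[OF \<mu> \<V>1(1)] obtain \<mu>' where \<mu>': "bounded_density n I M' \<mu>'"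
      "\<And>x p. x \<in> vecs n I \<Longrightarrow> \<mu>' x \<noteq> 0 \<Longrightarrow> p \<in> \<V>1 \<Longrightarrow> snd p x = 0"
      "\<And>r. multilinear I r \<Longrightarrow> mass n I \<mu>' r \<le> 4 ^ card I * mass n I \<mu> r" by blast
    from 3[rule_format, OF \<mu>'(1)] obtain \<V>2 where \<V>2: "family I k2 \<V>2"
      "\<And>r. sum_of (product_form (\<J> - {J}) I) t' r \<Longrightarrow> mass n I \<mu>' r \<le> \<epsilon>' \<Longrightarrow> in_span n I \<V>2 r"
      by blast
    have "card (\<V>1 \<union> \<V>2) \<le> k1 + k2"
      using \<V>1(1) \<V>2(1) by (intro order_trans[OF card_Un_le] add_mono) (auto simp: family_def)
    then have fam: "family I (k1 + k2) (\<V>1 \<union> \<V>2)"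
      using \<V>1(1) \<V>2(1) unfolding family_def by blast
    moreover have "in_span n I (\<V>1 \<union> \<V>2) r"
      if r: "sum_of (product_form \<J> I) t r" "mass n I \<mu> r \<le> ?\<epsilon>" for r
    proof -
      from r(2) have "mass n I \<mu> r \<le> \<epsilon> / 32" by simp
      from \<V>1(2)[OF r(1) this] obtain r' where r': "sum_of (product_form (\<J> - {J}) I) t' r'"
        "in_span n I \<V>1 (\<lambda>x. r x + r' x)" by blast
      have "r x = r' x" if "x \<in> vecs n I" "\<mu>' x \<noteq> 0" for x
      proof -
        have "x \<in> Pi I (\<lambda>i. vec_space (n i))" using that by (auto simp: vecs_def)
        then obtain c where "r x + r' x = (\<Sum>p\<in>\<V>1. snd p x * c p x)"
          using r'(2) unfolding in_span_def by blast
        also have "\<dots> = 0" using \<mu>'(2)[OF that] by (intro sum.neutral) simp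
        finally show ?thesis by (cases "r x"; cases "r' x") simp_all
      qed
      then have "mass n I \<mu>' r' = mass n I \<mu>' r" by (intro mass_cong) simp
      also have "\<dots> \<le> 4 ^ card I * mass n I \<mu> r"
        by (intro \<mu>'(3) multilinear_sum_of[OF r(1)] product_form_multilinear)
      also have "\<dots> \<le> 4 ^ card I * (\<epsilon>' / 4 ^ card I)"
        using r(2) by (intro mult_left_mono) auto
      finally have "mass n I \<mu>' r' \<le> \<epsilon>'" by simp
      then have "in_span n I \<V>2 r'" by (rule \<V>2(2)[OF r'(1)])
      have fin: "finite (\<V>1 \<union> \<V>2)" using fam by (simp add: family_def)
      have "in_span n I (\<V>1 \<union> \<V>2) (\<lambda>x. (r x + r' x) + r' x)"
        by (rule in_span_add[OF in_span_mono[OF r'(2) _ fin]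
              in_span_mono[OF \<open>in_span n I \<V>2 r'\<close> _ fin]]) auto
      then show ?thesis by (simp add: add.assoc)
    qed
    ultimately show "\<exists>\<V>. family I (k1 + k2) \<V> \<and>
       (\<forall>r. sum_of (product_form \<J> I) t r \<and> mass n I \<mu> r \<le> ?\<epsilon> \<longrightarrow> in_span n I \<V> r)"
      by blast
  qed
qed

text \<open>Removing a maximal member leaves a downward closed collection. When no part is left, a
  non-empty \<open>I\<close> admits no products and the form is zero. The hypothesis on proper
  subsets serves \<open>I - J\<close> for the cofactors and \<open>J - {j}\<close> for the biased
  forms.\<close>

lemma structured_sums_down_set:
  assumes I: "finite I" "I \<noteq> {}"
    and IH: "\<And>I'. I' \<subset> I \<Longrightarrow> \<exists>\<epsilon>>0. structured_vanishing \<epsilon> I'"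
    and \<J>: "\<J> \<subseteq> Pow I - {{}}" "\<And>A B. A \<in> \<J> \<Longrightarrow> B \<subseteq> A \<Longrightarrow> B \<noteq> {} \<Longrightarrow> B \<in> \<J>"
  shows "\<exists>\<epsilon>>0. structured_sums \<epsilon> \<J> I"
proof -
  have "finite \<J>" using \<J>(1) I(1) by (meson finite_Diff finite_Pow_iff finite_subset)
  then show ?thesis using \<J>
  proof (induction \<J> rule: finite_remove_induct)
    case empty
    have "r = (\<lambda>_. 0)" if "sum_of (product_form {} I) t r" for t r
      using that
    proof (induction rule: sum_of_induct)
      case (add g f t)
      then show ?case using I(2) by (auto elim: product_form.cases)
    qed simp
    then have "structured_sums 1 {} I"
      unfolding structured_sums_def family_def using in_span_zero
      by (intro allI exI[of _ 0] impI exI[of _ "{}"] conjI) auto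
    then show ?case by (intro exI[of _ 1]) simp
  next
    case (remove \<J>)
    obtain J where J: "J \<in> \<J>" "\<And>A. A \<in> \<J> \<Longrightarrow> J \<subseteq> A \<Longrightarrow> A = J"
      using finite_has_maximal[OF remove.hyps(1,2)] by blast
    then have JI: "J \<subseteq> I" "J \<noteq> {}" using remove.prems by auto
    obtain j where j: "j \<in> J" using JI by blast
    from IH[of "I - J"] JI obtain \<epsilon> where \<epsilon>: "0 < \<epsilon>" "structured_vanishing \<epsilon> (I - J)" by blast
    have "J - {j} \<subset> I" using j JI by blast
    from IH[OF this] obtain \<epsilon>j where \<epsilon>j: "0 < \<epsilon>j" "structured_vanishing \<epsilon>j (J - {j})" by blast
    have "\<exists>\<epsilon>>0. structured_sums \<epsilon> (\<J> - {J}) I"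
      by (rule remove.IH[OF J(1)]) (use remove.prems J(2) in blast)+
    then obtain \<epsilon>' where \<epsilon>': "0 < \<epsilon>'" "structured_sums \<epsilon>' (\<J> - {J}) I" by blast
    have "structured_sums (min (\<epsilon> / 32) (\<epsilon>' / 4 ^ card I)) \<J> I"
    proof (rule structured_sums_insert[OF I(1) JI J(2) _ \<epsilon> _ \<epsilon>'])
      show "B \<in> \<J>" if "B \<subset> J" "B \<noteq> {}" for B using remove.prems(2)[OF J(1)] that by blast
      show "\<exists>s. \<forall>n p. multilinear J p \<and> \<gamma> * card (vecs n J) < (\<Sum>x\<in>vecs n J. chi (p x)) \<longrightarrow>
        (\<exists>q. sum_of (split_form J) s q \<and> (\<forall>x\<in>Pi J (\<lambda>i. vec_space (n i)). p x = q x))"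
        if "0 < \<gamma>" for \<gamma> :: real
        using JI(1) I(1) j \<epsilon>j that
        by (intro biased_imp_sum_of_split[where j = j and \<epsilon> = \<epsilon>j]) (auto intro: finite_subset)
    qed
    then show ?case using \<epsilon>(1) \<epsilon>'(1)
      by (intro exI[of _ "min (\<epsilon> / 32) (\<epsilon>' / 4 ^ card I)"]) simp
  qed
qed

theorem structured_vanishing_finite:
  assumes "finite I"
  shows "\<exists>\<epsilon>>0. structured_vanishing \<epsilon> I"
  using assms
proof (induction I rule: finite_psubset_induct)
  case (psubset I)
  show ?case
  proof (cases "I = {}")
    case True
    \<comment> \<open>A form without arguments is constant, and the constant 1 has mass 1, above the
      bound 1/2.\<close>
    have "in_span n {} {} r" if \<mu>: "bounded_density n {} M \<mu>" and r: "multilinear {} r"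
      "mass n {} \<mu> r \<le> 1 / 2" for n M \<mu> r
    proof -
      have "r x = r (\<lambda>_. undefined)" for x using r(1) by (rule multilinear_cong) simp
      moreover have "r (\<lambda>_. undefined) = 0"
        using \<mu> r(2) by (cases "r (\<lambda>_. undefined)") (auto simp: mass_def bounded_density_def vecs_def)
      ultimately show ?thesis by (intro in_span_cong[OF in_span_zero]) metis
    qed
    then have "structured_vanishing (1 / 2) {}"
      unfolding structured_vanishing_def
      by (intro allI exI[of _ 0] impI exI[of _ "{}"] conjI) (auto simp: family_def)
    then show ?thesis using True by (intro exI[of _ "1 / 2"]) simp
  next
    case False
    obtain \<epsilon> where \<epsilon>: "0 < \<epsilon>" "structured_sums \<epsilon> (Pow I - {{}}) I"
      using structured_sums_down_set[OF psubset.hyps False psubset.IH, of "Pow I - {{}}"] by auto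
    have "sum_of (product_form (Pow I - {{}}) I) 1 r" if "multilinear I r" for r
      using that False by (intro sum_of_single product_form_single) auto
    with \<epsilon>(2) have "structured_vanishing \<epsilon> I"
      unfolding structured_vanishing_def structured_sums_def by meson
    with \<epsilon>(1) show ?thesis by blast
  qed
qed

section \<open>Fourier analysis\<close>

definition supported :: "'a set \<Rightarrow> ('a \<Rightarrow> bit) set" where
  "supported S = {f. \<forall>x. x \<notin> S \<longrightarrow> f x = 0}"

definition pairing :: "'a set \<Rightarrow> ('a \<Rightarrow> bit) \<Rightarrow> ('a \<Rightarrow> bit) \<Rightarrow> bit" where
  "pairing S r s = (\<Sum>x\<in>S. r x * s x)"

lemma pairing_add_left: "pairing S (r + r') s = pairing S r s + pairing S r' s"
  by (simp add: pairing_def distrib_right sum.distrib)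

lemma pairing_add_right: "pairing S r (s + s') = pairing S r s + pairing S r s'"
  by (simp add: pairing_def distrib_left sum.distrib)

lemma finite_supported: "finite S \<Longrightarrow> finite (supported S)"
proof -
  assume "finite S"
  have "supported S \<subseteq> (\<lambda>T x. of_bool (x \<in> T)) ` Pow S"
  proof
    fix f assume "f \<in> supported S"
    then have "f = (\<lambda>x. of_bool (x \<in> {x. f x = 1}))" "{x. f x = 1} \<in> Pow S"
      by (force simp: supported_def fun_eq_iff of_bool_def)+
    then show "f \<in> (\<lambda>T x. of_bool (x \<in> T)) ` Pow S" by (rule image_eqI)
  qed
  then show ?thesis using \<open>finite S\<close> by (meson finite_Pow_iff finite_imageI finite_subset)
qed

lemma supported_add: "r \<in> supported S \<Longrightarrow> s \<in> supported S \<Longrightarrow> r + s \<in> supported S"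
  by (simp add: supported_def)

lemma zero_in_supported: "0 \<in> supported S"
  by (simp add: supported_def)

lemma bit_fun_add_cancel: "a + b + b = a" "b + (b + a) = a" for a b :: "'a \<Rightarrow> bit"
  by (simp_all add: fun_eq_iff add.assoc)

lemma bit_fun_add_eq_0_iff: "a + b = 0 \<longleftrightarrow> a = b" for a b :: "'a \<Rightarrow> bit"
  by (metis bit_fun_add_cancel(1) add_0)

lemma sum_supported_translate:
  fixes F :: "_ \<Rightarrow> 'c::comm_monoid_add"
  assumes "b \<in> supported S"
  shows "(\<Sum>x\<in>supported S. F (x + b)) = (\<Sum>x\<in>supported S. F x)"
  by (rule sum.reindex_bij_witness[of _ "\<lambda>x. x + b" "\<lambda>x. x + b"])
    (use assms in \<open>simp_all only: bit_fun_add_cancel supported_add\<close>)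

text \<open>If \<open>x\<close> is 1 at \<open>z\<close>, flipping \<open>r\<close> at
  \<open>z\<close> reverses every sign.\<close>

lemma sum_chi_pairing:
  assumes "finite S" "x \<in> supported S"
  shows "(\<Sum>r\<in>supported S. chi (pairing S r x)) = (if x = 0 then card (supported S) else 0)"
proof (cases "x = 0")
  case True
  then show ?thesis by (simp add: pairing_def)
next
  case False
  then obtain z where z: "x z = 1" by (auto simp: fun_eq_iff)
  then have zS: "z \<in> S" using assms(2) by (force simp: supported_def)
  define \<delta> where "\<delta> = (\<lambda>y. of_bool (y = z) :: bit)"
  have "\<delta> \<in> supported S" using zS by (auto simp: \<delta>_def supported_def)
  have "pairing S \<delta> x = (\<Sum>y\<in>S. if y = z then x y else 0)"
    unfolding pairing_def \<delta>_def by (intro sum.cong) auto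
  also have "\<dots> = 1" using assms(1) zS z by simp
  finally have "chi (pairing S (r + \<delta>) x) = - chi (pairing S r x)" for r
    by (simp add: pairing_add_left chi_add)
  then have "(\<Sum>r\<in>supported S. chi (pairing S r x)) = - (\<Sum>r\<in>supported S. chi (pairing S r x))"
    using sum_supported_translate[OF \<open>\<delta> \<in> supported S\<close>, of "\<lambda>r. chi (pairing S r x)"]
    by (simp add: sum_negf)
  then show ?thesis using False by simp
qed

text \<open>Not normalised, whence the factor \<open>card (supported S)\<close> in
  \<open>parseval\<close>.\<close>

definition fourier :: "'a set \<Rightarrow> (('a \<Rightarrow> bit) \<Rightarrow> real) \<Rightarrow> ('a \<Rightarrow> bit) \<Rightarrow> real" where
  "fourier S f r = (\<Sum>x\<in>supported S. f x * chi (pairing S r x))"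

lemma parseval:
  fixes f :: "_ \<Rightarrow> real"
  assumes "finite S"
  shows "(\<Sum>r\<in>supported S. (fourier S f r)\<^sup>2) = card (supported S) * (\<Sum>x\<in>supported S. (f x)\<^sup>2)"
proof -
  let ?G = "supported S"
  have "(\<Sum>r\<in>?G. (fourier S f r)\<^sup>2) =
      (\<Sum>r\<in>?G. \<Sum>x\<in>?G. \<Sum>y\<in>?G. f x * f y * chi (pairing S r (x + y)))"
    by (simp add: fourier_def power2_eq_square sum_product pairing_add_right chi_add ac_simps)
  also have "\<dots> = (\<Sum>x\<in>?G. \<Sum>y\<in>?G. f x * f y * (\<Sum>r\<in>?G. chi (pairing S r (x + y))))"
    unfolding sum_distrib_left
    by (rule trans[OF sum.swap], rule sum.cong[OF refl], rule sum.swap)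
  also have "\<dots> = (\<Sum>x\<in>?G. \<Sum>y\<in>?G. if x = y then f x * f y * card ?G else 0)"
    by (intro sum.cong refl)
      (simp add: sum_chi_pairing[OF assms] supported_add bit_fun_add_eq_0_iff)
  also have "\<dots> = card ?G * (\<Sum>x\<in>?G. (f x)\<^sup>2)"
    using finite_supported[OF assms]
    by (simp add: sum_distrib_left power2_eq_square ac_simps)
  finally show ?thesis .
qed

lemma fourier_translate:
  assumes "b \<in> supported S"
  shows "fourier S (\<lambda>x. f (x + b)) r = chi (pairing S r b) * fourier S f r"
proof -
  have "fourier S (\<lambda>x. f (x + b)) r =
      (\<Sum>x\<in>supported S. chi (pairing S r b) * (f (x + b) * chi (pairing S r (x + b))))"
    unfolding fourier_def
    by (intro sum.cong refl) (cases "pairing S r b"; simp add: pairing_add_right chi_add)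
  also have "\<dots> = chi (pairing S r b) * fourier S f r"
    unfolding fourier_def sum_distrib_left
    by (rule sum_supported_translate[OF assms])
  finally show ?thesis .
qed

text \<open>Closure of \<open>C\<close> under \<open>B\<close> says that most of the \<open>L\<^sup>2\<close> mass of the Fourier transform of \<open>C\<close>
  lies on characters that are nearly trivial on \<open>B\<close>. If these vanish on \<open>D\<close>, averaging over
  cosets of \<open>D\<close> preserves that mass.\<close>

lemma dense_coset:
  fixes \<epsilon> \<epsilon>' :: real and S :: "'a set" and B C D :: "('a \<Rightarrow> bit) set"
  assumes S: "finite S" and C: "C \<subseteq> supported S" "C \<noteq> {}" and B: "B \<subseteq> supported S" "B \<noteq> {}"
    and D: "D \<subseteq> supported S" "D \<noteq> {}"
    and closed: "(1 - \<epsilon>) * card C * card B \<le> card {(a, b). a \<in> C \<and> b \<in> B \<and> a + b \<in> C}"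
    and \<epsilon>: "0 < \<epsilon>'" "\<epsilon> \<le> \<epsilon>'"
    and orth: "\<And>r s. r \<in> supported S \<Longrightarrow> card {b \<in> B. pairing S r b = 1} \<le> \<epsilon>' * card B \<Longrightarrow>
      s \<in> D \<Longrightarrow> pairing S r s = 0"
  shows "\<exists>t\<in>supported S. card D / 4 \<le> card (C \<inter> (\<lambda>x. t + x) ` D)"
proof (rule ccontr)
  assume "\<not> ?thesis"
  then have neg: "\<And>t. t \<in> supported S \<Longrightarrow> card (C \<inter> (\<lambda>x. t + x) ` D) \<le> card D / 4"
    by force
  let ?G = "supported S"
  have finG: "finite ?G" by (rule finite_supported[OF S])
  have fin: "finite C" "finite B" "finite D" using C B D finG by (auto intro: finite_subset)
  have pos: "0 < real (card C)" "0 < real (card B)" "0 < real (card D)" "0 < real (card ?G)"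
    using fin finG C B D by (auto simp: card_gt_0_iff)
  define f :: "('a \<Rightarrow> bit) \<Rightarrow> real" where "f x = of_bool (x \<in> C)" for x
  define F where "F = fourier S f"
  have sum_f: "(\<Sum>x\<in>?G. f x) = card C"
    using C(1) finG by (simp add: f_def of_bool_def sum.If_cases Int_absorb1)
  have total: "(\<Sum>r\<in>?G. (F r)\<^sup>2) = card ?G * card C"
  proof -
    have "(\<Sum>x\<in>?G. (f x)\<^sup>2) = (\<Sum>x\<in>?G. f x)" by (intro sum.cong) (auto simp: f_def)
    then show ?thesis using parseval[OF S, of f] sum_f by (simp add: F_def)
  qed
  \<comment> \<open>Parseval for \<open>f x - f (x + b)\<close>: its transform keeps exactly the
    characters nontrivial at \<open>b\<close>, doubled, and its norm counts the points that enter or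
    leave \<open>C\<close> under translation by \<open>b\<close>.\<close>
  have step: "4 * (\<Sum>r\<in>?G. (F r)\<^sup>2 * of_bool (pairing S r b = 1)) =
      real (card ?G) * (2 * real (card C) - 2 * (\<Sum>a\<in>C. of_bool (a + b \<in> C)))" if b: "b \<in> B" for b
  proof -
    have bG: "b \<in> ?G" using b B by auto
    have "fourier S (\<lambda>x. f x - f (x + b)) r = 2 * of_bool (pairing S r b = 1) * F r" for r
    proof -
      have "fourier S (\<lambda>x. f x - f (x + b)) r = F r - fourier S (\<lambda>x. f (x + b)) r"
        by (simp add: fourier_def F_def left_diff_distrib sum_subtractf)
      also have "\<dots> = F r - chi (pairing S r b) * F r"
        using fourier_translate[OF bG, of f r] by (simp add: F_def)
      finally show ?thesis by (simp add: chi_eq algebra_simps)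
    qed
    then have "4 * (\<Sum>r\<in>?G. (F r)\<^sup>2 * of_bool (pairing S r b = 1)) =
        (\<Sum>r\<in>?G. (fourier S (\<lambda>x. f x - f (x + b)) r)\<^sup>2)"
      unfolding sum_distrib_left by (intro sum.cong) (auto simp: power2_eq_square of_bool_def)
    also have "\<dots> = card ?G * (\<Sum>x\<in>?G. (f x - f (x + b))\<^sup>2)" by (rule parseval[OF S])
    also have "(\<Sum>x\<in>?G. (f x - f (x + b))\<^sup>2) = (\<Sum>x\<in>?G. f x + f (x + b) - 2 * (f x * f (x + b)))"
      by (intro sum.cong) (auto simp: f_def of_bool_def)
    also have "\<dots> = 2 * (\<Sum>x\<in>?G. f x) - 2 * (\<Sum>x\<in>?G. f x * f (x + b))"
      using sum_supported_translate[OF bG, of f]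
      by (simp add: sum_subtractf sum.distrib sum_distrib_left)
    also have "(\<Sum>x\<in>?G. f x * f (x + b)) = (\<Sum>a\<in>C. of_bool (a + b \<in> C))"
      using C(1) finG by (intro sum.mono_neutral_cong_right) (auto simp: f_def)
    finally show ?thesis by (simp add: sum_f)
  qed
  define N where "N r = card {b \<in> B. pairing S r b = 1}" for r
  have N_eq: "real (N r) = (\<Sum>b\<in>B. of_bool (pairing S r b = 1))" for r
    using fin by (simp add: N_def of_bool_def sum.If_cases Int_def)
  have pairs: "real (card {(a, b). a \<in> C \<and> b \<in> B \<and> a + b \<in> C}) =
      (\<Sum>b\<in>B. \<Sum>a\<in>C. of_bool (a + b \<in> C))"
  proof -
    have "{(a, b). a \<in> C \<and> b \<in> B \<and> a + b \<in> C} = (SIGMA a:C. {b \<in> B. a + b \<in> C})" by auto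
    then have "real (card {(a, b). a \<in> C \<and> b \<in> B \<and> a + b \<in> C}) =
        (\<Sum>a\<in>C. \<Sum>b\<in>B. of_bool (a + b \<in> C))"
      using fin by (simp add: card_SigmaI of_bool_def sum.If_cases Int_def)
    then show ?thesis by (subst sum.swap)
  qed
  have "4 * (\<Sum>r\<in>?G. (F r)\<^sup>2 * N r) =
      (\<Sum>b\<in>B. 4 * (\<Sum>r\<in>?G. (F r)\<^sup>2 * of_bool (pairing S r b = 1)))"
    unfolding N_eq sum_distrib_left by (rule sum.swap)
  also have "\<dots> = (\<Sum>b\<in>B. real (card ?G) * (2 * real (card C) - 2 * (\<Sum>a\<in>C. of_bool (a + b \<in> C))))"
    by (intro sum.cong refl step)
  also have "\<dots> = real (card ?G) * (2 * real (card C) * card B -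
      2 * real (card {(a, b). a \<in> C \<and> b \<in> B \<and> a + b \<in> C}))"
    unfolding pairs by (simp add: sum_subtractf sum_distrib_left[symmetric] algebra_simps)
  also have "\<dots> \<le> card ?G * (2 * \<epsilon>' * card C * card B)"
  proof (rule mult_left_mono)
    have "\<epsilon> * (card C * card B) \<le> \<epsilon>' * (card C * card B)"
      by (intro mult_right_mono \<epsilon>) simp
    then show "2 * real (card C) * card B - 2 * real (card {(a, b). a \<in> C \<and> b \<in> B \<and> a + b \<in> C}) \<le>
      2 * \<epsilon>' * card C * card B"
      using closed by (simp add: algebra_simps)
  qed simp
  finally have upper: "2 * (\<Sum>r\<in>?G. (F r)\<^sup>2 * N r) \<le> \<epsilon>' * card B * (real (card ?G) * card C)"
    by (simp add: ac_simps)
  \<comment> \<open>The characters nontrivial on more than the proportion \<open>\<epsilon>'\<close>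
    of \<open>B\<close>. By Markov's inequality they carry at most half of the L2 mass.\<close>
  define R where "R = {r \<in> ?G. \<epsilon>' * card B < N r}"
  have "(\<epsilon>' * card B) * (2 * (\<Sum>r\<in>R. (F r)\<^sup>2)) \<le> 2 * (\<Sum>r\<in>R. (F r)\<^sup>2 * N r)"
    unfolding sum_distrib_left
  proof (rule sum_mono)
    fix r assume "r \<in> R"
    then have "\<epsilon>' * card B \<le> N r" by (simp add: R_def)
    from mult_right_mono[OF this, of "2 * (F r)\<^sup>2"]
    show "\<epsilon>' * card B * (2 * (F r)\<^sup>2) \<le> 2 * ((F r)\<^sup>2 * N r)" by (simp add: ac_simps)
  qed
  also have "\<dots> \<le> 2 * (\<Sum>r\<in>?G. (F r)\<^sup>2 * N r)"
    using finG by (intro mult_left_mono sum_mono2) (auto simp: R_def)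
  also note upper
  finally have "2 * (\<Sum>r\<in>R. (F r)\<^sup>2) \<le> card ?G * card C"
    using pos \<epsilon> by simp
  moreover have "(\<Sum>r\<in>?G. (F r)\<^sup>2) = (\<Sum>r\<in>?G - R. (F r)\<^sup>2) + (\<Sum>r\<in>R. (F r)\<^sup>2)"
    using finG by (intro sum.subset_diff) (auto simp: R_def)
  ultimately have half: "real (card ?G) * card C \<le> 2 * (\<Sum>r\<in>?G - R. (F r)\<^sup>2)"
    using total unfolding of_nat_mult by linarith
  \<comment> \<open>\<open>h x\<close> counts the points of \<open>C\<close> in the translate of
    \<open>D\<close> by \<open>x\<close>. Off \<open>R\<close> its transform is
    \<open>card D\<close> times that of \<open>C\<close>, so its L2 norm is large, whereas
    \<open>neg\<close> bounds it by \<open>card D / 4\<close> everywhere.\<close>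
  define h where "h x = (\<Sum>s\<in>D. f (x + s))" for x
  have h_eq: "h x = card (C \<inter> (\<lambda>s. x + s) ` D)" for x
  proof -
    have "h x = card {s \<in> D. x + s \<in> C}"
      using fin by (simp add: h_def f_def of_bool_def sum.If_cases Int_def)
    also have "card {s \<in> D. x + s \<in> C} = card ((\<lambda>s. x + s) ` {s \<in> D. x + s \<in> C})"
      by (rule card_image[symmetric]) (simp add: inj_on_def)
    also have "(\<lambda>s. x + s) ` {s \<in> D. x + s \<in> C} = C \<inter> (\<lambda>s. x + s) ` D" by auto
    finally show ?thesis .
  qed
  have fourier_h: "fourier S h r = card D * F r" if "r \<in> ?G - R" for r
  proof -
    have "fourier S h r = (\<Sum>s\<in>D. fourier S (\<lambda>x. f (x + s)) r)"
      unfolding fourier_def h_def sum_distrib_right by (rule sum.swap)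
    also have "\<dots> = (\<Sum>s\<in>D. F r)"
    proof (rule sum.cong[OF refl])
      fix s assume s: "s \<in> D"
      have "pairing S r s = 0" using that s by (intro orth) (auto simp: R_def N_def)
      then show "fourier S (\<lambda>x. f (x + s)) r = F r"
        using fourier_translate[of s S f r] s D by (auto simp: F_def)
    qed
    finally show ?thesis by simp
  qed
  have "(real (card D))\<^sup>2 * (real (card ?G) * card C) \<le> (real (card D))\<^sup>2 * (2 * (\<Sum>r\<in>?G - R. (F r)\<^sup>2))"
    by (intro mult_left_mono half) simp
  also have "\<dots> = 2 * (\<Sum>r\<in>?G - R. (fourier S h r)\<^sup>2)"
    by (simp add: fourier_h power_mult_distrib sum_distrib_left ac_simps)
  also have "\<dots> \<le> 2 * (\<Sum>r\<in>?G. (fourier S h r)\<^sup>2)"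
    using finG by (intro mult_left_mono sum_mono2) auto
  also have "\<dots> = card ?G * (2 * (\<Sum>x\<in>?G. (h x)\<^sup>2))"
    unfolding parseval[OF S] by simp
  also have "\<dots> \<le> card ?G * (2 * (\<Sum>x\<in>?G. card D / 4 * h x))"
  proof (intro mult_left_mono sum_mono)
    fix x assume "x \<in> ?G"
    then have "h x * h x \<le> card D / 4 * h x"
      unfolding h_eq by (intro mult_right_mono neg) simp_all
    then show "(h x)\<^sup>2 \<le> card D / 4 * h x" by (simp only: power2_eq_square)
  qed simp_all
  also have "(\<Sum>x\<in>?G. card D / 4 * h x) = card D / 4 * (card D * card C)"
  proof -
    have "(\<Sum>x\<in>?G. h x) = (\<Sum>s\<in>D. \<Sum>x\<in>?G. f (x + s))" unfolding h_def by (rule sum.swap)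
    also have "\<dots> = (\<Sum>s\<in>D. real (card C))"
      using D by (intro sum.cong) (auto simp: sum_supported_translate sum_f)
    finally have "(\<Sum>x\<in>?G. h x) = card D * card C" by simp
    then show ?thesis by (simp only: sum_distrib_left[symmetric])
  qed
  finally have "(real (card D))\<^sup>2 * (real (card ?G) * card C) \<le> 1 / 2 * ((real (card D))\<^sup>2 * (real (card ?G) * card C))"
    by (simp add: power2_eq_square)
  moreover have "0 < (real (card D))\<^sup>2 * (real (card ?G) * card C)" using pos by simp
  ultimately show False by linarith
qed

section \<open>Tensors as forms\<close>

lemma tensor_space_eq_supported: "tensor_space n I = supported (\<Pi>\<^sub>E i\<in>I. {..<n i})"
  by (simp add: tensor_space_def supported_def)

definition basis_arg :: "(nat \<Rightarrow> nat) \<Rightarrow> nat \<Rightarrow> nat \<Rightarrow> bit" where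
  "basis_arg x = (\<lambda>i. unit_vec (x i))"

text \<open>The functional given by \<open>r\<close>, restricted to rank-1 tensors, is a multilinear
  form in their factors, with the entries of \<open>r\<close> as coefficients.\<close>

definition form_of :: "(nat \<Rightarrow> nat) \<Rightarrow> nat set \<Rightarrow> tensor \<Rightarrow> form" where
  "form_of n I r u = pairing (\<Pi>\<^sub>E i\<in>I. {..<n i}) r (pure_tensor I u)"

lemma multilinear_pure_tensor:
  assumes "finite I"
  shows "multilinear I (\<lambda>u. pure_tensor I u x)"
  unfolding multilinear_def
proof (intro conjI allI ballI impI)
  fix u v :: "nat \<Rightarrow> nat \<Rightarrow> bit" assume "\<forall>i\<in>I. u i = v i"
  then show "pure_tensor I u x = pure_tensor I v x"
    by (auto simp: pure_tensor_def intro!: prod.cong)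
next
  fix i and u :: "nat \<Rightarrow> nat \<Rightarrow> bit" and a b :: "nat \<Rightarrow> bit" assume i: "i \<in> I"
  have "(\<Prod>j\<in>I. (u(i := c)) j (x j)) = c (x i) * (\<Prod>j\<in>I - {i}. u j (x j))" for c
    using assms i by (subst prod.remove[of I i]) (auto intro!: prod.cong)
  then show "pure_tensor I (u(i := a + b)) x =
      pure_tensor I (u(i := a)) x + pure_tensor I (u(i := b)) x"
    by (simp only: pure_tensor_def distrib_right plus_fun_apply split: if_split) simp
qed

lemma multilinear_form_of: "finite I \<Longrightarrow> multilinear I (form_of n I r)"
  unfolding form_of_def pairing_def
  by (intro multilinear_sum multilinear_scale multilinear_pure_tensor)

lemma form_of_basis_arg:
  assumes "finite I" "x \<in> (\<Pi>\<^sub>E i\<in>I. {..<n i})"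
  shows "form_of n I r (basis_arg x) = r x"
proof -
  let ?E = "\<Pi>\<^sub>E i\<in>I. {..<n i}"
  have "pure_tensor I (basis_arg x) y = of_bool (y = x)" if y: "y \<in> ?E" for y
  proof (cases "y = x")
    case True
    then show ?thesis using y by (auto simp: pure_tensor_def basis_arg_def unit_vec_def PiE_def)
  next
    case False
    then obtain i where "i \<in> I" "y i \<noteq> x i" using PiE_ext[OF y assms(2)] by blast
    then have "(\<Prod>i\<in>I. basis_arg x i (y i)) = 0"
      using assms(1) by (intro prod_zero) (auto simp: basis_arg_def unit_vec_def)
    then show ?thesis using False by (simp add: pure_tensor_def)
  qed
  then have "form_of n I r (basis_arg x) = (\<Sum>y\<in>?E. if y = x then r y else 0)"
    unfolding form_of_def pairing_def by (intro sum.cong) auto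
  also have "\<dots> = r x" using assms by (simp add: finite_PiE)
  finally show ?thesis .
qed

section \<open>Subspaces of bounded codimension and orthogonality\<close>

lemma F2_subspaceI:
  assumes "0 \<in> H" "\<And>x y. x \<in> H \<Longrightarrow> y \<in> H \<Longrightarrow> x + y \<in> H"
  shows "F2.subspace H"
  unfolding F2.subspace_def
proof (intro conjI allI ballI)
  fix c :: bit and x assume "x \<in> H"
  then show "scale_fun c x \<in> H"
    by (cases c) (simp_all only: scale_fun_0 scale_fun_1 assms(1))
qed (use assms in auto)

text \<open>If \<open>\<phi>\<close> is 1 at \<open>a\<close>, adding \<open>a\<close> moves every
  point of value 1 into the kernel, so \<open>a\<close> and a basis of the kernel span
  \<open>H\<close>.\<close>

lemma dim_kernel:
  fixes \<phi> :: "('a \<Rightarrow> bit) \<Rightarrow> bit"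
  assumes H: "F2.subspace H" "finite H" and \<phi>: "\<And>x y. \<phi> (x + y) = \<phi> x + \<phi> y"
  shows "F2.dim H \<le> F2.dim {h \<in> H. \<phi> h = 0} + 1"
proof (cases "\<exists>a\<in>H. \<phi> a = 1")
  case True
  then obtain a where a: "a \<in> H" "\<phi> a = 1" by blast
  obtain B where B: "B \<subseteq> {h \<in> H. \<phi> h = 0}" "F2.independent B"
    "{h \<in> H. \<phi> h = 0} \<subseteq> F2.span B" "card B = F2.dim {h \<in> H. \<phi> h = 0}"
    by (rule F2.basis_exists)
  have finB: "finite B" using B(1) H(2) by (auto intro: finite_subset)
  have span: "F2.span B \<subseteq> F2.span (insert a B)" by (rule F2.span_mono) auto
  have "H \<subseteq> F2.span (insert a B)"
  proof
    fix h assume h: "h \<in> H"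
    show "h \<in> F2.span (insert a B)"
    proof (cases "\<phi> h = 0")
      case False
      then have "h + a \<in> {h \<in> H. \<phi> h = 0}"
        using h a H(1) \<phi> by (auto intro: F2.subspace_add simp del: plus_fun_apply)
      then have "h + a \<in> F2.span (insert a B)" using B(3) span by blast
      then have "h + a + a \<in> F2.span (insert a B)"
        by (rule F2.span_add) (auto intro: F2.span_base)
      then show ?thesis by (simp only: bit_fun_add_cancel)
    qed (use h B(3) span in blast)
  qed
  then have "F2.dim H \<le> card (insert a B)" by (rule F2.dim_le_card) (simp add: finB)
  then show ?thesis using B(4) finB by (simp add: card_insert_if split: if_splits)
next
  case False
  then have "{h \<in> H. \<phi> h = 0} = H" by force
  then show ?thesis by simp
qed

lemma dim_common_kernel:
  fixes \<phi> :: "'b \<Rightarrow> ('a \<Rightarrow> bit) \<Rightarrow> bit"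
  assumes "finite T" "F2.subspace V" "finite V" "\<And>p x y. \<phi> p (x + y) = \<phi> p x + \<phi> p y"
  shows "F2.dim V \<le> F2.dim {h \<in> V. \<forall>p\<in>T. \<phi> p h = 0} + card T \<and>
    F2.subspace {h \<in> V. \<forall>p\<in>T. \<phi> p h = 0}"
  using assms(1)
proof (induction T rule: finite_induct)
  case empty
  then show ?case using assms(2) by simp
next
  case (insert p T)
  let ?H = "{h \<in> V. \<forall>p\<in>T. \<phi> p h = 0}"
  have eq: "{h \<in> V. \<forall>p\<in>insert p T. \<phi> p h = 0} = {h \<in> ?H. \<phi> p h = 0}" by auto
  have "F2.dim ?H \<le> F2.dim {h \<in> ?H. \<phi> p h = 0} + 1"
    using insert.IH assms(3,4) by (intro dim_kernel) auto
  moreover have "\<phi> p 0 = 0" for p using assms(4)[of p 0 0] by (simp add: bit_add_eq_1_iff)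
  then have "F2.subspace {h \<in> ?H. \<phi> p h = 0}"
    using insert.IH assms(4)
    by (intro F2_subspaceI) (auto intro: F2.subspace_0 F2.subspace_add simp del: plus_fun_apply
        simp: F2.subspace_0[OF assms(2)] F2.subspace_add[OF assms(2)])
  ultimately show ?case using insert.IH insert.hyps unfolding eq by simp
qed

text \<open>The orthogonal complement of V_J for the standard pairing, a form becoming a tensor by
  evaluation at basis vectors. Each pair of the family costs at most one dimension.\<close>

definition annihilator :: "(nat \<Rightarrow> nat) \<Rightarrow> (nat set \<times> form) set \<Rightarrow> nat set \<Rightarrow> tensor set" where
  "annihilator n \<V> J = {h \<in> tensor_space n J. \<forall>p\<in>{p \<in> \<V>. fst p = J}.
     pairing (\<Pi>\<^sub>E i\<in>J. {..<n i}) (\<lambda>x. snd p (basis_arg x)) h = 0}"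

lemma finite_tensor_space: "finite I \<Longrightarrow> finite (tensor_space n I)"
  unfolding tensor_space_eq_supported by (intro finite_supported finite_PiE) auto

lemma subspace_tensor_space: "F2.subspace (tensor_space n I)"
  unfolding tensor_space_eq_supported by (intro F2_subspaceI zero_in_supported supported_add)

lemma annihilator_codim:
  assumes "finite J" "finite \<V>" "card \<V> \<le> k"
  shows "subspace_of_codim_le (annihilator n \<V> J) (tensor_space n J) k"
proof -
  have "card {p \<in> \<V>. fst p = J} \<le> k"
    using card_mono[OF assms(2), of "{p \<in> \<V>. fst p = J}"] assms(3) by auto
  with dim_common_kernel[of "{p \<in> \<V>. fst p = J}" "tensor_space n J"
      "\<lambda>p h. pairing (\<Pi>\<^sub>E i\<in>J. {..<n i}) (\<lambda>x. snd p (basis_arg x)) h",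
      OF _ subspace_tensor_space finite_tensor_space[OF assms(1)] pairing_add_right] assms(2)
  show ?thesis unfolding subspace_of_codim_le_def annihilator_def by auto
qed

definition simple_subspace ::
  "(nat \<Rightarrow> nat) \<Rightarrow> nat \<Rightarrow> (nat set \<Rightarrow> tensor set) \<Rightarrow> tensor set" where
  "simple_subspace n d H = (\<Inter>I \<in> {I. I \<subseteq> {1..d} \<and> I \<noteq> {}}.
     if I = {1..d} then H I else subspace_prod I ({1..d} - I) (H I) (tensor_space n ({1..d} - I)))"

lemma subspace_simple_subspace:
  "F2.subspace (H {1..d}) \<Longrightarrow> F2.subspace (simple_subspace n d H)"
  unfolding simple_subspace_def
  by (rule F2.subspace_Int) (auto simp: subspace_prod_def F2.subspace_span)

text \<open>On a product tensor the pairing factors, and its factor over \<open>J\<close> pairs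
  \<open>v\<close> with an element of \<open>H\<close>, giving 0. Linearity extends this to the
  span.\<close>

lemma pairing_subspace_prod:
  assumes I: "finite I" "J \<subseteq> I" and v: "multilinear J v" and c: "multilinear (I - J) c"
    and H: "\<And>h. h \<in> H \<Longrightarrow> pairing (\<Pi>\<^sub>E i\<in>J. {..<n i}) (\<lambda>x. v (basis_arg x)) h = 0"
    and s: "s \<in> subspace_prod J (I - J) H W"
  shows "pairing (\<Pi>\<^sub>E i\<in>I. {..<n i}) (\<lambda>x. v (basis_arg x) * c (basis_arg x)) s = 0"
proof -
  let ?E = "\<lambda>I. \<Pi>\<^sub>E i\<in>I. {..<n i}"
  let ?L = "pairing (?E I) (\<lambda>x. v (basis_arg x) * c (basis_arg x))"
  have "F2.subspace {s. ?L s = 0}"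
    by (intro F2_subspaceI) (simp_all only: mem_Collect_eq pairing_add_right,
        simp_all add: pairing_def)
  moreover have "{tensor_prod J (I - J) h w | h w. h \<in> H \<and> w \<in> W} \<subseteq> {s. ?L s = 0}"
  proof clarify
    fix h w assume h: "h \<in> H"
    have *: "v (basis_arg (override_on y z J)) = v (basis_arg z)"
      "c (basis_arg (override_on y z J)) = c (basis_arg y)"
      "tensor_prod J (I - J) h w (override_on y z J) = h z * w y"
      if "y \<in> ?E (I - J)" "z \<in> ?E J" for y z
    proof -
      show "v (basis_arg (override_on y z J)) = v (basis_arg z)"
        by (rule multilinear_cong[OF v]) (auto simp: basis_arg_def)
      show "c (basis_arg (override_on y z J)) = c (basis_arg y)"
        by (rule multilinear_cong[OF c]) (auto simp: basis_arg_def)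
      have "restrict (override_on y z J) J = z" "restrict (override_on y z J) (I - J) = y"
        "override_on y z J \<in> extensional (J \<union> (I - J))"
        using that I by (auto simp: PiE_iff extensional_def override_on_def restrict_def fun_eq_iff)
      then show "tensor_prod J (I - J) h w (override_on y z J) = h z * w y"
        by (simp add: tensor_prod_def)
    qed
    have "?L (tensor_prod J (I - J) h w) =
        (\<Sum>y\<in>?E (I - J). \<Sum>z\<in>?E J. c (basis_arg y) * w y * (v (basis_arg z) * h z))"
      unfolding pairing_def sum_PiE_split[OF I(2)]
      by (intro sum.cong refl) (simp add: * ac_simps)
    also have "\<dots> = (\<Sum>y\<in>?E (I - J). c (basis_arg y) * w y *
        pairing (?E J) (\<lambda>x. v (basis_arg x)) h)"
      by (simp only: pairing_def sum_distrib_left)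
    also have "\<dots> = 0" using H[OF h] by simp
    finally show "?L (tensor_prod J (I - J) h w) = 0" .
  qed
  ultimately show ?thesis
    using s F2.span_minimal unfolding subspace_prod_def by blast
qed

lemma structured_orthogonal:
  assumes \<V>: "family {1..d} k \<V>" and r: "in_span n {1..d} \<V> (form_of n {1..d} r)"
    and s: "s \<in> simple_subspace n d (annihilator n \<V>)"
  shows "pairing (\<Pi>\<^sub>E i\<in>{1..d}. {..<n i}) r s = 0"
proof -
  let ?E = "\<lambda>I. \<Pi>\<^sub>E i\<in>I. {..<n i}" and ?I = "{1..d}"
  from r obtain c where c: "\<And>p. p \<in> \<V> \<Longrightarrow> multilinear (?I - fst p) (c p)"
    "\<And>x. x \<in> Pi ?I (\<lambda>i. vec_space (n i)) \<Longrightarrow> form_of n ?I r x = (\<Sum>p\<in>\<V>. snd p x * c p x)"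
    unfolding in_span_def by blast
  have "r x = (\<Sum>p\<in>\<V>. snd p (basis_arg x) * c p (basis_arg x))" if "x \<in> ?E ?I" for x
  proof -
    have "basis_arg x \<in> Pi ?I (\<lambda>i. vec_space (n i))"
      using that by (auto simp: basis_arg_def PiE_iff intro!: unit_vec_in_vec_space)
    from c(2)[OF this] show ?thesis using form_of_basis_arg[OF _ that] by simp
  qed
  then have "pairing (?E ?I) r s =
      (\<Sum>x\<in>?E ?I. \<Sum>p\<in>\<V>. snd p (basis_arg x) * c p (basis_arg x) * s x)"
    by (simp add: pairing_def sum_distrib_right)
  also have "\<dots> = (\<Sum>p\<in>\<V>. pairing (?E ?I) (\<lambda>x. snd p (basis_arg x) * c p (basis_arg x)) s)"
    unfolding pairing_def by (rule sum.swap)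
  also have "\<dots> = 0"
  proof (rule sum.neutral, rule ballI)
    fix p assume p: "p \<in> \<V>"
    then have fp: "fst p \<subseteq> ?I" "fst p \<noteq> {}" "multilinear (fst p) (snd p)"
      using \<V> by (auto simp: family_def)
    have H: "pairing (?E (fst p)) (\<lambda>x. snd p (basis_arg x)) h = 0"
      if "h \<in> annihilator n \<V> (fst p)" for h
      using that p by (auto simp: annihilator_def)
    have s_in: "s \<in> (if fst p = ?I then annihilator n \<V> (fst p) else
        subspace_prod (fst p) (?I - fst p) (annihilator n \<V> (fst p)) (tensor_space n (?I - fst p)))"
      using s fp unfolding simple_subspace_def by blast
    show "pairing (?E ?I) (\<lambda>x. snd p (basis_arg x) * c p (basis_arg x)) s = 0"
    proof (cases "fst p = ?I")
      case True
      \<comment> \<open>Over the full index set the cofactor is a constant, which matches the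
        separate case \<open>I = {1..d}\<close> of \<open>k_simple\<close>.\<close>
      have "c p (basis_arg x) = c p (\<lambda>_. 0)" for x
        using c(1)[OF p] True by (intro multilinear_cong[of "{}"]) auto
      then have "pairing (?E ?I) (\<lambda>x. snd p (basis_arg x) * c p (basis_arg x)) s =
          c p (\<lambda>_. 0) * pairing (?E ?I) (\<lambda>x. snd p (basis_arg x)) s"
        by (simp add: pairing_def sum_distrib_left ac_simps)
      then show ?thesis using H[of s] s_in True by simp
    next
      case False
      then show ?thesis using s_in
        by (intro pairing_subspace_prod[OF _ fp(1,3) c(1)[OF p] H]) auto
    qed
  qed
  finally show ?thesis .
qed

section \<open>Rank-1 tensors and their factors\<close>

lemma pure_tensor_cong: "(\<And>i. i \<in> I \<Longrightarrow> u i = v i) \<Longrightarrow> pure_tensor I u = pure_tensor I v"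
  by (auto simp: pure_tensor_def fun_eq_iff intro!: prod.cong)

lemma rank1_tensors_eq:
  "rank1_tensors d n = pure_tensor {1..d} ` (\<Pi>\<^sub>E i\<in>{1..d}. vec_space (n i) - {0})"
proof
  show "rank1_tensors d n \<subseteq> pure_tensor {1..d} ` (\<Pi>\<^sub>E i\<in>{1..d}. vec_space (n i) - {0})"
  proof
    fix b assume "b \<in> rank1_tensors d n"
    then obtain u where u: "b = pure_tensor {1..d} u" "\<forall>i\<in>{1..d}. u i \<in> vec_space (n i) - {0}"
      unfolding rank1_tensors_def by blast
    have "b = pure_tensor {1..d} (restrict u {1..d})"
      unfolding u(1) by (rule pure_tensor_cong) simp
    moreover have "restrict u {1..d} \<in> (\<Pi>\<^sub>E i\<in>{1..d}. vec_space (n i) - {0})"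
      using u(2) by (auto simp: PiE_iff)
    ultimately show "b \<in> pure_tensor {1..d} ` (\<Pi>\<^sub>E i\<in>{1..d}. vec_space (n i) - {0})"
      by blast
  qed
qed (auto simp: rank1_tensors_def PiE_iff)

lemma prod_bit_eq_1_iff: "finite I \<Longrightarrow> (\<Prod>i\<in>I. f i) = (1::bit) \<longleftrightarrow> (\<forall>i\<in>I. f i = 1)"
proof (induction I rule: finite_induct)
  case (insert i I)
  then show ?case by (cases "f i") auto
qed simp

text \<open>Over F2 the only nonzero scalar is 1, so factors cannot be rescaled. With an index
  chosen for each factor at which it is 1, varying one of these indices reads off that
  factor.\<close>

lemma inj_on_pure_tensor:
  assumes "finite I"
  shows "inj_on (pure_tensor I) (\<Pi>\<^sub>E i\<in>I. vec_space (n i) - {0})"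
proof (rule inj_onI)
  fix u v assume u: "u \<in> (\<Pi>\<^sub>E i\<in>I. vec_space (n i) - {0})"
    and v: "v \<in> (\<Pi>\<^sub>E i\<in>I. vec_space (n i) - {0})" and eq: "pure_tensor I u = pure_tensor I v"
  have "\<forall>i. \<exists>j. i \<in> I \<longrightarrow> u i j = 1"
  proof
    fix i
    show "\<exists>j. i \<in> I \<longrightarrow> u i j = 1"
    proof (cases "i \<in> I")
      case True
      then have "u i \<noteq> 0" using u by auto
      then show ?thesis by (auto simp: fun_eq_iff)
    qed simp
  qed
  from choice[OF this] obtain x0 where x0: "\<And>i. i \<in> I \<Longrightarrow> u i (x0 i) = 1" by blast
  define x where "x = restrict x0 I"
  have pt: "pure_tensor I w y = 1 \<longleftrightarrow> (\<forall>i\<in>I. w i (y i) = 1)" if "y \<in> extensional I" for w y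
    using that prod_bit_eq_1_iff[OF assms] by (simp add: pure_tensor_def)
  have ext: "x \<in> extensional I" by (simp add: x_def)
  have ux: "\<And>i. i \<in> I \<Longrightarrow> u i (x i) = 1" using x0 by (simp add: x_def)
  then have vx: "\<And>i. i \<in> I \<Longrightarrow> v i (x i) = 1" using pt[OF ext, of u] pt[OF ext, of v] eq by simp
  show "u = v"
  proof (rule PiE_ext[OF u v])
    fix i assume i: "i \<in> I"
    show "u i = v i"
    proof
      fix j
      have e: "x(i := j) \<in> extensional I" using ext i by (auto simp: extensional_def)
      have "w i j = 1 \<longleftrightarrow> pure_tensor I w (x(i := j)) = 1"
        if "\<And>l. l \<in> I \<Longrightarrow> w l (x l) = 1" for w
        unfolding pt[OF e] using that i by auto
      from this[of u] this[of v] have "u i j = 1 \<longleftrightarrow> v i j = 1" using ux vx eq by simp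
      then show "u i j = v i j" by (cases "u i j"; cases "v i j") auto
    qed
  qed
qed

text \<open>As \<open>n i \<ge> 1\<close>, the nonzero vectors make up at least half of each factor
  space.\<close>

lemma card_vecs_le_rank1:
  assumes "\<forall>i\<in>{1..d}. n i \<ge> 1"
  shows "card (vecs n {1..d}) \<le> 2 ^ d * card (rank1_tensors d n)"
proof -
  have "card (rank1_tensors d n) = (\<Prod>i\<in>{1..d}. 2 ^ n i - 1)"
    unfolding rank1_tensors_eq
    by (subst card_image[OF inj_on_pure_tensor]) (simp_all add: card_PiE card_vec_space)
  moreover have "(\<Prod>i\<in>{1..d}. (2::nat) ^ n i) \<le> (\<Prod>i\<in>{1..d}. 2 * (2 ^ n i - 1))"
  proof (rule prod_mono, intro conjI)
    fix i assume "i \<in> {1..d}"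
    then obtain m where "n i = Suc m" using assms by (cases "n i") force+
    moreover have "(1::nat) \<le> 2 ^ m" by simp
    ultimately show "(2::nat) ^ n i \<le> 2 * (2 ^ n i - 1)" by simp
  qed simp
  ultimately show ?thesis by (simp add: vecs_def card_PiE card_vec_space prod.distrib)
qed

lemma rank1_subset_tensor_space: "rank1_tensors d n \<subseteq> tensor_space n {1..d}"
proof
  fix b assume "b \<in> rank1_tensors d n"
  then obtain u where u: "b = pure_tensor {1..d} u" "\<forall>i\<in>{1..d}. u i \<in> vec_space (n i) - {0}"
    unfolding rank1_tensors_def by blast
  have "b x = 0" if x: "x \<notin> (\<Pi>\<^sub>E i\<in>{1..d}. {..<n i})" for x
  proof (cases "x \<in> extensional {1..d}")
    case True
    with x obtain i where "i \<in> {1..d}" "x i \<notin> {..<n i}" by (auto simp: PiE_def Pi_def)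
    then have "u i (x i) = 0" using u(2) by (auto simp: vec_space_def)
    then have "(\<Prod>i\<in>{1..d}. u i (x i)) = 0" using \<open>i \<in> {1..d}\<close> by (intro prod_zero) auto
    then show ?thesis using u(1) by (simp add: pure_tensor_def)
  qed (simp add: u(1) pure_tensor_def)
  then show "b \<in> tensor_space n {1..d}" by (simp add: tensor_space_def)
qed

lemma finite_rank1: "finite (rank1_tensors d n)"
  using rank1_subset_tensor_space finite_tensor_space by (metis finite_atLeastAtMost finite_subset)

text \<open>The uniform distribution on \<open>B\<close> is transported to tuples of vectors along
  the injective map to pure tensors. The mass of a form is then the proportion of \<open>B\<close>
  on which the character is nontrivial; the factor \<open>2 ^ d\<close> pays for tuples with a zero
  entry.\<close>

lemma rank1_density:
  fixes \<delta> :: real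
  assumes n: "\<forall>i\<in>{1..d}. n i \<ge> 1" and B: "B \<subseteq> rank1_tensors d n" "B \<noteq> {}"
    and \<delta>: "0 < \<delta>" "\<delta> * card (rank1_tensors d n) \<le> card B"
  shows "\<exists>\<mu>. bounded_density n {1..d} (2 ^ d / \<delta>) \<mu> \<and>
    (\<forall>r. mass n {1..d} \<mu> (form_of n {1..d} r) =
      card {b \<in> B. pairing (\<Pi>\<^sub>E i\<in>{1..d}. {..<n i}) r b = 1} / card B)"
proof -
  let ?I = "{1..d}" and ?U = "\<Pi>\<^sub>E i\<in>{1..d}. vec_space (n i) - {0}"
  define U where "U = {u \<in> ?U. pure_tensor ?I u \<in> B}"
  have UV: "U \<subseteq> vecs n ?I" by (auto simp: U_def vecs_def PiE_def)
  have inj: "inj_on (pure_tensor ?I) U"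
    by (rule inj_on_subset[OF inj_on_pure_tensor[of ?I n]]) (auto simp: U_def)
  have img: "pure_tensor ?I ` U = B" using B(1) unfolding rank1_tensors_eq U_def by auto
  have finB: "finite B" using B(1) finite_rank1 by (rule finite_subset)
  have posB: "0 < real (card B)" using finB B by (simp add: card_gt_0_iff)
  have finV: "finite (vecs n ?I)" by (rule finite_vecs) simp
  define \<mu> where "\<mu> u = of_bool (u \<in> U) / real (card B)" for u
  have sum_\<mu>: "(\<Sum>u\<in>vecs n ?I. \<mu> u * of_bool (P (pure_tensor ?I u))) =
      card {b \<in> B. P b} / card B" for P
  proof -
    have "(\<Sum>u\<in>vecs n ?I. \<mu> u * of_bool (P (pure_tensor ?I u))) =
        (\<Sum>u\<in>U. of_bool (P (pure_tensor ?I u)) / card B)"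
      using UV finV by (intro sum.mono_neutral_cong_right) (auto simp: \<mu>_def)
    also have "\<dots> = (\<Sum>b\<in>B. of_bool (P b) / card B)"
      using sum.reindex[OF inj, of "\<lambda>b. of_bool (P b) / card B"] unfolding img
      by (simp add: comp_def)
    also have "\<dots> = card {b \<in> B. P b} / card B"
      using finB by (simp add: sum_divide_distrib[symmetric] of_bool_def sum.If_cases Int_def)
    finally show ?thesis .
  qed
  have "bounded_density n ?I (2 ^ d / \<delta>) \<mu>"
    unfolding bounded_density_def
  proof (intro conjI ballI)
    fix u
    show "0 \<le> \<mu> u" by (simp add: \<mu>_def)
    have "\<delta> * card (vecs n ?I) \<le> \<delta> * (2 ^ d * card (rank1_tensors d n))"
      using card_vecs_le_rank1[OF n] \<delta>(1)
      by (intro mult_left_mono) (metis of_nat_le_iff of_nat_mult of_nat_numeral of_nat_power, simp)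
    also have "\<dots> \<le> 2 ^ d * card B" using mult_left_mono[OF \<delta>(2), of "2 ^ d"] by (simp add: ac_simps)
    finally have "card (vecs n ?I) / card B \<le> 2 ^ d / \<delta>"
      using posB \<delta>(1) by (simp add: field_simps)
    moreover have "\<mu> u * card (vecs n ?I) \<le> card (vecs n ?I) / card B" by (simp add: \<mu>_def)
    ultimately show "\<mu> u * card (vecs n ?I) \<le> 2 ^ d / \<delta>" by linarith
  next
    show "(\<Sum>u\<in>vecs n ?I. \<mu> u) = 1" using sum_\<mu>[of "\<lambda>_. True"] posB by simp
  qed
  moreover have "mass n ?I \<mu> (form_of n ?I r) =
      card {b \<in> B. pairing (\<Pi>\<^sub>E i\<in>?I. {..<n i}) r b = 1} / card B" for r
    unfolding mass_def form_of_def by (rule sum_\<mu>)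
  ultimately show ?thesis by blast
qed

text \<open>The expected number of good \<open>x\<close> in \<open>C\<close> is at least
  \<open>c * card C\<close>, so some outcome attains it. Staying in the support makes its entries
  rank-1 tensors in the application.\<close>

lemma pmf_exists_ge_average:
  fixes c :: real
  assumes fin: "finite C" "finite (set_pmf p)"
    and prob: "\<And>x. x \<in> C \<Longrightarrow> c \<le> measure_pmf.prob p {b. P x b}"
  shows "\<exists>b\<in>set_pmf p. c * card C \<le> card {x \<in> C. P x b}"
proof (rule ccontr)
  assume neg: "\<not> ?thesis"
  have "c * card C = (\<Sum>x\<in>C. c)" by simp
  also have "\<dots> \<le> (\<Sum>x\<in>C. \<Sum>b\<in>set_pmf p. pmf p b * of_bool (P x b))"
  proof (rule sum_mono)
    fix x assume "x \<in> C"
    then have "c \<le> measure_pmf.prob p ({b. P x b} \<inter> set_pmf p)"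
      using prob by (simp add: measure_Int_set_pmf)
    also have "\<dots> = (\<Sum>b\<in>set_pmf p. pmf p b * of_bool (P x b))"
      using fin(2) by (subst measure_measure_pmf_finite) (auto intro!: sum.mono_neutral_cong_left)
    finally show "c \<le> (\<Sum>b\<in>set_pmf p. pmf p b * of_bool (P x b))" .
  qed
  also have "\<dots> = (\<Sum>b\<in>set_pmf p. \<Sum>x\<in>C. pmf p b * of_bool (P x b))" by (rule sum.swap)
  also have "\<dots> = (\<Sum>b\<in>set_pmf p. pmf p b * card {x \<in> C. P x b})"
    using fin(1) by (simp add: sum_distrib_left[symmetric] of_bool_def sum.If_cases Int_def)
  also have "\<dots> < (\<Sum>b\<in>set_pmf p. pmf p b * (c * card C))"
    using neg fin(2) set_pmf_not_empty[of p]
    by (intro sum_strict_mono mult_strict_left_mono) (auto simp: not_le pmf_positive)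
  also have "\<dots> = c * card C"
    using sum_pmf_eq_1[OF fin(2) subset_refl] by (simp add: sum_distrib_right[symmetric])
  finally show False by simp
qed

theorem mainTheorem5:
  fixes d :: nat
  assumes "d \<ge> 1"
    and "\<forall>\<eta>>0. \<forall>\<epsilon>>0. \<exists>(c::real)>0. \<exists>(\<delta>::real)>0. \<exists>(l::nat)>0.
      \<forall>n :: nat \<Rightarrow> nat. (\<forall>i\<in>{1..d}. n i \<ge> 1) \<longrightarrow>
        (\<forall>A \<subseteq> tensor_space n {1..d}. closed_wrt (rank1_tensors d n) \<eta> A \<longrightarrow>
          (\<exists>B' \<subseteq> rank1_tensors d n. \<exists>C \<subseteq> tensor_space n {1..d}.
             C \<noteq> {} \<and>
             real (card B') \<ge> \<delta> * real (card (rank1_tensors d n)) \<and>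
             closed_wrt B' (1 - \<epsilon>) C \<and>
             (\<forall>x\<in>C. measure_pmf.prob
                 (Pi_pmf {1..l} 0 (\<lambda>_. pmf_of_set (rank1_tensors d n)))
                 {b. x - (\<Sum>j=1..l. b j) \<in> A} \<ge> c)))"
  shows "\<forall>\<eta>>0. \<exists>k::nat. \<exists>(\<rho>::real)>0.
      \<forall>n :: nat \<Rightarrow> nat. (\<forall>i\<in>{1..d}. n i \<ge> 1) \<longrightarrow>
        (\<forall>A \<subseteq> tensor_space n {1..d}. closed_wrt (rank1_tensors d n) \<eta> A \<longrightarrow>
          (\<exists>D. k_simple d n k D \<and>
             real (card (A \<inter> D)) \<ge> \<rho> * real (card D)))"
proof (intro allI impI)
  fix \<eta> :: real assume "\<eta> > 0"
  let ?I = "{1..d}"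
  \<comment> \<open>The structure theorem fixes the tolerance; \<open>c\<close>,
    \<open>\<delta>\<close> and \<open>l\<close> are then chosen for it, and \<open>k\<close> last,
    from \<open>\<delta>\<close>.\<close>
  obtain \<epsilon> where \<epsilon>: "\<epsilon> > 0" "structured_vanishing \<epsilon> ?I"
    using structured_vanishing_finite[of ?I] by auto
  define Q where "Q c \<delta> l \<longleftrightarrow>
    (\<forall>n :: nat \<Rightarrow> nat. (\<forall>i\<in>{1..d}. n i \<ge> 1) \<longrightarrow>
        (\<forall>A \<subseteq> tensor_space n {1..d}. closed_wrt (rank1_tensors d n) \<eta> A \<longrightarrow>
          (\<exists>B' \<subseteq> rank1_tensors d n. \<exists>C \<subseteq> tensor_space n {1..d}.
             C \<noteq> {} \<and>
             real (card B') \<ge> \<delta> * real (card (rank1_tensors d n)) \<and>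
             closed_wrt B' (1 - \<epsilon>) C \<and>
             (\<forall>x\<in>C. measure_pmf.prob
                 (Pi_pmf {1..l} 0 (\<lambda>_. pmf_of_set (rank1_tensors d n)))
                 {b. x - (\<Sum>j=1..l. b j) \<in> A} \<ge> c))))" for c \<delta> :: real and l :: nat
  have "\<exists>c>0. \<exists>\<delta>>0. \<exists>l>0. Q c \<delta> l"
    unfolding Q_def
    by (rule assms(2)[THEN spec, THEN mp, OF \<open>\<eta> > 0\<close>, THEN spec, THEN mp, OF \<epsilon>(1)])
  then obtain c \<delta> l where c: "c > 0" and \<delta>: "\<delta> > 0" and "Q c \<delta> l" by blast
  note hyp = this(3)[unfolded Q_def]
  from \<epsilon>(2)[unfolded structured_vanishing_def, THEN spec, of "2 ^ d / \<delta>"]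
  obtain k where k: "\<forall>n \<mu>. bounded_density n ?I (2 ^ d / \<delta>) \<mu> \<longrightarrow>
     (\<exists>\<V>. family ?I k \<V> \<and>
       (\<forall>r. multilinear ?I r \<and> mass n ?I \<mu> r \<le> \<epsilon> \<longrightarrow> in_span n ?I \<V> r))"
    by blast
  show "\<exists>k::nat. \<exists>(\<rho>::real)>0.
      \<forall>n :: nat \<Rightarrow> nat. (\<forall>i\<in>{1..d}. n i \<ge> 1) \<longrightarrow>
        (\<forall>A \<subseteq> tensor_space n {1..d}. closed_wrt (rank1_tensors d n) \<eta> A \<longrightarrow>
          (\<exists>D. k_simple d n k D \<and>
             real (card (A \<inter> D)) \<ge> \<rho> * real (card D)))"
  \<comment> \<open>The density 1/4 of \<open>C\<close> in a coset times the proportion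
    \<open>c\<close> kept by averaging.\<close>
  proof (rule exI[of _ k], rule exI[of _ "c / 4"], intro conjI allI impI)
    show "c / 4 > 0" using c by simp
    fix n :: "nat \<Rightarrow> nat" and A
    assume n: "\<forall>i\<in>{1..d}. n i \<ge> 1" and A: "A \<subseteq> tensor_space n {1..d}"
      and A_closed: "closed_wrt (rank1_tensors d n) \<eta> A"
    let ?E = "\<Pi>\<^sub>E i\<in>?I. {..<n i}"
    define p where "p = Pi_pmf {1..l} 0 (\<lambda>_. pmf_of_set (rank1_tensors d n))"
    from hyp[THEN spec, THEN mp, OF n, THEN spec, THEN mp, OF A, THEN mp, OF A_closed, folded p_def]
    obtain B C where BC: "B \<subseteq> rank1_tensors d n" "C \<subseteq> tensor_space n ?I" "C \<noteq> {}"
      "\<delta> * real (card (rank1_tensors d n)) \<le> real (card B)" "closed_wrt B (1 - \<epsilon>) C"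
      "\<And>x. x \<in> C \<Longrightarrow> c \<le> measure_pmf.prob p {b. x - (\<Sum>j=1..l. b j) \<in> A}"
      by blast
    have B: "B \<noteq> {}" "finite B" and pairs: "(1 - \<epsilon>) * card C * card B \<le>
        card {(a, b). a \<in> C \<and> b \<in> B \<and> a + b \<in> C}"
      using BC(5) by (auto simp: closed_wrt_def)
    then have posB: "0 < real (card B)" by (simp add: card_gt_0_iff)
    from rank1_density[OF n BC(1) B(1) \<delta> BC(4)] obtain \<mu> where
      \<mu>: "bounded_density n ?I (2 ^ d / \<delta>) \<mu>"
      "\<And>r. mass n ?I \<mu> (form_of n ?I r) = card {b \<in> B. pairing ?E r b = 1} / card B"
      by blast
    from k[THEN spec, THEN spec, THEN mp, OF \<mu>(1)] obtain \<V> where \<V>: "family ?I k \<V>"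
      "\<And>r. multilinear ?I r \<Longrightarrow> mass n ?I \<mu> r \<le> \<epsilon> \<Longrightarrow> in_span n ?I \<V> r" by blast
    define D where "D = simple_subspace n d (annihilator n \<V>)"
    have codim: "subspace_of_codim_le (annihilator n \<V> J) (tensor_space n J) k" if "J \<subseteq> ?I" for J
      using that \<V>(1) by (intro annihilator_codim) (auto simp: family_def intro: finite_subset)
    have D_sub: "D \<subseteq> tensor_space n ?I"
    proof
      fix x assume "x \<in> D"
      moreover have "?I \<subseteq> ?I \<and> ?I \<noteq> {}" using assms(1) by simp
      ultimately have "x \<in> annihilator n \<V> ?I"
        unfolding D_def simple_subspace_def by (smt (verit, best) INT_D mem_Collect_eq)
      then show "x \<in> tensor_space n ?I" by (simp add: annihilator_def)
    qed
    have "F2.subspace D"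
      unfolding D_def using codim[of ?I]
      by (intro subspace_simple_subspace) (simp add: subspace_of_codim_le_def)
    then have D0: "0 \<in> D" by (rule F2.subspace_0)
    have finT: "finite (tensor_space n ?I)" by (rule finite_tensor_space) simp
    then have finD: "finite D" using D_sub by (rule finite_subset[rotated])
    have "\<exists>t\<in>supported ?E. card D / 4 \<le> card (C \<inter> (\<lambda>x. t + x) ` D)"
    proof (rule dense_coset[OF _ _ BC(3) _ B(1) _ _ pairs \<epsilon>(1) order_refl])
      show "finite ?E" by (intro finite_PiE) auto
      show "C \<subseteq> supported ?E" "B \<subseteq> supported ?E" "D \<subseteq> supported ?E" "D \<noteq> {}"
        using BC(1,2) rank1_subset_tensor_space[of d n] D_sub D0
        unfolding tensor_space_eq_supported[symmetric] by blast+
      fix r s assume r: "card {b \<in> B. pairing ?E r b = 1} \<le> \<epsilon> * card B" and s: "s \<in> D"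
      have "mass n ?I \<mu> (form_of n ?I r) \<le> \<epsilon>"
        unfolding \<mu>(2) using r posB by (simp add: pos_divide_le_eq)
      then have "in_span n ?I \<V> (form_of n ?I r)"
        by (intro \<V>(2) multilinear_form_of) simp
      then show "pairing ?E r s = 0"
        using s unfolding D_def by (rule structured_orthogonal[OF \<V>(1)])
    qed
    then obtain t where t: "t \<in> tensor_space n ?I" "card D / 4 \<le> card (C \<inter> (\<lambda>x. t + x) ` D)"
      by (auto simp: tensor_space_eq_supported)
    define C' where "C' = C \<inter> (\<lambda>x. t + x) ` D"
    have rank1: "rank1_tensors d n \<noteq> {}" using B(1) BC(1) by auto
    have set_p: "set_pmf p = PiE_dflt {1..l} 0 (\<lambda>_. rank1_tensors d n)"
      unfolding p_def using rank1 finite_rank1 by (simp add: set_Pi_pmf comp_def)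
    \<comment> \<open>A single \<open>b\<close> has to serve a proportion \<open>c\<close> of the
      points of \<open>C\<close> in the coset, so that one translate of \<open>D\<close> meets
      \<open>A\<close> in many points.\<close>
    have "\<exists>b\<in>set_pmf p. c * card C' \<le> card {x \<in> C'. x - (\<Sum>j=1..l. b j) \<in> A}"
    proof (rule pmf_exists_ge_average)
      show "finite C'" using finD by (simp add: C'_def)
      show "finite (set_pmf p)" unfolding set_p using finite_rank1 by (intro finite_PiE_dflt) auto
    qed (use BC(6) in \<open>auto simp: C'_def\<close>)
    then obtain b where b: "b \<in> set_pmf p"
      "c * card C' \<le> card {x \<in> C'. x - (\<Sum>j=1..l. b j) \<in> A}" by blast
    define \<sigma> where "\<sigma> = (\<Sum>j=1..l. b j)"
    have "\<sigma> \<in> tensor_space n ?I"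
      unfolding \<sigma>_def
    proof (rule F2.subspace_sum[OF subspace_tensor_space])
      fix j assume "j \<in> {1..l}"
      then have "b j \<in> rank1_tensors d n" using b(1) by (simp add: set_p PiE_dflt_def)
      then show "b j \<in> tensor_space n ?I" using rank1_subset_tensor_space by blast
    qed
    then have t': "t - \<sigma> \<in> tensor_space n ?I"
      using t(1) F2.subspace_diff[OF subspace_tensor_space] by blast
    \<comment> \<open>Subtracting \<open>\<sigma>\<close> changes only the translation, so the same
      subspaces witness simplicity.\<close>
    define D' where "D' = (\<lambda>x. (t - \<sigma>) + x) ` D"
    have "k_simple d n k D'"
      unfolding k_simple_def
      using t' codim by (intro exI[of _ "annihilator n \<V>"] bexI[of _ "t - \<sigma>"] conjI allI impI)
        (auto simp only: D'_def D_def simple_subspace_def)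
    moreover have "c / 4 * card D' \<le> card (A \<inter> D')"
    proof -
      have "card D' \<le> card D" unfolding D'_def by (rule card_image_le[OF finD])
      then have "c / 4 * card D' \<le> c / 4 * card D" using c by (intro mult_left_mono) auto
      also have "\<dots> \<le> c * card C'"
        using mult_left_mono[OF t(2), of c] c by (simp add: C'_def)
      also have "\<dots> \<le> card {x \<in> C'. x - \<sigma> \<in> A}" using b(2) by (simp only: \<sigma>_def)
      also have "real (card {x \<in> C'. x - \<sigma> \<in> A}) \<le> real (card (A \<inter> D'))"
      proof (rule of_nat_mono, rule card_inj_on_le)
        show "inj_on (\<lambda>x. x - \<sigma>) {x \<in> C'. x - \<sigma> \<in> A}" by (simp add: inj_on_def)
        show "finite (A \<inter> D')" using finD by (simp add: D'_def)
        show "(\<lambda>x. x - \<sigma>) ` {x \<in> C'. x - \<sigma> \<in> A} \<subseteq> A \<inter> D'"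
        proof (rule image_subsetI, elim CollectE conjE)
          fix x assume x: "x \<in> C'" "x - \<sigma> \<in> A"
          then obtain y where y: "y \<in> D" "x = t + y" by (auto simp: C'_def)
          have "x - \<sigma> = (t - \<sigma>) + y" unfolding y(2) by (simp only: diff_add_eq)
          with y(1) x(2) show "x - \<sigma> \<in> A \<inter> D'" unfolding D'_def by blast
        qed
      qed
      finally show ?thesis .
    qed
    ultimately show "\<exists>D. k_simple d n k D \<and> real (card (A \<inter> D)) \<ge> c / 4 * real (card D)"
      by blast
  qed
qed

end
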